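(* Let $X$ be a separable Banach manifold, $Y$ a second countable Hilbert manifold, and $G$ a finite dimensional Lie group acting on $Y$ by an action of class $C^1$ such that $\dim D_y$ does not depend on $y\in Y$. Let $A\subset X\times Y$ be an open subset such that $(x,y)\in A$ implies $(x,g\cdot y)\in A$ for all $g\in G$, and let $f:A\to\mathbb R$ be a function of class $C^k$, $k\ge2$, such that $f(x,g\cdot y)=f(x,y)$ for all $(x,y)\in A$ and $g\in G$. For $x\in X$ set $A_x=\{y\in Y:(x,y)\in A\}$ and $f_x=f(x,\cdot):A_x\to\mathbb R$. Assume: (a) for all $(x_0,y_0)$ such that $y_0\in A_{x_0}$ is a critical point of $f_{x_0}$, the Hessian $\mathrm H^{f_{x_0}}(y_0)$ is Fredholm; (b) for all $(x_0,y_0)$ such that $y_0\in A_{x_0}$ is a critical point of $f_{x_0}$ and for all $v\in\mathrm{Ker}\big(\mathrm H^{f_{x_0}}(y_0)\big)\setminus D_{y_0}$ there exists $w\in T_{x_0}X$ such that $\frac{\partial^2 f}{\partial x\,\partial y}(x_0,y_0)(v,w)\ne0$. Let $\Pi:X\times Y\to X$ be the projection. Then the set of $x\in X$ such that the functional $A_x\ni y\mapsto f(x,y)\in\mathbb R$ is a $G$-Morse function is generic in $\Pi(A)$.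
   Context: For $y\in Y$, let $\beta_y:G\to Y$, $\beta_y(g)=g\cdot y$; $D_y\subset T_yY$ is the image of $\mathrm d\beta_y(1):\mathfrak g\to T_yY$, where $\mathfrak g$ is the Lie algebra of $G$ (it is the tangent space at $y$ to the orbit of $y$). A $G$-invariant function $h$ is $G$-nondegenerate at a critical point $y$ if the Hessian $\mathrm H^h(y)$ is strongly nondegenerate (i.e., represented by an isomorphism) when restricted to some closed complement of $D_y$ in $T_yY$; $h$ is $G$-Morse if it is $G$-nondegenerate at each of its critical points. At a critical point $y_0$ of $f_{x_0}$ the mixed derivative $\frac{\partial^2 f}{\partial x\partial y}(x_0,y_0)$ is the well-defined bilinear map $T_{y_0}Y\times T_{x_0}X\to\mathbb R$ obtained by differentiating $x\mapsto\frac{\partial f}{\partial y}(x,y_0)$ at $x_0$. A subset of a topological space is generic if it contains a countable intersection of open dense subsets. *)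

theory Defs
  imports "HOL-Analysis.Analysis" "HOL-Algebra.Group_Action"
begin

section \<open>Maps of class $C^n$ between open subsets of normed spaces\<close>

definition bounded_multilinear ::
    "nat \<Rightarrow> ('a::real_normed_vector list \<Rightarrow> 'b::real_normed_vector) \<Rightarrow> bool" where
  "bounded_multilinear n M \<longleftrightarrow>
     (\<forall>vs. length vs = n \<longrightarrow> (\<forall>i<n. linear (\<lambda>v. M (vs[i := v])))) \<and>
     (\<exists>C. \<forall>vs. length vs = n \<longrightarrow> norm (M vs) \<le> C * prod_list (map norm vs))"

text \<open>
  \<open>D j x\<close> is the \<open>j\<close>-th derivative of \<open>f\<close> at \<open>x\<close>, a bounded \<open>j\<close>-linear map on lists of length \<open>j\<close>.
  The third conjunct says that \<open>D (Suc j)\<close> is the Frechet derivative of \<open>D j\<close>, and the fourth that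
  \<open>D n\<close> is continuous, both for the operator norm on \<open>j\<close>-linear maps. (Derivatives of different
  orders have different types as iterated bounded linear maps, which rules out a recursion on \<open>n\<close>
  over \<open>blinfun\<close>.) The definition is meant for open \<open>S\<close>.
\<close>

definition Ck_on ::
    "nat \<Rightarrow> 'a::real_normed_vector set \<Rightarrow> ('a \<Rightarrow> 'b::real_normed_vector) \<Rightarrow> bool" where
  "Ck_on n S f \<longleftrightarrow> (\<exists>D :: nat \<Rightarrow> 'a \<Rightarrow> 'a list \<Rightarrow> 'b.
     (\<forall>x\<in>S. D 0 x [] = f x) \<and>
     (\<forall>j\<le>n. \<forall>x\<in>S. bounded_multilinear j (D j x)) \<and>
     (\<forall>j<n. \<forall>x\<in>S. \<forall>\<epsilon>>0. \<exists>\<delta>>0. \<forall>y\<in>S. norm (y - x) < \<delta> \<longrightarrow>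
        (\<forall>vs. length vs = j \<longrightarrow>
           norm (D j y vs - D j x vs - D (Suc j) x ((y - x) # vs))
             \<le> \<epsilon> * norm (y - x) * prod_list (map norm vs))) \<and>
     (\<forall>x\<in>S. \<forall>\<epsilon>>0. \<exists>\<delta>>0. \<forall>y\<in>S. norm (y - x) < \<delta> \<longrightarrow>
        (\<forall>vs. length vs = n \<longrightarrow> norm (D n y vs - D n x vs) \<le> \<epsilon> * prod_list (map norm vs))))"

text \<open>The Frechet derivative at a point, as a bounded linear map.\<close>

definition fderiv ::
    "('a::real_normed_vector \<Rightarrow> 'b::real_normed_vector) \<Rightarrow> 'a \<Rightarrow> 'a \<Rightarrow>\<^sub>L 'b" where
  "fderiv f x = Blinfun (frechet_derivative f (at x))"


section \<open>Manifolds\<close>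

text \<open>
  A manifold is a Hausdorff topological space, given by a type, with a $C^\infty$ atlas modelled on
  a normed space: a Banach manifold if the model space is of class \<open>banach\<close>, a Hilbert manifold if
  it is moreover of class \<open>real_inner\<close>. The atlas need not be maximal.
\<close>

type_synonym ('x, 'e) chart = "'x set \<times> ('x \<Rightarrow> 'e)"

definition chart_inv :: "('x, 'e) chart \<Rightarrow> 'e \<Rightarrow> 'x" where
  "chart_inv c = inv_into (fst c) (snd c)"

definition smooth_atlas :: "('x::t2_space, 'e::real_normed_vector) chart set \<Rightarrow> bool" where
  "smooth_atlas \<A> \<longleftrightarrow>
     (\<forall>c\<in>\<A>. open (fst c) \<and> open (snd c ` fst c) \<and>
        homeomorphism (fst c) (snd c ` fst c) (snd c) (chart_inv c)) \<and>
     (\<Union>c\<in>\<A>. fst c) = UNIV \<and>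
     (\<forall>c\<in>\<A>. \<forall>d\<in>\<A>. \<forall>n. Ck_on n (snd c ` (fst c \<inter> fst d)) (snd d \<circ> chart_inv c))"

definition prod_atlas ::
    "('x, 'e) chart set \<Rightarrow> ('y, 'f) chart set \<Rightarrow> ('x \<times> 'y, 'e \<times> 'f) chart set" where
  "prod_atlas \<A> \<B> = {(fst c \<times> fst d, map_prod (snd c) (snd d)) | c d. c \<in> \<A> \<and> d \<in> \<B>}"

definition model_atlas :: "('e, 'e) chart set" where
  "model_atlas = {(UNIV, id)}"

text \<open>Maps of class $C^n$ from an open subset \<open>S\<close> of a manifold to a manifold.\<close>

definition Ck_map ::
    "nat \<Rightarrow> ('x::t2_space, 'e::real_normed_vector) chart set \<Rightarrow> 'x set \<Rightarrow>
     ('y::t2_space, 'f::real_normed_vector) chart set \<Rightarrow> ('x \<Rightarrow> 'y) \<Rightarrow> bool" where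
  "Ck_map n \<A> S \<B> f \<longleftrightarrow> continuous_on S f \<and>
     (\<forall>c\<in>\<A>. \<forall>d\<in>\<B>. Ck_on n (snd c ` (S \<inter> fst c \<inter> f -` fst d)) (snd d \<circ> f \<circ> chart_inv c))"

text \<open>
  The tangent space at \<open>p\<close> is identified with the model space by means of a chart \<open>chart_at \<A> p\<close>
  around \<open>p\<close>, chosen once and for all. Tangent vectors, differentials, Hessians at critical points
  and mixed derivatives are expressed through this identification; a different choice changes them
  by the derivative of a transition map, which is a toplinear isomorphism.
\<close>

definition chart_at :: "('x, 'e) chart set \<Rightarrow> 'x \<Rightarrow> ('x, 'e) chart" where
  "chart_at \<A> p = (SOME c. c \<in> \<A> \<and> p \<in> fst c)"

definition coord :: "('x, 'e) chart set \<Rightarrow> 'x \<Rightarrow> 'x \<Rightarrow> 'e" where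
  "coord \<A> p = snd (chart_at \<A> p)"

definition param :: "('x, 'e) chart set \<Rightarrow> 'x \<Rightarrow> 'e \<Rightarrow> 'x" where
  "param \<A> p = chart_inv (chart_at \<A> p)"

definition differential ::
    "('x, 'e::real_normed_vector) chart set \<Rightarrow> ('y, 'f::real_normed_vector) chart set \<Rightarrow>
     ('x \<Rightarrow> 'y) \<Rightarrow> 'x \<Rightarrow> 'e \<Rightarrow>\<^sub>L 'f" where
  "differential \<A> \<B> f p = fderiv (coord \<B> (f p) \<circ> f \<circ> param \<A> p) (coord \<A> p p)"


section \<open>Critical points, Hessians and mixed derivatives\<close>

text \<open>
  Functions on an open subset of a manifold are represented by total functions; the notions below
  depend only on the germ of the function.
\<close>

definition differential_real ::
    "('y, 'h::real_normed_vector) chart set \<Rightarrow> ('y \<Rightarrow> real) \<Rightarrow> 'y \<Rightarrow> 'h \<Rightarrow>\<^sub>L real" where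
  "differential_real \<B> h y = fderiv (h \<circ> param \<B> y) (coord \<B> y y)"

definition critical_point ::
    "('y, 'h::real_normed_vector) chart set \<Rightarrow> ('y \<Rightarrow> real) \<Rightarrow> 'y \<Rightarrow> bool" where
  "critical_point \<B> h y \<longleftrightarrow> differential_real \<B> h y = 0"

text \<open>The Hessian is intrinsic only at critical points.\<close>

definition hessian ::
    "('y, 'h::real_normed_vector) chart set \<Rightarrow> ('y \<Rightarrow> real) \<Rightarrow> 'y \<Rightarrow> 'h \<Rightarrow>\<^sub>L 'h \<Rightarrow>\<^sub>L real" where
  "hessian \<B> h y = fderiv (fderiv (h \<circ> param \<B> y)) (coord \<B> y y)"

text \<open>
  The derivative at \<open>x\<^sub>0\<close> of the map sending \<open>x\<close> to the differential of \<open>f x\<close> at the fixed point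
  \<open>y\<^sub>0\<close>, as a bilinear map whose first argument is the tangent vector at \<open>x\<^sub>0\<close>.
\<close>

definition mixed_derivative ::
    "('x, 'e::real_normed_vector) chart set \<Rightarrow> ('y, 'h::real_normed_vector) chart set \<Rightarrow>
     ('x \<Rightarrow> 'y \<Rightarrow> real) \<Rightarrow> 'x \<Rightarrow> 'y \<Rightarrow> 'e \<Rightarrow>\<^sub>L 'h \<Rightarrow>\<^sub>L real" where
  "mixed_derivative \<A> \<B> f x\<^sub>0 y\<^sub>0 =
     fderiv ((\<lambda>x. differential_real \<B> (f x) y\<^sub>0) \<circ> param \<A> x\<^sub>0) (coord \<A> x\<^sub>0 x\<^sub>0)"


section \<open>Bilinear forms on Hilbert spaces\<close>

definition finite_dimensional :: "'a::real_vector set \<Rightarrow> bool" where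
  "finite_dimensional V \<longleftrightarrow> (\<exists>B. finite B \<and> V \<subseteq> span B)"

definition fredholm_operator :: "('a::real_normed_vector \<Rightarrow>\<^sub>L 'b::real_normed_vector) \<Rightarrow> bool" where
  "fredholm_operator L \<longleftrightarrow>
     finite_dimensional {v. blinfun_apply L v = 0} \<and>
     closed (range (blinfun_apply L)) \<and>
     (\<exists>C. finite C \<and> span (range (blinfun_apply L) \<union> C) = UNIV)"

text \<open>
  A bounded bilinear form \<open>B\<close> is represented, through the inner product, by a bounded operator.
\<close>

definition fredholm_form :: "('h::real_inner \<Rightarrow>\<^sub>L 'h \<Rightarrow>\<^sub>L real) \<Rightarrow> bool" where
  "fredholm_form B \<longleftrightarrow>
     (\<exists>L :: 'h \<Rightarrow>\<^sub>L 'h.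
        (\<forall>v w. blinfun_apply (blinfun_apply B v) w = blinfun_apply L v \<bullet> w) \<and> fredholm_operator L)"

definition form_kernel :: "('h::real_normed_vector \<Rightarrow>\<^sub>L 'h \<Rightarrow>\<^sub>L real) \<Rightarrow> 'h set" where
  "form_kernel B = {v. \<forall>w. blinfun_apply (blinfun_apply B v) w = 0}"

text \<open>
  The restriction of \<open>B\<close> to the closed subspace \<open>W\<close> is represented by an isomorphism of \<open>W\<close>.
  Linearity of \<open>L\<close> on \<open>W\<close> follows from the bilinearity of \<open>B\<close>.
\<close>

definition strongly_nondegenerate_on ::
    "'h::real_inner set \<Rightarrow> ('h \<Rightarrow>\<^sub>L 'h \<Rightarrow>\<^sub>L real) \<Rightarrow> bool" where
  "strongly_nondegenerate_on W B \<longleftrightarrow>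
     (\<exists>L L'. homeomorphism W W L L' \<and>
        (\<forall>v\<in>W. \<forall>w\<in>W. blinfun_apply (blinfun_apply B v) w = L v \<bullet> w))"

definition closed_complement :: "'h::real_normed_vector set \<Rightarrow> 'h set \<Rightarrow> bool" where
  "closed_complement D W \<longleftrightarrow>
     subspace W \<and> closed W \<and> D \<inter> W = {0} \<and> (\<forall>u. \<exists>d\<in>D. \<exists>w\<in>W. u = d + w)"


section \<open>Lie group actions and \<open>G\<close>-Morse functions\<close>

text \<open>The model space may be zero-dimensional, which class \<open>euclidean_space\<close> would exclude.\<close>

definition lie_group ::
    "('g::t2_space, 'm::banach) chart set \<Rightarrow> ('g, 'k) monoid_scheme \<Rightarrow> bool" where
  "lie_group \<G> G \<longleftrightarrow>
     finite_dimensional (UNIV :: 'm set) \<and> smooth_atlas \<G> \<and> group G \<and> carrier G = UNIV \<and>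
     (\<forall>n. Ck_map n (prod_atlas \<G> \<G>) UNIV \<G> (\<lambda>(a, b). a \<otimes>\<^bsub>G\<^esub> b)) \<and>
     (\<forall>n. Ck_map n \<G> UNIV \<G> (\<lambda>a. inv\<^bsub>G\<^esub> a))"

text \<open>The subspace $D_y$: the image of the differential at the identity of $g \mapsto g \cdot y$.\<close>

definition orbit_tangent ::
    "('g::t2_space, 'm::banach) chart set \<Rightarrow> ('g, 'k) monoid_scheme \<Rightarrow>
     ('y, 'h::real_normed_vector) chart set \<Rightarrow> ('g \<Rightarrow> 'y \<Rightarrow> 'y) \<Rightarrow> 'y \<Rightarrow> 'h set" where
  "orbit_tangent \<G> G \<B> act y =
     range (blinfun_apply (differential \<G> \<B> (\<lambda>g. act g y) \<one>\<^bsub>G\<^esub>))"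

definition G_nondegenerate ::
    "('g::t2_space, 'm::banach) chart set \<Rightarrow> ('g, 'k) monoid_scheme \<Rightarrow>
     ('y, 'h::{real_inner, banach}) chart set \<Rightarrow> ('g \<Rightarrow> 'y \<Rightarrow> 'y) \<Rightarrow> ('y \<Rightarrow> real) \<Rightarrow> 'y \<Rightarrow> bool" where
  "G_nondegenerate \<G> G \<B> act h y \<longleftrightarrow>
     (\<exists>W. closed_complement (orbit_tangent \<G> G \<B> act y) W \<and>
          strongly_nondegenerate_on W (hessian \<B> h y))"

text \<open>\<open>h\<close> is regarded as a function on the open \<open>G\<close>-invariant set \<open>\<Omega>\<close>.\<close>

definition G_Morse ::
    "('g::t2_space, 'm::banach) chart set \<Rightarrow> ('g, 'k) monoid_scheme \<Rightarrow>
     ('y, 'h::{real_inner, banach}) chart set \<Rightarrow> ('g \<Rightarrow> 'y \<Rightarrow> 'y) \<Rightarrow> 'y set \<Rightarrow> ('y \<Rightarrow> real) \<Rightarrow> bool" where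
  "G_Morse \<G> G \<B> act \<Omega> h \<longleftrightarrow>
     (\<forall>y\<in>\<Omega>. critical_point \<B> h y \<longrightarrow> G_nondegenerate \<G> G \<B> act h y)"


section \<open>Generic subsets\<close>

definition generic_in :: "'a topology \<Rightarrow> 'a set \<Rightarrow> bool" where
  "generic_in T S \<longleftrightarrow> S \<subseteq> topspace T \<and>
     (\<exists>U :: nat \<Rightarrow> 'a set. (\<forall>n. openin T (U n) \<and> T closure_of U n = topspace T) \<and> (\<Inter>n. U n) \<subseteq> S)"

end

theory Submission
  imports Defs
begin

text \<open>
  Genericity is a local question on \<open>A\<close>, because the domains of countably many charts form an open
  dense subset of \<open>X\<close> with a countable basis. Near a critical point \<open>(x\<^sub>0, y\<^sub>0)\<close> every \<open>y\<close> is moved by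
  the group into the slice \<open>y\<^sub>0 + W\<close>, where \<open>W\<close> is the orthogonal complement of \<open>D\<close> at \<open>y\<^sub>0\<close>. As \<open>dim D\<close>
  is constant, \<open>W\<close> meets the kernel of the Hessian at each degenerate critical point on the slice.

  Let \<open>J\<close> be an orthonormal basis of the part of the kernel at \<open>(x\<^sub>0, y\<^sub>0)\<close> lying in \<open>W\<close>. By (b) there
  are vectors \<open>e j\<close> (\<open>j \<in> J\<close>) of the model of \<open>X\<close> on which the mixed derivative is dual to \<open>J\<close>. Over
  an affine space parallel to their span, the critical points on the slice are determined, in a
  Lipschitz way, by their \<open>J\<close>-coordinates; at a degenerate one the symmetry of the Hessian gives a
  nonzero covector that annihilates the variation of \<open>x\<close> to first order. This is the situation of
  Sard's theorem for $C^1$ maps between spaces of equal finite dimension, which is proved by counting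
  lattice points, so that neither an implicit function theorem nor a measure is needed.
\<close>

section \<open>Sard's theorem by counting lattice points\<close>

text \<open>The action is only of class $C^1$, so the invariance of \<open>f\<close> cannot be
  differentiated twice. Hessians at two points of an orbit are compared at critical points alone,
  where the term with a second derivative of the action would be multiplied by a vanishing
  differential. For the same reason the orbits are not straightened: the proof studies zeros of the
  full partial differential at points of an affine slice. The constancy of \<open>dim D\<close>
  enters through a count: at a degenerate point the kernel is strictly larger than \<open>D\<close>
  there, hence too large for the projection onto \<open>D\<close> at \<open>y0\<close> to be
  injective on it. Since the Hessian is symmetric, its kernel has the dimension of its cokernel;
  this is why Sard's theorem is needed in equal dimensions only and a differential of class $C^1$
  suffices, whatever the dimension of the kernel. Genericity requires closed nowhere dense sets, so
  closedness of the projected degenerate set is part of the local claim: finitely many coordinates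
  are handled by compactness, the other directions by coercivity of the Hessian.\<close>

lemma mod_eq_imp_eq_nat:
  fixes a b n :: nat
  assumes "a mod n = b mod n" "\<bar>real a - real b\<bar> < real n"
  shows "a = b"
proof -
  have "int n dvd (int a - int b)"
    using assms(1) by (metis mod_eq_dvd_iff zmod_int)
  moreover have "\<bar>int a - int b\<bar> < int n"
    using assms(2) by linarith
  ultimately have "int a - int b = 0"
    using dvd_imp_le_int[of "int a - int b" "int n"] by linarith
  thus ?thesis by simp
qed

text \<open>Read \<open>t\<close> as a function of \<open>q\<close>: it is Lipschitz with constant
  \<open>c\<close>, its variation is annihilated to first order by a covector at each point, and it
  covers a cube, against Sard's theorem. Volume is replaced by the number of lattice points of mesh
  \<open>\<sigma> = \<epsilon> * h\<close> in the cube. There are about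
  \<open>(2 * b / h) ^ p\<close> boxes of side \<open>h\<close> in the space of \<open>q\<close>.
  The Lipschitz bound leaves about \<open>c / \<epsilon>\<close> values of each coordinate per box,
  but the covector leaves only three for one of them. One factor \<open>1 / \<epsilon>\<close> is
  thus missing, and the count fails for small \<open>\<epsilon>\<close>.\<close>

lemma lattice_sard:
  fixes q :: "('i \<Rightarrow> real) \<Rightarrow> 'i \<Rightarrow> real"
  assumes J: "finite J" "J \<noteq> {}" and pos: "\<tau> > 0" "b > 0" "c > 0"
    and T_def: "T = {t. \<forall>j\<in>J. 0 \<le> t j \<and> t j \<le> \<tau>}"
    and q: "\<And>t j. t \<in> T \<Longrightarrow> j \<in> J \<Longrightarrow> \<bar>q t j\<bar> \<le> b"
    and lip: "\<And>t t' h j. t \<in> T \<Longrightarrow> t' \<in> T \<Longrightarrow> (\<And>j. j \<in> J \<Longrightarrow> \<bar>q t' j - q t j\<bar> \<le> h) \<Longrightarrow> j \<in> J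
      \<Longrightarrow> \<bar>t' j - t j\<bar> \<le> c * h"
    and sing: "\<And>\<epsilon>. \<epsilon> > 0 \<Longrightarrow> \<exists>\<delta>>0. \<forall>t\<in>T. \<exists>l. \<exists>i\<in>J. \<bar>l i\<bar> = 1 \<and>
      (\<forall>t'\<in>T. \<forall>h<\<delta>. (\<forall>j\<in>J. \<bar>q t' j - q t j\<bar> \<le> h) \<longrightarrow> \<bar>\<Sum>j\<in>J. l j * (t' j - t j)\<bar> \<le> \<epsilon> * h)"
  shows False
proof -
  define p where "p = card J"
  have p: "p \<ge> 1" using J unfolding p_def by (simp add: card_gt_0_iff Suc_leI)
  \<comment> \<open>The final count reads
    \<open>\<alpha> ^ p \<le> 3 * \<beta> ^ (p - 1) * \<epsilon>\<close> with
    \<open>\<alpha> = \<tau> / (4 * b)\<close> and \<open>\<beta> = 3 * c\<close>; the second bound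
    makes the right side at most half of the left. The bound by \<open>c\<close> gives
    \<open>K + 1 \<le> 3 * c / \<epsilon>\<close>.\<close>
  define \<epsilon> where "\<epsilon> = min c ((\<tau> / (4 * b)) ^ p / (6 * (3 * c) ^ (p - 1)))"
  have \<epsilon>: "\<epsilon> > 0" "\<epsilon> \<le> c" "\<epsilon> \<le> (\<tau> / (4 * b)) ^ p / (6 * (3 * c) ^ (p - 1))"
    unfolding \<epsilon>_def using pos by auto
  obtain \<delta> where \<delta>: "\<delta> > 0" and sing': "\<And>t. t \<in> T \<Longrightarrow> \<exists>l. \<exists>i\<in>J. \<bar>l i\<bar> = 1 \<and>
      (\<forall>t'\<in>T. \<forall>h<\<delta>. (\<forall>j\<in>J. \<bar>q t' j - q t j\<bar> \<le> h) \<longrightarrow> \<bar>\<Sum>j\<in>J. l j * (t' j - t j)\<bar> \<le> \<epsilon> * h)"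
    using sing[OF \<epsilon>(1)] by blast
  define m where "m = nat \<lceil>2 * b / \<delta>\<rceil> + 1"
  have m: "m \<ge> 1" "real m > 2 * b / \<delta>" unfolding m_def by linarith+
  define h where "h = 2 * b / m"
  have h: "h > 0" "h < \<delta>" using m \<delta> pos unfolding h_def
    by (auto simp: field_simps)
  define \<sigma> where "\<sigma> = \<epsilon> * h"
  have \<sigma>: "\<sigma> > 0" unfolding \<sigma>_def using \<epsilon> h by simp
  define M where "M = nat \<lfloor>\<tau> / \<sigma>\<rfloor>"
  have M: "real M \<le> \<tau> / \<sigma>" "\<tau> / \<sigma> \<le> real (M + 1)"
    unfolding M_def using pos \<sigma> real_of_int_floor_add_one_ge[of "\<tau> / \<sigma>"]
    by (simp_all add: of_nat_floor add.commute)
  define K where "K = nat \<lceil>c / \<epsilon>\<rceil>"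
  have K: "c / \<epsilon> \<le> real K" "real K \<le> c / \<epsilon> + 1"
    unfolding K_def using pos \<epsilon> of_int_ceiling_le_add_one[of "c / \<epsilon>"] by (simp_all add: of_nat_ceiling)
  define I where "I = (J \<rightarrow>\<^sub>E {..M})"
  define pt where "pt i = (\<lambda>j. real (i j) * \<sigma>)" for i :: "'i \<Rightarrow> nat"
  have pt: "pt i \<in> T" if "i \<in> I" for i
  proof -
    have "real (i j) * \<sigma> \<le> \<tau>" if "j \<in> J" for j
    proof -
      have "i j \<le> M" using that \<open>i \<in> I\<close> unfolding I_def by auto
      hence "real (i j) \<le> \<tau> / \<sigma>" using M(1) by linarith
      thus ?thesis using \<sigma> by (simp add: field_simps)
    qed
    thus ?thesis unfolding T_def pt_def using \<sigma> by auto
  qed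
  \<comment> \<open>Since \<open>q\<close> ranges over an interval of length
    \<open>2 * b = m * h\<close>, the indices run from 0 to \<open>m\<close>; the index
    \<open>m\<close> occurs at the right end point only and raises the count to \<open>m + 1\<close>
    per coordinate.\<close>
  define cell where "cell i = restrict (\<lambda>j. nat \<lfloor>(q (pt i) j + b) / h\<rfloor>) J" for i
  define Cells where "Cells = (J \<rightarrow>\<^sub>E {..m})"
  have cell: "cell i \<in> Cells" if "i \<in> I" for i
  proof -
    have "nat \<lfloor>(q (pt i) j + b) / h\<rfloor> \<le> m" if "j \<in> J" for j
    proof -
      have "q (pt i) j + b \<le> 2 * b" using q[OF pt[OF \<open>i \<in> I\<close>] that] by linarith
      hence "(q (pt i) j + b) / h \<le> m"
        using pos m(1) h(1) unfolding h_def by (simp add: field_simps)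
      thus ?thesis by linarith
    qed
    thus ?thesis unfolding cell_def Cells_def by auto
  qed
  have finI: "finite I" unfolding I_def using J by (intro finite_PiE) auto
  have near: "\<bar>q (pt i) j - q (pt i') j\<bar> \<le> h" if "i \<in> I" "i' \<in> I" "cell i = cell i'" "j \<in> J" for i i' j
  proof -
    have eq: "nat \<lfloor>(q (pt i) j + b) / h\<rfloor> = nat \<lfloor>(q (pt i') j + b) / h\<rfloor>"
      using fun_cong[OF that(3), of j] that(4) unfolding cell_def by (simp only: restrict_apply if_True)
    have "(q (pt i) j + b) / h \<ge> 0" "(q (pt i') j + b) / h \<ge> 0"
      using q[OF pt[OF that(1)] that(4)] q[OF pt[OF that(2)] that(4)] h(1) by auto
    hence "\<lfloor>(q (pt i) j + b) / h\<rfloor> = \<lfloor>(q (pt i') j + b) / h\<rfloor>"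
      using eq by (simp only: eq_nat_nat_iff zero_le_floor)
    hence "\<bar>(q (pt i) j + b) / h - (q (pt i') j + b) / h\<bar> \<le> 1"
      by linarith
    hence "\<bar>q (pt i) j - q (pt i') j\<bar> / h \<le> 1"
      using h(1) by (simp add: abs_divide flip: diff_divide_distrib)
    thus ?thesis using h(1) by (simp add: field_simps)
  qed
  have fibre: "card {i \<in> I. cell i = k} \<le> 3 * (K + 1) ^ (p - 1)" for k
  proof (cases "{i \<in> I. cell i = k} = {}")
    case True
    thus ?thesis by (metis card.empty zero_le)
  next
    case False
    let ?F = "{i \<in> I. cell i = k}"
    obtain a where a: "a \<in> I" "cell a = k" using False by auto
    obtain l j0 where j0: "j0 \<in> J" and l: "\<bar>l j0\<bar> = 1"
      and sm: "\<And>t' h. t' \<in> T \<Longrightarrow> h < \<delta> \<Longrightarrow> (\<And>j. j \<in> J \<Longrightarrow> \<bar>q t' j - q (pt a) j\<bar> \<le> h) \<Longrightarrow>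
        \<bar>\<Sum>j\<in>J. l j * (t' j - pt a j)\<bar> \<le> \<epsilon> * h"
      using sing'[OF pt[OF a(1)]] by blast
    \<comment> \<open>Residues separate the points of a fibre. Off \<open>j0\<close> two indices
      differ by at most \<open>c / \<epsilon>\<close>, which is less than \<open>K + 1\<close>. Once
      these agree, both points are compared with \<open>a\<close> in the direction
      \<open>j0\<close>, each up to \<open>\<sigma>\<close>, so their indices differ by at most 2
      and the modulus 3 suffices.\<close>
    define r where "r j = (if j = j0 then 3 else K + 1)" for j
    define \<Phi> where "\<Phi> i = restrict (\<lambda>j. i j mod r j) J" for i :: "'i \<Rightarrow> nat"
    have inj: "inj_on \<Phi> ?F"
    proof (rule inj_onI)
      fix i i' assume i: "i \<in> ?F" "i' \<in> ?F" and eq: "\<Phi> i = \<Phi> i'"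
      have md: "i j mod r j = i' j mod r j" if "j \<in> J" for j
        using fun_cong[OF eq, of j] that unfolding \<Phi>_def by (simp only: restrict_apply if_True)
      have others: "i j = i' j" if j: "j \<in> J" "j \<noteq> j0" for j
      proof -
        have "\<bar>pt i j - pt i' j\<bar> \<le> c * h"
          using i j by (intro lip[OF pt pt near]) auto
        hence "\<bar>real (i j) - real (i' j)\<bar> * \<sigma> \<le> c * h"
          unfolding pt_def using \<sigma> by (simp add: abs_mult flip: left_diff_distrib)
        hence "\<bar>real (i j) - real (i' j)\<bar> \<le> c / \<epsilon>"
          unfolding \<sigma>_def using \<epsilon>(1) h(1) by (simp add: field_simps)
        also have "\<dots> < real (K + 1)" using K by simp
        finally show ?thesis
          using md[OF j(1)] j(2) by (intro mod_eq_imp_eq_nat[of "i j" "K + 1" "i' j"]) (simp_all add: r_def)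
      qed
      have s: "\<bar>\<Sum>j\<in>J. l j * (pt x j - pt a j)\<bar> \<le> \<sigma>" if "x \<in> ?F" for x
        unfolding \<sigma>_def using that a by (intro sm pt h near) auto
      have "(\<Sum>j\<in>J. l j * (pt i j - pt a j)) - (\<Sum>j\<in>J. l j * (pt i' j - pt a j))
          = (\<Sum>j\<in>J. l j * (pt i j - pt i' j))"
        by (simp add: algebra_simps flip: sum_subtractf)
      also have "\<dots> = (\<Sum>j\<in>{j0}. l j * (pt i j - pt i' j))"
        using J j0 others by (intro sum.mono_neutral_right) (auto simp: pt_def)
      finally have "\<bar>l j0 * (pt i j0 - pt i' j0)\<bar> \<le> 2 * \<sigma>"
        using s[OF i(1)] s[OF i(2)] unfolding sum.insert_remove[OF finite.emptyI] by simp
      hence "\<bar>real (i j0) - real (i' j0)\<bar> * \<sigma> \<le> 2 * \<sigma>"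
        unfolding pt_def using \<sigma> l by (simp add: abs_mult flip: left_diff_distrib)
      hence "\<bar>real (i j0) - real (i' j0)\<bar> < real 3" using \<sigma> by simp
      hence "i j0 = i' j0"
        using md[OF j0] by (intro mod_eq_imp_eq_nat[of "i j0" 3 "i' j0"]) (simp_all add: r_def)
      hence "i j = i' j" if "j \<in> J" for j using others that by auto
      thus "i = i'" using i unfolding I_def by (intro PiE_ext[of i J "\<lambda>_. {..M}" i']) auto
    qed
    have "card ?F \<le> card (PiE J (\<lambda>j. {..<r j}))"
    proof (rule card_inj_on_le[OF inj])
      show "\<Phi> ` ?F \<subseteq> PiE J (\<lambda>j. {..<r j})" unfolding \<Phi>_def r_def by auto
      show "finite (PiE J (\<lambda>j. {..<r j}))" using J by (intro finite_PiE) auto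
    qed
    also have "\<dots> = (\<Prod>j\<in>J. r j)" using J by (simp add: card_PiE)
    also have "\<dots> = r j0 * (\<Prod>j\<in>J - {j0}. r j)" using J j0 by (simp add: prod.remove)
    also have "(\<Prod>j\<in>J - {j0}. r j) = (\<Prod>j\<in>J - {j0}. K + 1)"
      by (intro prod.cong) (auto simp: r_def)
    also have "r j0 * \<dots> = 3 * (K + 1) ^ (p - 1)"
      using J j0 unfolding r_def p_def by simp
    finally show ?thesis .
  qed
  have "I = (\<Union>k\<in>Cells. {i \<in> I. cell i = k})" using cell by auto
  hence "card I \<le> (\<Sum>k\<in>Cells. card {i \<in> I. cell i = k})"
    using card_UN_le[of Cells "\<lambda>k. {i \<in> I. cell i = k}"] J unfolding Cells_def
    by (simp add: finite_PiE)
  also have "\<dots> \<le> (\<Sum>k\<in>Cells. 3 * (K + 1) ^ (p - 1))" by (intro sum_mono fibre)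
  also have "\<dots> = (m + 1) ^ p * (3 * (K + 1) ^ (p - 1))"
    unfolding Cells_def p_def using J by (simp add: card_PiE)
  finally have "(M + 1) ^ p \<le> (m + 1) ^ p * (3 * (K + 1) ^ (p - 1))"
    unfolding I_def p_def using J by (simp add: card_PiE)
  hence "real ((M + 1) ^ p) \<le> real ((m + 1) ^ p * (3 * (K + 1) ^ (p - 1)))"
    by (simp only: of_nat_le_iff)
  hence count: "real (M + 1) ^ p \<le> real (m + 1) ^ p * (3 * real (K + 1) ^ (p - 1))"
    by (simp only: of_nat_mult of_nat_power of_nat_numeral)
  \<comment> \<open>\<open>R = 2 * m\<close> bounds \<open>m + 1\<close>. The 4 in
    \<open>\<alpha>\<close> results from writing \<open>\<tau> / \<sigma>\<close>, with
    \<open>h = 2 * b / m\<close>, as \<open>R * (\<alpha> / \<epsilon>)\<close>, so that the powers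
    of \<open>R\<close> cancel.\<close>
  define R \<alpha> \<beta> where "R = 2 * real m" and "\<alpha> = \<tau> / (4 * b)" and "\<beta> = 3 * c"
  have R: "R > 0" and \<alpha>: "\<alpha> > 0" and \<beta>: "\<beta> > 0"
    using m pos unfolding R_def \<alpha>_def \<beta>_def by auto
  have \<epsilon>3: "\<epsilon> \<le> \<alpha> ^ p / (6 * \<beta> ^ (p - 1))" using \<epsilon>(3) unfolding \<alpha>_def \<beta>_def .
  have "(\<tau> / \<sigma>) ^ p \<le> real (M + 1) ^ p" using M pos \<sigma> by (intro power_mono) auto
  also note count
  also have "real (m + 1) ^ p * (3 * real (K + 1) ^ (p - 1)) \<le> R ^ p * (3 * (\<beta> / \<epsilon>) ^ (p - 1))"
  proof -
    have "real (K + 1) \<le> \<beta> / \<epsilon>" using K(2) \<epsilon>(1,2) unfolding \<beta>_def by (auto simp: field_simps)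
    moreover have "real (m + 1) \<le> R" using m(1) unfolding R_def by simp
    ultimately show ?thesis using R \<beta> \<epsilon> by (intro mult_mono power_mono) auto
  qed
  finally have "(\<tau> / \<sigma>) ^ p \<le> R ^ p * (3 * (\<beta> / \<epsilon>) ^ (p - 1))" .
  moreover have "\<tau> / \<sigma> = R * (\<alpha> / \<epsilon>)"
    unfolding \<sigma>_def h_def R_def \<alpha>_def using pos \<epsilon>(1) m(1) by (simp add: field_simps)
  ultimately have "R ^ p * (\<alpha> / \<epsilon>) ^ p \<le> R ^ p * (3 * (\<beta> / \<epsilon>) ^ (p - 1))"
    by (simp only: power_mult_distrib)
  hence "(\<alpha> / \<epsilon>) ^ p \<le> 3 * (\<beta> / \<epsilon>) ^ (p - 1)"
    using R by (simp add: mult_le_cancel_left_pos)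
  hence "(\<alpha> / \<epsilon>) ^ p * \<epsilon> ^ p \<le> 3 * (\<beta> / \<epsilon>) ^ (p - 1) * \<epsilon> ^ p"
    using \<epsilon>(1) by (intro mult_right_mono) auto
  also have "(\<alpha> / \<epsilon>) ^ p * \<epsilon> ^ p = \<alpha> ^ p"
    using \<epsilon>(1) by (simp flip: power_mult_distrib)
  also have "3 * (\<beta> / \<epsilon>) ^ (p - 1) * \<epsilon> ^ p = 3 * ((\<beta> / \<epsilon>) ^ (p - 1) * \<epsilon> ^ (p - 1)) * \<epsilon>"
    using p by (cases p) auto
  also have "(\<beta> / \<epsilon>) ^ (p - 1) * \<epsilon> ^ (p - 1) = \<beta> ^ (p - 1)"
    using \<epsilon>(1) by (simp flip: power_mult_distrib)
  finally have 1: "\<alpha> ^ p \<le> 3 * \<beta> ^ (p - 1) * \<epsilon>" .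
  have "3 * \<beta> ^ (p - 1) * \<epsilon> \<le> \<alpha> ^ p / 2"
    using \<epsilon>3 \<beta> by (simp add: field_simps)
  moreover have "\<alpha> ^ p > 0" using \<alpha> by simp
  ultimately show False using 1 by linarith
qed

section \<open>Symmetry of the second derivative\<close>

text \<open>The second difference is the increment over \<open>[0, t]\<close> of a function of one
  variable \<open>r\<close>, so a single application of the mean value theorem turns it into a
  difference of two values of \<open>g\<close>, each compared with the expansion of \<open>g\<close>
  at \<open>p\<close>.\<close>

lemma second_difference_estimate:
  fixes f :: "'a::real_normed_vector \<Rightarrow> real" and g :: "'a \<Rightarrow> 'a \<Rightarrow>\<^sub>L real" and B :: "'a \<Rightarrow> 'a \<Rightarrow>\<^sub>L real"
  assumes f: "\<And>x. norm (x - p) < \<delta> \<Longrightarrow> (f has_derivative blinfun_apply (g x)) (at x)"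
    and g: "\<And>x. norm (x - p) < \<delta> \<Longrightarrow> norm (g x - g p - B (x - p)) \<le> \<epsilon> * norm (x - p)"
    and B: "linear B" and "\<epsilon> \<ge> 0" "t > 0" "t * s < \<delta>" "norm u + norm v \<le> s"
  shows "\<bar>f (p + t *\<^sub>R u + t *\<^sub>R v) - f (p + t *\<^sub>R u) - f (p + t *\<^sub>R v) + f p - t\<^sup>2 * B v u\<bar>
    \<le> 2 * \<epsilon> * t\<^sup>2 * s\<^sup>2"
proof -
  define \<phi> where "\<phi> r = f (p + r *\<^sub>R u + t *\<^sub>R v) - f (p + r *\<^sub>R u)" for r
  have s: "s \<ge> 0" "norm u \<le> s" "norm v \<le> s" using assms(7) norm_ge_zero[of u] norm_ge_zero[of v] by linarith+
  have n1: "norm ((p + r *\<^sub>R u + t *\<^sub>R v) - p) \<le> t * s" if "0 \<le> r" "r \<le> t" for r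
  proof -
    have "norm ((p + r *\<^sub>R u + t *\<^sub>R v) - p) \<le> r * norm u + t * norm v"
      using that \<open>t > 0\<close> by (simp add: add.assoc) (metis abs_of_nonneg abs_of_pos norm_scaleR norm_triangle_ineq)
    also have "\<dots> \<le> t * norm u + t * norm v" using that by (intro add_mono mult_right_mono) auto
    also have "\<dots> \<le> t * s" using assms(5,7) by (simp flip: distrib_left)
    finally show ?thesis .
  qed
  have n2: "norm ((p + r *\<^sub>R u) - p) \<le> t * s" if "0 \<le> r" "r \<le> t" for r
    using that s by (simp add: mult_mono)
  have der: "(\<phi> has_real_derivative (g (p + r *\<^sub>R u + t *\<^sub>R v) u - g (p + r *\<^sub>R u) u)) (at r)"
    if r: "0 \<le> r" "r \<le> t" for r
  proof -
    have 1: "((\<lambda>r. p + r *\<^sub>R u + t *\<^sub>R v) has_derivative (\<lambda>h. h *\<^sub>R u)) (at r)"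
      by (auto intro!: derivative_eq_intros)
    have 2: "((\<lambda>r. p + r *\<^sub>R u) has_derivative (\<lambda>h. h *\<^sub>R u)) (at r)"
      by (auto intro!: derivative_eq_intros)
    have "(\<phi> has_derivative (\<lambda>h. g (p + r *\<^sub>R u + t *\<^sub>R v) (h *\<^sub>R u) - g (p + r *\<^sub>R u) (h *\<^sub>R u))) (at r)"
      unfolding \<phi>_def
      using n1[OF r] n2[OF r] assms(6)
      by (intro has_derivative_diff has_derivative_compose[OF 1 f] has_derivative_compose[OF 2 f]) auto
    thus ?thesis
      by (rule has_derivative_imp_has_field_derivative) (simp add: blinfun.scaleR_right right_diff_distrib)
  qed
  obtain r where r: "0 < r" "r < t"
    and mvt: "\<phi> t - \<phi> 0 = (t - 0) * (g (p + r *\<^sub>R u + t *\<^sub>R v) u - g (p + r *\<^sub>R u) u)"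
    using MVT2[OF \<open>t > 0\<close>, of \<phi> "\<lambda>r. g (p + r *\<^sub>R u + t *\<^sub>R v) u - g (p + r *\<^sub>R u) u"] der
    by blast
  have a: "norm (g (p + r *\<^sub>R u + t *\<^sub>R v) - g p - B (r *\<^sub>R u + t *\<^sub>R v)) \<le> \<epsilon> * (t * s)"
  proof -
    have 1: "(p + r *\<^sub>R u + t *\<^sub>R v) - p = r *\<^sub>R u + t *\<^sub>R v" by simp
    show ?thesis
      using g[of "p + r *\<^sub>R u + t *\<^sub>R v"] n1[of r] r assms(6) mult_left_mono[OF n1[of r] assms(4)]
      unfolding 1 by linarith
  qed
  have b: "norm (g (p + r *\<^sub>R u) - g p - B (r *\<^sub>R u)) \<le> \<epsilon> * (t * s)"
  proof -
    have 1: "(p + r *\<^sub>R u) - p = r *\<^sub>R u" by simp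
    show ?thesis
      using g[of "p + r *\<^sub>R u"] n2[of r] r assms(6) mult_left_mono[OF n2[of r] assms(4)]
      unfolding 1 by linarith
  qed
  have "g (p + r *\<^sub>R u + t *\<^sub>R v) - g (p + r *\<^sub>R u) - t *\<^sub>R B v =
      (g (p + r *\<^sub>R u + t *\<^sub>R v) - g p - B (r *\<^sub>R u + t *\<^sub>R v)) - (g (p + r *\<^sub>R u) - g p - B (r *\<^sub>R u))"
    by (simp add: linear_add[OF B] linear_scale[OF B])
  also have "norm \<dots> \<le> \<epsilon> * (t * s) + \<epsilon> * (t * s)"
    by (rule order_trans[OF norm_triangle_ineq4 add_mono[OF a b]])
  finally have c: "norm (g (p + r *\<^sub>R u + t *\<^sub>R v) - g (p + r *\<^sub>R u) - t *\<^sub>R B v) \<le> 2 * \<epsilon> * t * s"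
    by (simp add: mult_ac)
  have "\<bar>g (p + r *\<^sub>R u + t *\<^sub>R v) u - g (p + r *\<^sub>R u) u - t * B v u\<bar> \<le> 2 * \<epsilon> * t * s * norm u"
    using norm_blinfun[of "g (p + r *\<^sub>R u + t *\<^sub>R v) - g (p + r *\<^sub>R u) - t *\<^sub>R B v" u]
      mult_right_mono[OF c norm_ge_zero[of u]]
    by (simp add: blinfun.bilinear_simps)
  also have "\<dots> \<le> 2 * \<epsilon> * t * s * s"
    using s assms(4,5) by (intro mult_left_mono) auto
  finally have d: "\<bar>g (p + r *\<^sub>R u + t *\<^sub>R v) u - g (p + r *\<^sub>R u) u - t * B v u\<bar> \<le> 2 * \<epsilon> * t * s * s" .
  have "f (p + t *\<^sub>R u + t *\<^sub>R v) - f (p + t *\<^sub>R u) - f (p + t *\<^sub>R v) + f p - t\<^sup>2 * B v u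
      = t * (g (p + r *\<^sub>R u + t *\<^sub>R v) u - g (p + r *\<^sub>R u) u - t * B v u)"
    using mvt unfolding \<phi>_def by (simp add: algebra_simps power2_eq_square)
  also have "\<bar>\<dots>\<bar> \<le> t * (2 * \<epsilon> * t * s * s)"
    using d \<open>t > 0\<close> by (simp add: abs_mult)
  also have "\<dots> = 2 * \<epsilon> * t\<^sup>2 * s\<^sup>2" by (simp add: power2_eq_square)
  finally show ?thesis .
qed

text \<open>The second difference is symmetric in \<open>u\<close> and \<open>v\<close>, so
  \<open>t\<^sup>2 * B u v\<close> and \<open>t\<^sup>2 * B v u\<close> both approximate it up to
  \<open>2 * \<epsilon> * t\<^sup>2 * s\<^sup>2\<close>; dividing by \<open>t\<^sup>2\<close> leaves
  an arbitrarily small error.\<close>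

lemma second_derivative_symmetric:
  fixes f :: "'a::real_normed_vector \<Rightarrow> real" and g :: "'a \<Rightarrow> 'a \<Rightarrow>\<^sub>L real" and B :: "'a \<Rightarrow> 'a \<Rightarrow>\<^sub>L real"
  assumes S: "open S" "p \<in> S"
    and f: "\<And>x. x \<in> S \<Longrightarrow> (f has_derivative blinfun_apply (g x)) (at x)"
    and g: "(g has_derivative B) (at p)"
  shows "B u v = B v u"
proof -
  have B: "linear B" using g by (simp add: has_derivative_linear)
  define s where "s = norm u + norm v + 1"
  have s: "s > 0" unfolding s_def by (simp add: add_nonneg_pos)
  have small: "\<bar>B u v - B v u\<bar> \<le> 4 * s\<^sup>2 * \<epsilon>" if eps: "\<epsilon> > 0" for \<epsilon>
  proof -
    obtain \<delta>1 where \<delta>1: "\<delta>1 > 0" "\<And>x. norm (x - p) < \<delta>1 \<Longrightarrow> norm (g x - g p - B (x - p)) \<le> \<epsilon> * norm (x - p)"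
      using has_derivative_at_alt[THEN iffD1, OF g, THEN conjunct2, rule_format, OF eps] by blast
    obtain \<delta>2 where \<delta>2: "\<delta>2 > 0" "ball p \<delta>2 \<subseteq> S" using S openE by blast
    define \<delta> where "\<delta> = min \<delta>1 \<delta>2"
    define t where "t = \<delta> / (2 * s)"
    have t: "t > 0" "t * s < \<delta>" unfolding t_def \<delta>_def using s \<delta>1 \<delta>2 by auto
    have f': "(f has_derivative blinfun_apply (g x)) (at x)" if "norm (x - p) < \<delta>" for x
      using that \<delta>2 unfolding \<delta>_def by (intro f) (auto simp: dist_norm norm_minus_commute)
    have g': "norm (g x - g p - B (x - p)) \<le> \<epsilon> * norm (x - p)" if "norm (x - p) < \<delta>" for x
      using that unfolding \<delta>_def by (intro \<delta>1) auto
    have "\<bar>f (p + t *\<^sub>R u + t *\<^sub>R v) - f (p + t *\<^sub>R u) - f (p + t *\<^sub>R v) + f p - t\<^sup>2 * B v u\<bar> \<le> 2 * \<epsilon> * t\<^sup>2 * s\<^sup>2"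
      using eps t by (intro second_difference_estimate[OF f' g' B]) (auto simp: s_def)
    moreover have "\<bar>f (p + t *\<^sub>R v + t *\<^sub>R u) - f (p + t *\<^sub>R v) - f (p + t *\<^sub>R u) + f p - t\<^sup>2 * B u v\<bar> \<le> 2 * \<epsilon> * t\<^sup>2 * s\<^sup>2"
      using eps t by (intro second_difference_estimate[OF f' g' B]) (auto simp: s_def)
    moreover have "p + t *\<^sub>R v + t *\<^sub>R u = p + t *\<^sub>R u + t *\<^sub>R v" by simp
    ultimately have "\<bar>t\<^sup>2 * B u v - t\<^sup>2 * B v u\<bar> \<le> 2 * (2 * \<epsilon> * t\<^sup>2 * s\<^sup>2)"
      unfolding abs_le_iff by auto
    also have "t\<^sup>2 * B u v - t\<^sup>2 * B v u = t\<^sup>2 * (B u v - B v u)" by (simp add: right_diff_distrib)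
    finally have "t\<^sup>2 * \<bar>B u v - B v u\<bar> \<le> t\<^sup>2 * (4 * s\<^sup>2 * \<epsilon>)"
      by (simp add: abs_mult mult_ac)
    thus ?thesis using t(1) by simp
  qed
  have "\<bar>B u v - B v u\<bar> \<le> 0 + e" if "e > 0" for e
    using small[of "e / (4 * s\<^sup>2)"] that s by simp
  hence "\<bar>B u v - B v u\<bar> \<le> 0" by (rule field_le_epsilon)
  thus ?thesis by simp
qed

section \<open>Orthogonal projections\<close>

text \<open>A minimising sequence is Cauchy by the parallelogram law, because midpoints stay in
  \<open>M\<close> and are no closer to \<open>x\<close> than the infimum. It is applied to the
  range of a Fredholm operator, which may have infinite dimension.\<close>

lemma closed_subspace_nearest:
  fixes M :: "'a::{real_inner,complete_space} set"
  assumes "subspace M" "closed M"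
  obtains m where "m \<in> M" "\<And>z. z \<in> M \<Longrightarrow> (x - m) \<bullet> z = 0"
proof -
  define d where "d = infdist x M"
  have ne: "M \<noteq> {}" using assms(1) subspace_0 by auto
  have d0: "d \<ge> 0" unfolding d_def by (rule infdist_nonneg)
  have dle: "d\<^sup>2 \<le> (norm (x - m))\<^sup>2" if "m \<in> M" for m
    using infdist_le[OF that, of x] d0 unfolding d_def dist_norm by (intro power_mono) auto
  have "\<exists>m\<in>M. (norm (x - m))\<^sup>2 < d\<^sup>2 + 1 / real (Suc n)" for n
  proof -
    have "d < sqrt (d\<^sup>2 + 1 / real (Suc n))"
      using d0 by (intro real_less_rsqrt) auto
    then obtain m where "m \<in> M" "dist x m < sqrt (d\<^sup>2 + 1 / real (Suc n))"
      using ne cINF_greatest[of M "sqrt (d\<^sup>2 + 1 / real (Suc n))" "dist x"]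
      unfolding d_def infdist_notempty[OF ne] by (meson not_le)
    hence "(norm (x - m))\<^sup>2 < (sqrt (d\<^sup>2 + 1 / real (Suc n)))\<^sup>2"
      unfolding dist_norm by (intro power_strict_mono) auto
    thus ?thesis using \<open>m \<in> M\<close> by (auto simp: real_sqrt_pow2)
  qed
  then obtain m where m: "\<And>n. m n \<in> M" "\<And>n. (norm (x - m n))\<^sup>2 < d\<^sup>2 + 1 / real (Suc n)"
    by metis
  have close: "(norm (m i - m j))\<^sup>2 \<le> 2 / real (Suc i) + 2 / real (Suc j)" for i j
  proof -
    have "(1/2) *\<^sub>R (m i + m j) \<in> M" using m(1) assms(1) by (simp add: subspace_add subspace_scale)
    hence "4 * d\<^sup>2 \<le> 4 * (norm (x - (1/2) *\<^sub>R (m i + m j)))\<^sup>2" using dle by simp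
    also have "\<dots> = (norm (2 *\<^sub>R (x - (1/2) *\<^sub>R (m i + m j))))\<^sup>2" by (simp add: power_mult_distrib)
    also have "2 *\<^sub>R (x - (1/2) *\<^sub>R (m i + m j)) = (x - m i) + (x - m j)"
      by (simp add: algebra_simps flip: scaleR_add_left) (simp add: scaleR_2)
    finally have "4 * d\<^sup>2 \<le> (norm ((x - m i) + (x - m j)))\<^sup>2" .
    moreover have "(norm ((x - m i) + (x - m j)))\<^sup>2 + (norm ((x - m i) - (x - m j)))\<^sup>2
        = 2 * (norm (x - m i))\<^sup>2 + 2 * (norm (x - m j))\<^sup>2"
      by (simp only: power2_norm_eq_inner) (simp add: inner_simps inner_commute)
    moreover have "norm ((x - m i) - (x - m j)) = norm (m i - m j)"
      by (simp add: norm_minus_commute)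
    ultimately show ?thesis using m(2)[of i] m(2)[of j] by simp
  qed
  have "Cauchy m"
  proof (rule metric_CauchyI)
    fix e :: real assume e: "e > 0"
    obtain N where N: "4 / e\<^sup>2 < real (Suc N)"
      using reals_Archimedean2[of "4 / e\<^sup>2"] by (metis less_Suc_eq of_nat_less_iff order_less_trans)
    show "\<exists>N. \<forall>i\<ge>N. \<forall>j\<ge>N. dist (m i) (m j) < e"
    proof (intro exI allI impI)
      fix i j assume ij: "N \<le> i" "N \<le> j"
      have "2 / real (Suc i) + 2 / real (Suc j) \<le> 2 / real (Suc N) + 2 / real (Suc N)"
        using ij by (intro add_mono divide_left_mono) auto
      also have "\<dots> = 4 / real (Suc N)" by (simp flip: add_divide_distrib)
      also have "\<dots> < e\<^sup>2" using N e by (simp add: divide_less_eq mult.commute)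
      finally have "(norm (m i - m j))\<^sup>2 < e\<^sup>2" using close[of i j] by linarith
      thus "dist (m i) (m j) < e" unfolding dist_norm using e by (intro power2_less_imp_less[of _ e]) auto
    qed
  qed
  then obtain l where l: "m \<longlonglongrightarrow> l" using Cauchy_convergent convergent_def by blast
  have lM: "l \<in> M" using closed_sequentially[OF assms(2) _ l] m(1) by blast
  have "(\<lambda>n. (norm (x - m n))\<^sup>2) \<longlonglongrightarrow> (norm (x - l))\<^sup>2" by (intro tendsto_intros l)
  moreover have "(\<lambda>n. d\<^sup>2 + 1 / real (Suc n)) \<longlonglongrightarrow> d\<^sup>2 + 0"
    by (intro tendsto_intros LIMSEQ_inverse_real_of_nat[unfolded inverse_eq_divide])
  ultimately have "(norm (x - l))\<^sup>2 \<le> d\<^sup>2 + 0"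
    by (rule LIMSEQ_le) (use m(2) less_imp_le in blast)
  hence min: "(norm (x - l))\<^sup>2 \<le> (norm (x - w))\<^sup>2" if "w \<in> M" for w using dle[OF that] by linarith
  have "(x - l) \<bullet> z = 0" if z: "z \<in> M" for z
  proof (cases "z = 0")
    case False
    \<comment> \<open>\<open>l + a *\<^sub>R z\<close> is the point nearest to \<open>x\<close> on
      the line through \<open>l\<close> with direction \<open>z\<close>; minimality of
      \<open>l\<close> forces the gain to vanish.\<close>
    define a where "a = ((x - l) \<bullet> z) / (z \<bullet> z)"
    have zz: "z \<bullet> z > 0" using False by simp
    have "l + a *\<^sub>R z \<in> M" using lM z assms(1) by (simp add: subspace_add subspace_scale)
    hence "(norm (x - l))\<^sup>2 \<le> (norm ((x - l) - a *\<^sub>R z))\<^sup>2" using min by (metis diff_diff_add)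
    also have "\<dots> = (norm (x - l))\<^sup>2 - 2 * (a * ((x - l) \<bullet> z)) + a * a * (z \<bullet> z)"
      unfolding power2_norm_eq_inner by (simp add: inner_diff_left inner_diff_right inner_commute algebra_simps)
    also have "\<dots> = (norm (x - l))\<^sup>2 - ((x - l) \<bullet> z)\<^sup>2 / (z \<bullet> z)"
      unfolding a_def using zz by (simp add: power2_eq_square)
    finally show ?thesis using zz by (simp add: divide_le_0_iff)
  qed simp
  thus ?thesis using that lM by blast
qed

definition orthonormal :: "'a::real_inner set \<Rightarrow> bool" where
  "orthonormal J \<longleftrightarrow> (\<forall>i\<in>J. \<forall>j\<in>J. i \<bullet> j = (if i = j then 1 else 0))"

text \<open>For finite orthonormal \<open>J\<close> this is the orthogonal projection onto
  \<open>span J\<close>.\<close>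

definition fourier :: "'a::real_inner set \<Rightarrow> 'a \<Rightarrow> 'a" where
  "fourier J u = (\<Sum>j\<in>J. (u \<bullet> j) *\<^sub>R j)"

lemma finite_dimensional_orthonormal_basis:
  fixes V :: "'a::real_inner set"
  assumes "subspace V" "finite_dimensional V"
  obtains J where "finite J" "orthonormal J" "span J = V"
proof -
  obtain B where B: "finite B" "V \<subseteq> span B" using assms(2) unfolding finite_dimensional_def by blast
  obtain B' where B': "B' \<subseteq> V" "independent B'" "V \<subseteq> span B'"
    using maximal_independent_subset by blast
  have "finite B'" using independent_span_bound[OF B(1) B'(2)] B'(1) B(2) by blast
  moreover have "span B' = V" using B' assms(1) by (metis span_minimal subset_antisym)
  ultimately obtain C where C: "finite C" "span C = V" "pairwise orthogonal C"
    using basis_orthogonal by metis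
  \<comment> \<open>\<open>basis_orthogonal\<close> may return a family containing 0, which cannot
    be normalised.\<close>
  define J where "J = (\<lambda>c. inverse (norm c) *\<^sub>R c) ` (C - {0})"
  have "finite J" unfolding J_def using C by simp
  moreover have "orthonormal J"
    unfolding orthonormal_def
  proof (intro ballI)
    fix i j assume "i \<in> J" "j \<in> J"
    then obtain a b where ab: "a \<in> C" "a \<noteq> 0" "b \<in> C" "b \<noteq> 0"
      "i = inverse (norm a) *\<^sub>R a" "j = inverse (norm b) *\<^sub>R b"
      unfolding J_def by blast
    show "i \<bullet> j = (if i = j then 1 else 0)"
    proof (cases "a = b")
      case True
      thus ?thesis using ab by (simp add: dot_square_norm power2_eq_square)
    next
      case False
      hence 0: "a \<bullet> b = 0" using C(3) ab unfolding pairwise_def orthogonal_def by blast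
      have "i \<noteq> j"
      proof
        assume "i = j"
        hence "i \<bullet> i = i \<bullet> j" by simp
        also have "\<dots> = 0" using ab 0 by simp
        finally show False using ab by simp
      qed
      thus ?thesis using ab 0 by simp
    qed
  qed
  moreover have "span J = V"
  proof -
    have "span J = span (C - {0})"
    proof (rule span_eq[THEN iffD2], intro conjI subsetI)
      fix x assume "x \<in> J" thus "x \<in> span (C - {0})" unfolding J_def by (auto intro: span_scale span_base)
    next
      fix c assume c: "c \<in> C - {0}"
      hence "norm c *\<^sub>R (inverse (norm c) *\<^sub>R c) \<in> span J"
        unfolding J_def by (intro span_scale span_base) auto
      thus "c \<in> span J" using c by simp
    qed
    also have "\<dots> = V" using C(2) by simp
    finally show ?thesis .
  qed
  ultimately show ?thesis using that by blast
qed

lemma bounded_linear_fourier: "bounded_linear (fourier J)"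
  unfolding fourier_def
  by (intro bounded_linear_sum bounded_linear_scaleR_left[THEN bounded_linear_compose] bounded_linear_inner_left)

lemma fourier_in_span: "fourier J u \<in> span J"
  unfolding fourier_def by (intro span_sum span_scale span_base)

lemma fourier_inner:
  assumes "finite J" "orthonormal J" "j \<in> J"
  shows "fourier J u \<bullet> j = u \<bullet> j"
proof -
  have "fourier J u \<bullet> j = (\<Sum>i\<in>J. (u \<bullet> i) * (i \<bullet> j))"
    unfolding fourier_def by (simp add: inner_sum_left)
  also have "\<dots> = (\<Sum>i\<in>J. if i = j then u \<bullet> j else 0)"
    using assms unfolding orthonormal_def by (intro sum.cong) auto
  finally show ?thesis using assms by simp
qed

lemma fourier_orthogonal:
  assumes "finite J" "orthonormal J" "w \<in> span J"
  shows "(u - fourier J u) \<bullet> w = 0"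
  using assms(3)
proof (induction rule: span_induct_alt)
  case (step c x y)
  thus ?case using fourier_inner[OF assms(1,2), of x u] by (simp add: inner_simps)
qed simp

lemma fourier_id:
  assumes "finite J" "orthonormal J" "w \<in> span J"
  shows "fourier J w = w"
proof -
  have "w - fourier J w \<in> span J" by (intro span_diff assms(3) fourier_in_span)
  hence "(w - fourier J w) \<bullet> (w - fourier J w) = 0" using fourier_orthogonal[OF assms(1,2)] by blast
  thus ?thesis by simp
qed

lemma norm_fourier_le:
  assumes "finite J" "orthonormal J"
  shows "norm (fourier J u) \<le> norm u"
proof -
  have "(u - fourier J u) \<bullet> fourier J u = 0" using fourier_orthogonal[OF assms fourier_in_span] .
  hence "(norm (fourier J u))\<^sup>2 = u \<bullet> fourier J u"
    by (simp add: inner_diff_left power2_norm_eq_inner)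
  also have "\<dots> \<le> norm u * norm (fourier J u)" by (rule norm_cauchy_schwarz)
  finally show ?thesis by (cases "fourier J u = 0") (auto simp: power2_eq_square)
qed

lemma norm_fourier_le_card:
  fixes h :: real
  assumes "orthonormal J" "\<And>j. j \<in> J \<Longrightarrow> \<bar>u \<bullet> j\<bar> \<le> h"
  shows "norm (fourier J u) \<le> card J * h"
proof -
  have "norm j = 1" if "j \<in> J" for j
    using assms(1) that unfolding orthonormal_def by (simp add: norm_eq_sqrt_inner)
  hence "norm (fourier J u) \<le> (\<Sum>j\<in>J. h)"
    unfolding fourier_def using assms(2) by (intro sum_norm_le) auto
  thus ?thesis by simp
qed

text \<open>Dimension count: the projection onto \<open>D\<close> cannot be injective on a space of
  dimension \<open>card I > dim D\<close>, and the difference of two vectors with equal projection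
  is orthogonal to \<open>D\<close>. Later \<open>I\<close> spans part of a Hessian kernel,
  \<open>T\<close> moves it along an orbit, and \<open>D\<close> is the tangent space of an orbit at
  the centre of a slice.\<close>

lemma independent_image_meets_complement:
  fixes T :: "'a::real_vector \<Rightarrow> 'b::real_inner"
  assumes I: "finite I" "independent I" and T: "linear T" "inj T"
    and D: "subspace D" "finite_dimensional D" "dim D < card I"
  obtains w where "w \<in> span (T ` I)" "norm w = 1" "\<And>d. d \<in> D \<Longrightarrow> w \<bullet> d = 0"
proof -
  obtain J where J: "finite J" "orthonormal J" "span J = D"
    using finite_dimensional_orthonormal_basis D(1,2) by metis
  obtain B where B: "B \<subseteq> D" "independent B" "D \<subseteq> span B" "card B = dim D"
    using basis_exists by blast
  obtain B1 where "finite B1" "D \<subseteq> span B1" using D(2) unfolding finite_dimensional_def by blast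
  hence finB: "finite B" using independent_span_bound[OF _ B(2)] B(1) by blast
  have linF: "linear (fourier J)" by (rule bounded_linear.linear[OF bounded_linear_fourier])
  have indT: "independent (T ` I)"
    using linear_independent_injective_image[OF T(1) I(2)] T(2) by (simp add: inj_on_subset)
  have cardT: "card (T ` I) = card I" using T(2) by (intro card_image) (auto intro: inj_on_subset)
  have "\<not> inj_on (fourier J) (span (T ` I))"
  proof
    assume inj: "inj_on (fourier J) (span (T ` I))"
    have "independent (fourier J ` (T ` I))" by (rule linear_independent_injective_image[OF linF indT inj])
    moreover have "fourier J ` (T ` I) \<subseteq> span B" using fourier_in_span[of J] J(3) B(3) by blast
    ultimately have "card (fourier J ` (T ` I)) \<le> card B" using independent_span_bound[OF finB] by blast
    moreover have "card (fourier J ` (T ` I)) = card (T ` I)"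
      by (rule card_image[OF inj_on_subset[OF inj span_superset]])
    ultimately show False using D(3) B(4) cardT by simp
  qed
  then obtain a b where ab: "a \<in> span (T ` I)" "b \<in> span (T ` I)" "fourier J a = fourier J b" "a \<noteq> b"
    unfolding inj_on_def by auto
  define w where "w = (1 / norm (a - b)) *\<^sub>R (a - b)"
  have "fourier J (a - b) = 0" using ab(3) by (simp add: linear_diff[OF linF])
  hence "(a - b) \<bullet> d = 0" if "d \<in> D" for d
    using fourier_orthogonal[OF J(1,2), of d "a - b"] that J(3) by simp
  hence "w \<bullet> d = 0" if "d \<in> D" for d unfolding w_def using that by simp
  moreover have "norm w = 1" unfolding w_def using ab(4) by simp
  moreover have "w \<in> span (T ` I)" unfolding w_def using ab by (intro span_scale span_diff)
  ultimately show ?thesis using that by blast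
qed

section \<open>Finite families of functionals and of sequences\<close>

lemma dual_family:
  fixes \<phi> :: "'j \<Rightarrow> 'e::real_vector \<Rightarrow> real"
  assumes "finite J" "\<And>j. j \<in> J \<Longrightarrow> linear (\<phi> j)"
    and "\<And>c. (\<And>w. (\<Sum>j\<in>J. c j * \<phi> j w) = 0) \<Longrightarrow> (\<forall>j\<in>J. c j = 0)"
  shows "\<exists>e. \<forall>i\<in>J. \<forall>j\<in>J. \<phi> j (e i) = (if i = j then 1 else 0)"
  using assms
proof (induction J rule: finite_induct)
  case (insert a J)
  have "\<exists>e. \<forall>i\<in>J. \<forall>j\<in>J. \<phi> j (e i) = (if i = j then 1 else 0)"
  proof (rule insert.IH)
    show "linear (\<phi> j)" if "j \<in> J" for j using insert.prems(1) that by simp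
    fix c assume c: "\<And>w. (\<Sum>j\<in>J. c j * \<phi> j w) = 0"
    have "(\<Sum>j\<in>insert a J. (c(a := 0)) j * \<phi> j w) = (\<Sum>j\<in>J. c j * \<phi> j w)" for w
      using insert.hyps by (auto intro: sum.cong)
    hence "\<forall>j\<in>insert a J. (c(a := 0)) j = 0" using c by (intro insert.prems(2)) simp
    thus "\<forall>j\<in>J. c j = 0" using insert.hyps by (metis fun_upd_other insertCI)
  qed
  then obtain e where e: "\<And>i j. i \<in> J \<Longrightarrow> j \<in> J \<Longrightarrow> \<phi> j (e i) = (if i = j then 1 else 0)" by blast
  \<comment> \<open>These coefficients form \<open>\<phi> a\<close> minus the sum of the
    \<open>\<phi> a (e j) * \<phi> j\<close>, a functional that vanishes on all \<open>e j\<close>.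
    Independence provides a \<open>w\<close> where it is nonzero, and removing the components of
    \<open>w\<close> along the \<open>e i\<close> keeps this value as
    \<open>\<phi> a w'\<close>.\<close>
  define c where "c j = (if j = a then 1 else - \<phi> a (e j))" for j
  obtain w where w: "(\<Sum>j\<in>insert a J. c j * \<phi> j w) \<noteq> 0"
    using insert.prems(2)[of c] unfolding c_def by force
  define w' where "w' = w - (\<Sum>i\<in>J. \<phi> i w *\<^sub>R e i)"
  have lin: "\<phi> j w' = \<phi> j w - (\<Sum>i\<in>J. \<phi> i w * \<phi> j (e i))" if "j \<in> insert a J" for j
    unfolding w'_def using insert.prems(1)[OF that]
    by (simp add: linear_diff linear_sum linear_scale)
  have w'0: "\<phi> j w' = 0" if "j \<in> J" for j
  proof -
    have "(\<Sum>i\<in>J. \<phi> i w * \<phi> j (e i)) = (\<Sum>i\<in>J. if i = j then \<phi> i w else 0)"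
      using e that by (intro sum.cong) auto
    thus ?thesis using lin[of j] that insert.hyps(1) by simp
  qed
  have "(\<Sum>j\<in>insert a J. c j * \<phi> j w) = \<phi> a w - (\<Sum>j\<in>J. \<phi> j w * \<phi> a (e j))"
    using insert.hyps unfolding c_def
    by (simp add: sum_negf[symmetric] mult.commute) (auto intro!: sum.cong)
  hence w'a: "\<phi> a w' \<noteq> 0" using w lin[of a] by simp
  \<comment> \<open>\<open>w'\<close> is killed by all old functionals. Rescaled, it is the new dual
    vector; subtracting multiples of it from the old ones corrects their value under
    \<open>\<phi> a\<close> and no other.\<close>
  define e' where "e' i = (if i = a then (1 / \<phi> a w') *\<^sub>R w' else e i - (\<phi> a (e i) / \<phi> a w') *\<^sub>R w')" for i
  have "\<phi> j (e' i) = (if i = j then 1 else 0)" if "i \<in> insert a J" "j \<in> insert a J" for i j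
    using that insert.prems(1)[OF that(2)] w'a w'0 e insert.hyps(2) unfolding e'_def
    by (auto simp: linear_diff linear_scale)
  thus ?case by blast
qed simp

lemma finitely_many_bounded_sequences:
  fixes c :: "'j \<Rightarrow> nat \<Rightarrow> real"
  assumes "finite J" "\<And>j. j \<in> J \<Longrightarrow> bounded (range (c j))"
  obtains r :: "nat \<Rightarrow> nat" where "strict_mono r" "\<And>j. j \<in> J \<Longrightarrow> convergent (c j \<circ> r)"
proof -
  have "\<exists>r :: nat \<Rightarrow> nat. strict_mono r \<and> (\<forall>j\<in>J. convergent (c j \<circ> r))"
    using assms
  proof (induction J rule: finite_induct)
    case empty
    show ?case by (auto intro!: exI[of _ id] strict_mono_id)
  next
    case (insert a J)
    have "\<exists>r :: nat \<Rightarrow> nat. strict_mono r \<and> (\<forall>j\<in>J. convergent (c j \<circ> r))"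
      by (rule insert.IH) (use insert.prems in simp)
    then obtain r where r: "strict_mono (r :: nat \<Rightarrow> nat)" "\<And>j. j \<in> J \<Longrightarrow> convergent (c j \<circ> r)" by blast
    have "bounded (range (c a \<circ> r))"
      using insert.prems[of a] by (rule bounded_subset) auto
    then obtain l r' where r': "strict_mono (r' :: nat \<Rightarrow> nat)" "(c a \<circ> r \<circ> r') \<longlonglongrightarrow> l"
      using bounded_imp_convergent_subsequence by blast
    have "convergent (c j \<circ> (r \<circ> r'))" if "j \<in> insert a J" for j
      using that r' r(2)[of j] convergent_subseq_convergent[of "c j \<circ> r" r']
      by (auto simp: o_assoc convergent_def)
    thus ?case using strict_mono_o[OF r(1) r'(1)] by blast
  qed
  thus ?thesis using that by blast
qed

text \<open>Closed balls need not be compact here, so only the component in \<open>span J\<close> is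
  made to converge; the other component is recovered later from estimates.\<close>

lemma bounded_fourier_subsequence:
  fixes u :: "nat \<Rightarrow> 'a::real_inner"
  assumes "finite J" "\<And>n. norm (u n) \<le> b"
  obtains r :: "nat \<Rightarrow> nat" where "strict_mono r" "convergent (fourier J \<circ> u \<circ> r)"
proof -
  have "bounded (range (\<lambda>n. u n \<bullet> j))" for j
  proof (rule boundedI)
    fix x assume "x \<in> range (\<lambda>n. u n \<bullet> j)"
    then obtain n where "x = u n \<bullet> j" by blast
    thus "norm x \<le> b * norm j"
      using Cauchy_Schwarz_ineq2[of "u n" j] mult_right_mono[OF assms(2)[of n] norm_ge_zero[of j]] by simp
  qed
  then obtain r :: "nat \<Rightarrow> nat" where r: "strict_mono r" "\<And>j. j \<in> J \<Longrightarrow> convergent ((\<lambda>n. u n \<bullet> j) \<circ> r)"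
    using finitely_many_bounded_sequences[OF assms(1), of "\<lambda>j n. u n \<bullet> j"] by blast
  have "convergent (\<lambda>n. (u (r n) \<bullet> j) *\<^sub>R j)" if j: "j \<in> J" for j
  proof -
    obtain l where "(\<lambda>n. u (r n) \<bullet> j) \<longlonglongrightarrow> l" using r(2)[OF j] by (auto simp: convergent_def o_def)
    hence "(\<lambda>n. (u (r n) \<bullet> j) *\<^sub>R j) \<longlonglongrightarrow> l *\<^sub>R j" by (intro tendsto_intros)
    thus ?thesis by (rule convergentI)
  qed
  hence "convergent (\<lambda>n. \<Sum>j\<in>J. (u (r n) \<bullet> j) *\<^sub>R j)" by (rule convergent_sum)
  hence "convergent (fourier J \<circ> u \<circ> r)" unfolding fourier_def o_def .
  thus ?thesis using that r(1) by blast
qed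

section \<open>Fredholm forms\<close>

text \<open>The open mapping theorem for a map onto its closed range. The range is completely
  metrizable, so by Baire the closure of the image of some ball contains a relatively open set; this
  gives approximate preimages, and a geometric series makes them exact.\<close>

lemma open_mapping_estimate:
  fixes L :: "'a::banach \<Rightarrow>\<^sub>L 'b::banach"
  assumes closed: "closed (range (blinfun_apply L))"
  obtains C where "C > 0" "\<And>y. y \<in> range (blinfun_apply L) \<Longrightarrow> \<exists>u. L u = y \<and> norm u \<le> C * norm y"
proof -
  let ?R = "range (blinfun_apply L)"
  let ?X = "top_of_set ?R"
  define F where "F n = closure (blinfun_apply L ` cball 0 (real n))" for n :: nat
  have FR: "F n \<subseteq> ?R" for n
    unfolding F_def by (rule closure_minimal[OF _ closed]) auto
  have cm: "completely_metrizable_space ?X"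
    using completely_metrizable_space_closedin[OF completely_metrizable_space_euclidean, of ?R] closed
    by simp
  have un: "\<Union>(range F) = ?R"
  proof
    show "\<Union>(range F) \<subseteq> ?R" using FR by blast
    show "?R \<subseteq> \<Union>(range F)"
    proof
      fix y assume "y \<in> ?R"
      then obtain u where u: "y = L u" by blast
      have "L u \<in> F (nat \<lceil>norm u\<rceil>)"
        unfolding F_def by (rule closure_subset[THEN subsetD]) (auto intro!: imageI)
      thus "y \<in> \<Union>(range F)" using u by blast
    qed
  qed
  have "\<exists>n. ?X interior_of F n \<noteq> {}"
  proof (rule ccontr)
    assume "\<not> ?thesis"
    hence "?X interior_of \<Union>(range F) = {}"
      using cm FR by (intro Baire_category_alt) (auto simp: closedin_closed_eq[OF closed] F_def[abs_def] subset_iff)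
    thus False unfolding un using interior_of_topspace[of ?X] by simp
  qed
  then obtain n y0 where "y0 \<in> ?X interior_of F n" by blast
  then obtain U where U: "openin ?X U" "y0 \<in> U" "U \<subseteq> F n"
    unfolding interior_of_def by blast
  then obtain V where V: "open V" "U = ?R \<inter> V" unfolding openin_open by blast
  then obtain r where r: "r > 0" "ball y0 r \<subseteq> V" using U(2) openE by blast
  \<comment> \<open>A difference of two vectors of norm at most \<open>n\<close>, divided by
    \<open>s = r / (2 * norm y)\<close>, has norm at most \<open>4 * n / r * norm y\<close>; adding
    1 keeps \<open>c\<close> positive when \<open>n = 0\<close>.\<close>
  define c where "c = 4 * real n / r + 1"
  have c: "c > 0" using r(1) unfolding c_def by (simp add: add_nonneg_pos)
  have apr: "\<exists>u. norm u \<le> c * norm y \<and> norm (y - L u) \<le> norm y / 2" if y: "y \<in> ?R" for y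
  proof (cases "y = 0")
    case True
    thus ?thesis by (auto intro!: exI[of _ 0])
  next
    case False
    \<comment> \<open>Scales \<open>y\<close> to length \<open>r / 2\<close>, so that
      \<open>y0 + s *\<^sub>R y\<close> remains in the ball. Approximating it and \<open>y0\<close>
      up to a quarter of \<open>s * norm y\<close> each leaves an error of one half.\<close>
    define s where "s = r / (2 * norm y)"
    have s: "s > 0" unfolding s_def using False r(1) by simp
    obtain a b where ab: "y = L a" "y0 = L b" using y U(2) V(2) by blast
    have "y0 + s *\<^sub>R y \<in> ?R" unfolding ab by (metis blinfun.add_right blinfun.scaleR_right rangeI)
    moreover have "y0 + s *\<^sub>R y \<in> ball y0 r" unfolding s_def using False r(1) by (simp add: dist_norm)
    ultimately have "y0 + s *\<^sub>R y \<in> F n" using r(2) U(3) V(2) by blast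
    have e: "s * norm y / 4 > 0" using s False by simp
    have Fe: "\<exists>u. norm u \<le> real n \<and> dist (L u) z < s * norm y / 4" if "z \<in> F n" for z
      using that e unfolding F_def closure_approachable by fastforce
    obtain u1 where u1: "norm u1 \<le> real n" "dist (L u1) (y0 + s *\<^sub>R y) < s * norm y / 4"
      using Fe[OF \<open>y0 + s *\<^sub>R y \<in> F n\<close>] by blast
    obtain u2 where u2: "norm u2 \<le> real n" "dist (L u2) y0 < s * norm y / 4"
      using Fe[of y0] U by blast
    note u = u1 u2
    define u where "u = (1 / s) *\<^sub>R (u1 - u2)"
    have "norm u \<le> (1 / s) * (2 * real n)"
      unfolding u_def using s u(1,3) norm_triangle_ineq4[of u1 u2]
      by (simp add: divide_right_mono)
    also have "\<dots> \<le> c * norm y" unfolding s_def c_def using r(1) by (simp add: field_simps)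
    finally have 1: "norm u \<le> c * norm y" .
    have "s *\<^sub>R (y - L u) = (y0 + s *\<^sub>R y - L u1) - (y0 - L u2)"
      unfolding u_def using s by (simp add: blinfun.bilinear_simps algebra_simps)
    hence "s * norm (y - L u) \<le> norm (y0 + s *\<^sub>R y - L u1) + norm (y0 - L u2)"
      using norm_triangle_ineq4[of "y0 + s *\<^sub>R y - L u1" "y0 - L u2"] s
      by (metis abs_of_pos norm_scaleR)
    also have "\<dots> \<le> s * norm y / 4 + s * norm y / 4"
      using u(2,4) by (simp add: dist_norm norm_minus_commute)
    also have "\<dots> = s * (norm y / 2)" by simp
    finally have "norm (y - L u) \<le> norm y / 2" using s by (simp only: mult_le_cancel_left_pos)
    thus ?thesis using 1 by blast
  qed
  then obtain U where U: "\<And>y. y \<in> ?R \<Longrightarrow> norm (U y) \<le> c * norm y"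
    "\<And>y. y \<in> ?R \<Longrightarrow> norm (y - L (U y)) \<le> norm y / 2" by metis
  have "\<exists>u. L u = y \<and> norm u \<le> (2 * c) * norm y" if y: "y \<in> ?R" for y
  proof -
    \<comment> \<open>\<open>Y k\<close> is what remains of \<open>y\<close> after \<open>k\<close>
      corrections. It is at least halved at each step, so the corrections sum to at most
      \<open>2 * c * norm y\<close> in norm and their images telescope to \<open>y\<close>.\<close>
    define Y where "Y = rec_nat y (\<lambda>_ y. y - L (U y))"
    have Y0: "Y 0 = y" and YS: "\<And>k. Y (Suc k) = Y k - L (U (Y k))" unfolding Y_def by auto
    have YR: "Y k \<in> ?R" for k
    proof (induction k)
      case (Suc k)
      then obtain a where "Y k = L a" by blast
      thus ?case unfolding YS by (metis blinfun.diff_right rangeI)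
    qed (simp add: Y0 y)
    have Yn: "norm (Y k) \<le> norm y * (1/2) ^ k" for k
    proof (induction k)
      case (Suc k)
      thus ?case using U(2)[OF YR[of k]] unfolding YS by simp
    qed (simp add: Y0)
    have Un: "norm (U (Y k)) \<le> c * norm y * (1/2) ^ k" for k
      using order_trans[OF U(1)[OF YR[of k]] mult_left_mono[OF Yn[of k]]] c by (simp add: mult.assoc)
    have geo: "(\<lambda>k. c * norm y * (1/2) ^ k) sums (c * norm y * 2)"
      using sums_mult[OF geometric_sums[of "1/2::real"], of "c * norm y"] by simp
    have sn: "summable (\<lambda>k. norm (U (Y k)))"
      by (rule summable_comparison_test[OF _ sums_summable[OF geo]]) (use Un in auto)
    hence su: "summable (\<lambda>k. U (Y k))" by (rule summable_norm_cancel)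
    define u where "u = (\<Sum>k. U (Y k))"
    have "norm u \<le> (\<Sum>k. norm (U (Y k)))" unfolding u_def by (rule summable_norm[OF sn])
    also have "\<dots> \<le> c * norm y * 2"
      using suminf_le[OF Un sn sums_summable[OF geo]] sums_unique[OF geo] by simp
    finally have 1: "norm u \<le> (2 * c) * norm y" by simp
    have "(\<lambda>k. L (U (Y k))) sums L u"
      unfolding u_def using bounded_linear.sums[OF blinfun.bounded_linear_right summable_sums[OF su]] .
    moreover have "(\<lambda>k. L (U (Y k))) sums y"
    proof -
      have "(\<lambda>k. norm y * (1/2) ^ k) \<longlonglongrightarrow> norm y * 0" by (intro tendsto_intros LIMSEQ_power_zero) auto
      hence "Y \<longlonglongrightarrow> 0" using Yn by (intro Lim_null_comparison[of Y "\<lambda>k. norm y * (1/2) ^ k"]) auto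
      hence "(\<lambda>k. Y k - Y (Suc k)) sums (Y 0 - 0)" by (rule telescope_sums')
      thus ?thesis unfolding YS Y0 by simp
    qed
    ultimately show ?thesis using 1 sums_unique2 by blast
  qed
  thus ?thesis using that[of "2 * c"] c by simp
qed

text \<open>A vector \<open>u\<close> orthogonal to the kernel is the shortest one with its image,
  so the preimage \<open>v\<close> of \<open>L u\<close> supplied by the open mapping estimate
  bounds \<open>u\<close> as well. Testing \<open>B u\<close> on \<open>L u\<close> bounds
  \<open>norm (L u)\<close> by \<open>norm (B u)\<close>.\<close>

lemma fredholm_form_coercive:
  fixes B :: "'h::{real_inner,banach} \<Rightarrow>\<^sub>L 'h \<Rightarrow>\<^sub>L real"
  assumes "fredholm_form B"
  obtains C where "C > 0" "\<And>u. (\<And>k. k \<in> form_kernel B \<Longrightarrow> u \<bullet> k = 0) \<Longrightarrow> norm u \<le> C * norm (B u)"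
proof -
  obtain L :: "'h \<Rightarrow>\<^sub>L 'h" where L: "\<And>v w. B v w = L v \<bullet> w" and F: "fredholm_operator L"
    using assms unfolding fredholm_form_def by blast
  obtain C where C: "C > 0" "\<And>y. y \<in> range (blinfun_apply L) \<Longrightarrow> \<exists>u. L u = y \<and> norm u \<le> C * norm y"
    using open_mapping_estimate[of L] F unfolding fredholm_operator_def by blast
  have nL: "norm (L v) \<le> norm (B v)" for v
  proof (cases "L v = 0")
    case False
    have "norm (L v) * norm (L v) = B v (L v)" by (simp add: L dot_square_norm power2_eq_square)
    also have "\<dots> \<le> norm (B v) * norm (L v)" using norm_blinfun[of "B v" "L v"] by simp
    finally show ?thesis using False by simp
  qed simp
  have "norm u \<le> C * norm (B u)" if u: "\<And>k. k \<in> form_kernel B \<Longrightarrow> u \<bullet> k = 0" for u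
  proof (cases "u = 0")
    case False
    obtain v where v: "L v = L u" "norm v \<le> C * norm (L u)" using C(2)[of "L u"] by auto
    have "u - v \<in> form_kernel B"
      unfolding form_kernel_def using v(1) by (simp add: blinfun.bilinear_simps L)
    hence "norm u * norm u = u \<bullet> v" using u[of "u - v"] by (simp add: inner_diff_right dot_square_norm power2_eq_square)
    also have "\<dots> \<le> norm u * norm v" by (rule norm_cauchy_schwarz)
    finally have "norm u \<le> norm v" using False by simp
    also note v(2)
    also have "C * norm (L u) \<le> C * norm (B u)" using C(1) nL[of u] by simp
    finally show ?thesis .
  qed (use C(1) in simp)
  thus ?thesis using that C(1) by blast
qed

lemma subspace_form_kernel: "subspace (form_kernel B)"
  unfolding form_kernel_def subspace_def by (auto simp: blinfun.bilinear_simps)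

lemma finite_dimensional_form_kernel:
  fixes B :: "'h::{real_inner,banach} \<Rightarrow>\<^sub>L 'h \<Rightarrow>\<^sub>L real"
  assumes "fredholm_form B"
  shows "finite_dimensional (form_kernel B)"
proof -
  obtain L :: "'h \<Rightarrow>\<^sub>L 'h" where L: "\<And>v w. B v w = L v \<bullet> w" and F: "fredholm_operator L"
    using assms unfolding fredholm_form_def by blast
  have "form_kernel B \<subseteq> {v. L v = 0}"
  proof
    fix v assume "v \<in> form_kernel B"
    hence "L v \<bullet> L v = 0" unfolding form_kernel_def L by blast
    thus "v \<in> {v. L v = 0}" by simp
  qed
  thus ?thesis using F unfolding fredholm_operator_def finite_dimensional_def by blast
qed

lemma closed_orthogonal_complement: "closed {w :: 'a::real_inner. \<forall>d\<in>D. w \<bullet> d = 0}"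
proof -
  have "{w. \<forall>d\<in>D. w \<bullet> d = 0} = (\<Inter>d\<in>D. {w. w \<bullet> d = 0})" by auto
  thus ?thesis by (auto intro!: closed_INT closed_Collect_eq continuous_intros)
qed

lemma subspace_orthogonal_complement: "subspace {w :: 'a::real_inner. \<forall>d\<in>D. w \<bullet> d = 0}"
  unfolding subspace_def by (auto simp: inner_simps)

text \<open>The orthogonal complement of the kernel serves as \<open>W\<close>. By symmetry
  \<open>L\<close> is self-adjoint, so it maps into \<open>W\<close>; coercivity gives injectivity
  and a Lipschitz inverse. The use is contrapositive: at a degenerate critical point the tangent
  space of the orbit is a proper subspace of the kernel.\<close>

lemma strongly_nondegenerate_complement:
  fixes B :: "'h::{real_inner,banach} \<Rightarrow>\<^sub>L 'h \<Rightarrow>\<^sub>L real"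
  assumes fred: "fredholm_form B" and sym: "\<And>u v. B u v = B v u"
  shows "\<exists>W. closed_complement (form_kernel B) W \<and> strongly_nondegenerate_on W B"
proof -
  define D where "D = form_kernel B"
  define W where "W = {w. \<forall>d\<in>D. w \<bullet> d = 0}"
  obtain L :: "'h \<Rightarrow>\<^sub>L 'h" where L: "\<And>v w. B v w = L v \<bullet> w" and F: "fredholm_operator L"
    using fred unfolding fredholm_form_def by blast
  obtain C where C: "C > 0" "\<And>u. (\<And>k. k \<in> D \<Longrightarrow> u \<bullet> k = 0) \<Longrightarrow> norm u \<le> C * norm (B u)"
    using fredholm_form_coercive[OF fred] unfolding D_def by metis
  obtain J where J: "finite J" "orthonormal J" "span J = D"
    using finite_dimensional_orthonormal_basis[OF subspace_form_kernel finite_dimensional_form_kernel[OF fred]]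
    unfolding D_def by metis
  have split: "\<exists>d\<in>D. \<exists>w\<in>W. u = d + w" for u
  proof (intro bexI)
    show "u = fourier J u + (u - fourier J u)" by simp
    show "fourier J u \<in> D" using fourier_in_span J(3) by blast
    show "u - fourier J u \<in> W" unfolding W_def using fourier_orthogonal[OF J(1,2)] J(3) by blast
  qed
  have cW: "closed W" and sW: "subspace W"
    unfolding W_def by (rule closed_orthogonal_complement, rule subspace_orthogonal_complement)
  have int: "D \<inter> W = {0}"
  proof -
    have "d = 0" if "d \<in> D" "d \<in> W" for d using that unfolding W_def by (metis (mono_tags) inner_eq_zero_iff mem_Collect_eq)
    moreover have "0 \<in> D" "0 \<in> W" using subspace_form_kernel sW subspace_0 unfolding D_def by blast+
    ultimately show ?thesis by blast
  qed
  have cc: "closed_complement D W" unfolding closed_complement_def using cW sW int split by blast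
  have nLB: "norm (B u) \<le> norm (L u)" for u
    using norm_blinfun_bound[of "norm (L u)" "B u"] Cauchy_Schwarz_ineq2[of "L u"] by (simp add: L)
  have est: "norm u \<le> C * norm (L u)" if "u \<in> W" for u
    using order_trans[OF C(2)[of u]] that nLB[of u] C(1) unfolding W_def by (simp add: mult_left_mono)
  have LW: "L u \<in> W" for u
    unfolding W_def D_def form_kernel_def by (auto simp: sym[of u] simp flip: L)
  have surj: "\<exists>v\<in>W. L v = w" if w: "w \<in> W" for w
  proof -
    have sR: "subspace (range (blinfun_apply L))"
      using linear_subspace_image[OF bounded_linear.linear[OF blinfun.bounded_linear_right] subspace_UNIV] .
    \<comment> \<open>The defect \<open>w - m\<close> is orthogonal to the range of
      \<open>L\<close>, hence by symmetry in the kernel, hence 0 because it also lies in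
      \<open>W\<close>.\<close>
    obtain m where m: "m \<in> range (blinfun_apply L)" "\<And>z. z \<in> range (blinfun_apply L) \<Longrightarrow> (w - m) \<bullet> z = 0"
      using closed_subspace_nearest[OF sR, of w] F unfolding fredholm_operator_def by metis
    have "B (w - m) z = 0" for z
    proof -
      have "B (w - m) z = L z \<bullet> (w - m)" by (rule trans[OF sym L])
      thus ?thesis using m(2)[of "L z"] by (simp add: inner_commute)
    qed
    hence "w - m \<in> D" unfolding D_def form_kernel_def by simp
    moreover have "w - m \<in> W" using m(1) LW w by (intro subspace_diff[OF sW]) auto
    ultimately have "w - m \<in> {0}" unfolding int[symmetric] by (rule IntI)
    hence "w = m" by simp
    then obtain u where u: "L u = w" using m(1) by auto
    obtain d v where dv: "d \<in> D" "v \<in> W" "u = d + v" using split by blast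
    have "L d \<bullet> L d = 0" using dv(1) unfolding D_def form_kernel_def L by blast
    hence "L d = 0" by simp
    thus ?thesis using u dv by (auto simp: blinfun.bilinear_simps)
  qed
  define L' where "L' = inv_into W (blinfun_apply L)"
  have inj: "inj_on (blinfun_apply L) W"
  proof (rule inj_onI)
    fix u v assume uv: "u \<in> W" "v \<in> W" "L u = L v"
    have "u - v \<in> W" using uv by (intro subspace_diff[OF sW])
    thus "u = v" using est[of "u - v"] uv(3) by (simp add: blinfun.bilinear_simps)
  qed
  have img: "blinfun_apply L ` W = W" using LW surj by auto
  have L'W: "L' w \<in> W" "L (L' w) = w" if "w \<in> W" for w
    unfolding L'_def using that img by (auto simp: inv_into_into f_inv_into_f)
  have "homeomorphism W W L L'"
  proof (rule homeomorphismI)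
    show "continuous_on W L" by (intro continuous_intros)
    show "continuous_on W L'"
    proof (rule continuous_on_iff[THEN iffD2], intro ballI allI impI)
      fix x and e :: real assume x: "x \<in> W" and e: "e > 0"
      show "\<exists>d>0. \<forall>x'\<in>W. dist x' x < d \<longrightarrow> dist (L' x') (L' x) < e"
      proof (intro exI conjI ballI impI)
        show "e / C > 0" using e C(1) by simp
        fix x' assume x': "x' \<in> W" "dist x' x < e / C"
        have "L' x' - L' x \<in> W" using L'W x x' by (intro subspace_diff[OF sW])
        hence "norm (L' x' - L' x) \<le> C * norm (L (L' x' - L' x))" by (rule est)
        also have "\<dots> = C * norm (x' - x)" using L'W x x' by (simp add: blinfun.bilinear_simps)
        also have "\<dots> < e" using x'(2) C(1) by (simp add: dist_norm field_simps)
        finally show "dist (L' x') (L' x) < e" by (simp add: dist_norm)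
      qed
    qed
    show "L' ` W \<subseteq> W" using L'W by blast
    show "L' (L x) = x" if "x \<in> W" for x using that inj unfolding L'_def by simp
  qed (use img L'W in auto)
  hence "strongly_nondegenerate_on W B"
    unfolding strongly_nondegenerate_on_def using L by blast
  thus ?thesis using cc unfolding D_def by blast
qed

section \<open>Degenerate zeros of a Fredholm family\<close>

text \<open>Turns an a priori estimate into convergence: \<open>b\<close> will carry the
  finite-dimensional component and \<open>c\<close> the data already known to converge.\<close>

lemma Cauchy_of_estimate:
  fixes a :: "nat \<Rightarrow> 'a::real_normed_vector" and b :: "nat \<Rightarrow> 'b::real_normed_vector"
    and c :: "nat \<Rightarrow> 'c::real_normed_vector"
  assumes "\<And>m n. norm (a m - a n) \<le> K * norm (b m - b n) + L * norm (c m - c n)"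
    and "convergent b" "convergent c" "K > 0" "L > 0"
  shows "Cauchy a"
proof (rule CauchyI)
  fix e :: real assume e: "e > 0"
  obtain M1 where M1: "\<And>m n. m \<ge> M1 \<Longrightarrow> n \<ge> M1 \<Longrightarrow> norm (b m - b n) < e / (2 * K)"
    using CauchyD[OF convergent_Cauchy[OF assms(2)], of "e / (2 * K)"] e assms(4) by auto
  obtain M2 where M2: "\<And>m n. m \<ge> M2 \<Longrightarrow> n \<ge> M2 \<Longrightarrow> norm (c m - c n) < e / (2 * L)"
    using CauchyD[OF convergent_Cauchy[OF assms(3)], of "e / (2 * L)"] e assms(5) by auto
  show "\<exists>M. \<forall>m\<ge>M. \<forall>n\<ge>M. norm (a m - a n) < e"
  proof (intro exI[of _ "max M1 M2"] allI impI)
    fix m n assume mn: "max M1 M2 \<le> m" "max M1 M2 \<le> n"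
    have "K * norm (b m - b n) < e / 2" using M1[of m n] mn assms(4) by (simp add: field_simps)
    moreover have "L * norm (c m - c n) < e / 2" using M2[of m n] mn assms(5) by (simp add: field_simps)
    ultimately show "norm (a m - a n) < e" using assms(1)[of m n] by linarith
  qed
qed

lemma norm_blinfun_le: "norm (blinfun_apply L x) \<le> c * b" if "norm L \<le> c" "norm x \<le> b"
  using norm_blinfun[of L x] mult_mono[OF that] that norm_ge_zero[of L] norm_ge_zero[of x] by linarith

text \<open>The comparison point \<open>w\<close> is kept separate from the end points: it will be
  either the centre of a ball or the end point \<open>z\<close>.\<close>

lemma convex_linearization:
  fixes g :: "'a::real_normed_vector \<Rightarrow> 'b::real_normed_vector"
  assumes Q: "convex Q" "z \<in> Q" "z' \<in> Q" "w \<in> Q"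
    and der: "\<And>x. x \<in> Q \<Longrightarrow> (g has_derivative blinfun_apply (g' x)) (at x)"
    and bd: "\<And>x. x \<in> Q \<Longrightarrow> norm (g' x - g' w) \<le> \<eta>"
  shows "norm (g z' - g z - g' w (z' - z)) \<le> \<eta> * norm (z' - z)"
proof -
  have "norm (g z' - g z - g' w (z' - z)) \<le> norm (z' - z) * \<eta>"
  proof (rule differentiable_bound_linearization[OF _ _ _ Q(4)])
    show "z + t *\<^sub>R (z' - z) \<in> Q" if "t \<in> {0..1}" for t
      using convexD_alt[OF Q(1-3), of t] that by (simp add: algebra_simps)
    show "(g has_derivative blinfun_apply (g' x)) (at x within Q)" if "x \<in> Q" for x
      by (rule has_derivative_at_withinI[OF der[OF that]])
    show "onorm (blinfun_apply (g' x) - blinfun_apply (g' w)) \<le> \<eta>" if "x \<in> Q" for x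
      using bd[OF that] by (simp add: norm_blinfun.rep_eq minus_blinfun.rep_eq fun_diff_def)
  qed
  thus ?thesis by (simp add: mult.commute)
qed

text \<open>The counting argument demands one \<open>\<delta>\<close> for all points of
  \<open>K\<close>. Compactness is stated for sequences in \<open>K\<close>, with limits in
  \<open>S\<close> that may lie outside \<open>K\<close>, since the spaces may have infinite
  dimension. Near such a limit the derivative is almost constant on a ball, and balls are
  convex.\<close>

lemma C1_uniform_remainder:
  fixes g :: "'a::real_normed_vector \<Rightarrow> 'b::real_normed_vector"
  assumes S: "open S" and der: "\<And>z. z \<in> S \<Longrightarrow> (g has_derivative blinfun_apply (g' z)) (at z)"
    and cont: "continuous_on S g'"
    and cpt: "\<And>z :: nat \<Rightarrow> 'a. range z \<subseteq> K \<Longrightarrow> \<exists>r l. strict_mono (r :: nat \<Rightarrow> nat) \<and> l \<in> S \<and> (z \<circ> r) \<longlonglongrightarrow> l"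
    and \<epsilon>: "\<epsilon> > 0"
  shows "\<exists>\<delta>>0. \<forall>z\<in>K. \<forall>z'\<in>K. norm (z' - z) < \<delta> \<longrightarrow> norm (g z' - g z - g' z (z' - z)) \<le> \<epsilon> * norm (z' - z)"
proof (rule ccontr)
  assume neg: "\<not> ?thesis"
  have "\<exists>z z'. z \<in> K \<and> z' \<in> K \<and> norm (z' - z) < 1 / real (Suc n) \<and>
      norm (g z' - g z - g' z (z' - z)) > \<epsilon> * norm (z' - z)" for n
  proof -
    have "1 / real (Suc n) > 0" by simp
    thus ?thesis using neg by (metis not_le)
  qed
  then obtain z z' where zz: "\<And>n. z n \<in> K" "\<And>n. z' n \<in> K" "\<And>n. norm (z' n - z n) < 1 / real (Suc n)"
    and bad: "\<And>n. norm (g (z' n) - g (z n) - g' (z n) (z' n - z n)) > \<epsilon> * norm (z' n - z n)"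
    by metis
  obtain r l where r: "strict_mono (r :: nat \<Rightarrow> nat)" "l \<in> S" "(z \<circ> r) \<longlonglongrightarrow> l"
    using cpt[of z] zz(1) by blast
  have "(\<lambda>n. z' n - z n) \<longlonglongrightarrow> 0"
    by (rule Lim_null_comparison[OF always_eventually LIMSEQ_inverse_real_of_nat])
      (use zz(3)[THEN less_imp_le] in \<open>simp add: inverse_eq_divide\<close>)
  hence d0: "((\<lambda>n. z' n - z n) \<circ> r) \<longlonglongrightarrow> 0" by (rule LIMSEQ_subseq_LIMSEQ[OF _ r(1)])
  have "(\<lambda>n. (z \<circ> r) n + ((\<lambda>n. z' n - z n) \<circ> r) n) \<longlonglongrightarrow> l + 0" by (rule tendsto_add[OF r(3) d0])
  hence z'l: "(z' \<circ> r) \<longlonglongrightarrow> l" by (simp add: o_def)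
  have "isCont g' l" using cont S r(2) by (simp add: continuous_on_eq_continuous_at)
  then obtain d1 where d1: "d1 > 0" "\<And>w. dist w l < d1 \<Longrightarrow> dist (g' w) (g' l) < \<epsilon> / 2"
    unfolding continuous_at_eps_delta using \<epsilon> half_gt_zero by blast
  obtain d2 where d2: "d2 > 0" "ball l d2 \<subseteq> S" using S r(2) openE by blast
  define d where "d = min d1 d2"
  have d: "d > 0" unfolding d_def using d1 d2 by simp
  have "eventually (\<lambda>n. dist ((z \<circ> r) n) l < d \<and> dist ((z' \<circ> r) n) l < d) sequentially"
    by (intro eventually_conj tendstoD[OF r(3) d] tendstoD[OF z'l d])
  then obtain n where n: "dist (z (r n)) l < d" "dist (z' (r n)) l < d"
    by (auto simp: eventually_sequentially)
  have "norm (g (z' (r n)) - g (z (r n)) - g' (z (r n)) (z' (r n) - z (r n))) \<le> \<epsilon> * norm (z' (r n) - z (r n))"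
  proof (rule convex_linearization[OF convex_ball])
    show "(g has_derivative blinfun_apply (g' w)) (at w)" if "w \<in> ball l d" for w
      using that d2 unfolding d_def by (intro der) auto
    show "norm (g' w - g' (z (r n))) \<le> \<epsilon>" if "w \<in> ball l d" for w
    proof -
      have "dist (g' w) (g' l) < \<epsilon> / 2" "dist (g' (z (r n))) (g' l) < \<epsilon> / 2"
        using d1(2)[of w] d1(2)[of "z (r n)"] that n unfolding d_def by (simp_all add: dist_commute)
      hence "norm (g' w - g' (z (r n))) < \<epsilon>" using dist_triangle_half_r by (metis dist_commute dist_norm)
      thus ?thesis by simp
    qed
  qed (use n in \<open>simp_all add: dist_commute\<close>)
  thus False using bad[of "r n"] by simp
qed

text \<open>\<open>D\<close> belongs to the centre \<open>z\<^sub>0\<close> and stays fixed while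
  \<open>z\<close> varies; together with the normalisation of \<open>v\<close> this makes the
  condition stable under limits.\<close>

definition degenerate_zeros ::
    "('e::real_normed_vector \<times> 'h::real_inner \<Rightarrow> 'h \<Rightarrow>\<^sub>L real) \<Rightarrow> ('e \<times> 'h \<Rightarrow> ('e \<times> 'h) \<Rightarrow>\<^sub>L 'h \<Rightarrow>\<^sub>L real) \<Rightarrow>
     'e \<times> 'h \<Rightarrow> 'h set \<Rightarrow> real \<Rightarrow> ('e \<times> 'h) set" where
  "degenerate_zeros g g' z\<^sub>0 D r =
     {z. dist (fst z) (fst z\<^sub>0) \<le> r \<and> dist (snd z) (snd z\<^sub>0) \<le> r \<and> (\<forall>d\<in>D. (snd z - snd z\<^sub>0) \<bullet> d = 0) \<and>
        g z = 0 \<and> (\<exists>v. norm v = 1 \<and> (\<forall>d\<in>D. v \<bullet> d = 0) \<and> g' z (0, v) = 0)}"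

text \<open>
  Lyapunov--Schmidt reduction without the implicit function theorem: \<open>g\<close> stands for the partial
  differential with respect to \<open>y\<close>. On the slice \<open>y - y\<^sub>0 \<bottom> D\<close> the zeros of \<open>g\<close> over an affine space
  parallel to a complement \<open>span (e ` J)\<close> form a Lipschitz graph over the \<open>J\<close>-coordinates of \<open>y\<close>, and
  the symmetry of the Hessian turns a kernel vector into a covector to which the counting lemma applies.
\<close>

lemma degenerate_zeros_nowhere_dense:
  fixes g :: "'e::real_normed_vector \<times> 'h::{real_inner,banach} \<Rightarrow> 'h \<Rightarrow>\<^sub>L real"
    and g' :: "'e \<times> 'h \<Rightarrow> ('e \<times> 'h) \<Rightarrow>\<^sub>L 'h \<Rightarrow>\<^sub>L real"
  assumes S: "open S" "(x0, y0) \<in> S"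
    and der: "\<And>z. z \<in> S \<Longrightarrow> (g has_derivative blinfun_apply (g' z)) (at z)"
    and cont: "continuous_on S g'"
    and sym: "\<And>z u v. z \<in> S \<Longrightarrow> g' z (0, u) v = g' z (0, v) u"
    and B: "\<And>u. blinfun_apply B u = g' (x0, y0) (0, u)"
    and fred: "fredholm_form B"
    and D: "subspace D" "D \<subseteq> form_kernel B"
    and trans: "\<And>v. v \<in> form_kernel B - D \<Longrightarrow> \<exists>w. g' (x0, y0) (w, 0) v \<noteq> 0"
  obtains r where "r > 0"
    "closed (fst ` degenerate_zeros g g' (x0, y0) D r)"
    "interior (fst ` degenerate_zeros g g' (x0, y0) D r) = {}"
proof -
  define A where "A = g' (x0, y0)"
  define N where "N = form_kernel B \<inter> {v. \<forall>d\<in>D. v \<bullet> d = 0}"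
  have fdk: "finite_dimensional (form_kernel B)" by (rule finite_dimensional_form_kernel[OF fred])
  have "subspace N" unfolding N_def
    by (intro subspace_inter subspace_form_kernel subspace_orthogonal_complement)
  moreover have "finite_dimensional N" "finite_dimensional D"
    using fdk D(2) unfolding N_def finite_dimensional_def by blast+
  ultimately obtain J JD where J: "finite J" "orthonormal J" "span J = N"
    and JD: "finite JD" "orthonormal JD" "span JD = D"
    using finite_dimensional_orthonormal_basis D(1) by metis
  have JN: "j \<in> form_kernel B" "\<And>d. d \<in> D \<Longrightarrow> j \<bullet> d = 0" "norm j = 1" if "j \<in> J" for j
    using that J span_base[of j J] unfolding N_def orthonormal_def by (auto simp: norm_eq_sqrt_inner)
  have B0: "B k = 0" if "k \<in> form_kernel B" for k
    using that unfolding form_kernel_def by (intro blinfun_eqI) simp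
  obtain C0 where C0: "C0 > 0" "\<And>u. (\<And>k. k \<in> form_kernel B \<Longrightarrow> u \<bullet> k = 0) \<Longrightarrow> norm u \<le> C0 * norm (B u)"
    using fredholm_form_coercive[OF fred] by metis
  have fourier_N: "fourier J u \<in> N" for u using fourier_in_span J(3) by blast
  \<comment> \<open>A kernel vector is the sum of its projection to \<open>D\<close> and a vector of
    \<open>N = span J\<close>. For \<open>u\<close> orthogonal to \<open>D\<close>, the difference
    \<open>u - fourier J u\<close> is orthogonal to both, so the estimate on the complement of the
    kernel applies to it.\<close>
  have coercive: "norm (u - fourier J u) \<le> C0 * norm (B u)" if u: "\<And>d. d \<in> D \<Longrightarrow> u \<bullet> d = 0" for u
  proof -
    have "(u - fourier J u) \<bullet> k = 0" if k: "k \<in> form_kernel B" for k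
    proof -
      have kD: "fourier JD k \<in> D" using fourier_in_span JD(3) by blast
      have "k - fourier JD k \<in> form_kernel B"
        using k kD D(2) by (intro subspace_diff[OF subspace_form_kernel]) auto
      moreover have "(k - fourier JD k) \<bullet> d = 0" if "d \<in> D" for d
        using fourier_orthogonal[OF JD(1,2)] that JD(3) by blast
      ultimately have "k - fourier JD k \<in> span J" unfolding J(3) N_def by blast
      hence "(u - fourier J u) \<bullet> (k - fourier JD k) = 0" by (rule fourier_orthogonal[OF J(1,2)])
      moreover have "(u - fourier J u) \<bullet> fourier JD k = 0"
        using u[OF kD] fourier_N[of u] kD unfolding N_def by (simp add: inner_diff_left)
      ultimately show ?thesis by (simp add: inner_diff_right)
    qed
    hence "norm (u - fourier J u) \<le> C0 * norm (B (u - fourier J u))" by (rule C0(2))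
    also have "B (u - fourier J u) = B u"
      using B0[of "fourier J u"] fourier_N[of u] unfolding N_def by (simp add: blinfun.diff_right)
    finally show ?thesis .
  qed
  have Bsym: "B u v = B v u" for u v unfolding B using sym[OF S(2)] .

  \<comment> \<open>A combination of \<open>J\<close> annihilated by all mixed derivatives lies in
    \<open>D\<close> by \<open>trans\<close>, but it is also orthogonal to \<open>D\<close>, so it
    vanishes: the functionals given by \<open>J\<close> on the model of \<open>X\<close> are
    independent.\<close>
  have "\<exists>e. \<forall>i\<in>J. \<forall>j\<in>J. A (e i, 0) j = (if i = j then 1 else 0)"
  proof (rule dual_family[OF J(1)])
    show "linear (\<lambda>w. A (w, 0) j)" for j
    proof (rule linearI)
      fix v w :: 'e and c :: real
      have "A (v + w, 0) = A (v, 0) + A (w, 0)" by (simp flip: blinfun.add_right)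
      thus "A (v + w, 0) j = A (v, 0) j + A (w, 0) j" by (simp add: blinfun.add_left)
      have "A (c *\<^sub>R v, 0) = c *\<^sub>R A (v, 0)" by (simp flip: blinfun.scaleR_right)
      thus "A (c *\<^sub>R v, 0) j = c *\<^sub>R A (v, 0) j" by (simp add: blinfun.scaleR_left)
    qed
    fix c assume c: "\<And>w. (\<Sum>j\<in>J. c j * A (w, 0) j) = 0"
    define v where "v = (\<Sum>j\<in>J. c j *\<^sub>R j)"
    have "A (w, 0) v = 0" for w
      using c[of w] unfolding v_def by (simp add: blinfun.sum_right blinfun.scaleR_right)
    moreover have vN: "v \<in> N" unfolding v_def J(3)[symmetric] by (intro span_sum span_scale span_base)
    ultimately have "v \<in> D" using trans[of v] unfolding N_def A_def by blast
    hence "v \<bullet> v = 0" using vN unfolding N_def by blast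
    hence "v \<bullet> i = 0" for i by simp
    moreover have "v \<bullet> i = c i" if "i \<in> J" for i
    proof -
      have "v \<bullet> i = (\<Sum>j\<in>J. c j * (j \<bullet> i))" unfolding v_def by (simp add: inner_sum_left)
      also have "\<dots> = (\<Sum>j\<in>J. if j = i then c i else 0)"
        using J(2) that unfolding orthonormal_def by (intro sum.cong) auto
      finally show ?thesis using that J(1) by simp
    qed
    ultimately show "\<forall>j\<in>J. c j = 0" by simp
  qed
  then obtain e where e: "\<And>i j. i \<in> J \<Longrightarrow> j \<in> J \<Longrightarrow> A (e i, 0) j = (if i = j then 1 else 0)" by blast
  define M where "M = (\<Sum>j\<in>J. norm (e j))"
  have M: "M \<ge> 0" unfolding M_def by (simp add: sum_nonneg)
  have eM: "norm (e j) \<le> M" if "j \<in> J" for j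
    unfolding M_def using that J(1) by (intro member_le_sum) auto
  define a where "a = norm A"
  have a: "a \<ge> 0" unfolding a_def by simp
  define p where "p = real (card J)"
  have p0: "p \<ge> 0" unfolding p_def by simp
  define c1 where "c1 = 2 * C0 * (1 + a)"
  have c1: "c1 > 0" unfolding c1_def using C0(1) a by simp
  define c3 where "c3 = 1 / (8 * (p + 1))"
  have c3: "c3 > 0" unfolding c3_def using p0 by simp
  \<comment> \<open>The bound on \<open>C0 * \<eta>\<close> lets terms in the norm of the unknown be
    absorbed in \<open>E1\<close> and \<open>proper\<close>, the two bounds on
    \<open>M * \<eta>\<close> do so in \<open>E2\<close>, and the last one keeps the errors in
    \<open>E3\<close> below \<open>c3\<close>.\<close>
  obtain \<eta> where \<eta>: "\<eta> > 0" "\<eta> \<le> 1" "C0 * \<eta> \<le> 1/2" "M * \<eta> \<le> 1/2" "c1 * 2 * (M * \<eta>) \<le> 1/2"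
    "\<eta> * (M + a * M * C0) \<le> c3"
  proof -
    have "eventually (\<lambda>\<eta>. \<eta> > 0) (at_right (0::real))" by (rule eventually_at_right_less)
    moreover have ev: "eventually (\<lambda>\<eta>. k * \<eta> < c) (at_right (0::real))" if "c > 0" for k c :: real
    proof (rule order_tendstoD(2)[OF _ that])
      show "((\<lambda>\<eta>. k * \<eta>) \<longlongrightarrow> 0) (at_right 0)" by (auto intro!: tendsto_eq_intros)
    qed
    ultimately have "eventually (\<lambda>\<eta>. \<eta> > 0 \<and> 1 * \<eta> < 1 \<and> C0 * \<eta> < 1/2 \<and> M * \<eta> < 1/2 \<and>
        (c1 * 2 * M) * \<eta> < 1/2 \<and> (M + a * M * C0) * \<eta> < c3) (at_right (0::real))"
      using c3 by (intro eventually_conj ev) auto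
    then obtain \<eta> where "\<eta> > 0 \<and> 1 * \<eta> < 1 \<and> C0 * \<eta> < 1/2 \<and> M * \<eta> < 1/2 \<and>
        (c1 * 2 * M) * \<eta> < 1/2 \<and> (M + a * M * C0) * \<eta> < c3"
      using eventually_happens' by (metis (no_types, lifting) trivial_limit_at_right_real)
    thus ?thesis by (intro that[of \<eta>]) (auto simp: mult_ac)
  qed
  have "isCont g' (x0, y0)" using cont S by (simp add: continuous_on_eq_continuous_at)
  then obtain d1 where d1: "d1 > 0" "\<And>z. dist z (x0, y0) < d1 \<Longrightarrow> dist (g' z) A < \<eta>"
    unfolding continuous_at_eps_delta A_def using \<eta>(1) by blast
  obtain d2 where d2: "d2 > 0" "ball (x0, y0) d2 \<subseteq> S" using S openE by blast
  \<comment> \<open>A quarter, since the distance in the product is at most the sum of the two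
    coordinate distances and has to stay strictly below \<open>min d1 d2\<close>.\<close>
  define r where "r = min d1 d2 / 4"
  have r: "r > 0" unfolding r_def using d1 d2 by simp
  define Q where "Q = cball x0 r \<times> cball y0 r"
  have Qd: "dist z (x0, y0) < min d1 d2" if "z \<in> Q" for z
  proof -
    have "dist z (x0, y0) \<le> dist (fst z) x0 + dist (snd z) y0"
      using norm_Pair_le[of "fst z - x0" "snd z - y0"] by (cases z) (simp add: dist_norm)
    also have "\<dots> \<le> r + r" using that unfolding Q_def by (auto simp: dist_commute)
    also have "\<dots> < min d1 d2" using d1(1) d2(1) unfolding r_def by linarith
    finally show ?thesis .
  qed
  have QS: "z \<in> S" if "z \<in> Q" for z using Qd[OF that] d2(2) by (auto simp: dist_commute)
  have QA: "norm (g' z - A) \<le> \<eta>" if "z \<in> Q" for z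
    using Qd[OF that] d1(2)[of z] by (simp add: dist_norm)
  have convQ: "convex Q" unfolding Q_def by (intro convex_Times convex_cball)
  have z0Q: "(x0, y0) \<in> Q" unfolding Q_def using r by simp
  have lin: "norm (g z' - g z - A (z' - z)) \<le> \<eta> * norm (z' - z)" if "z \<in> Q" "z' \<in> Q" for z z'
    unfolding A_def
    using QA that by (intro convex_linearization[OF convQ _ _ z0Q der]) (auto simp: A_def QS)
  have Apair: "A (\<xi>, u) = A (\<xi>, 0) + B u" for \<xi> u
    unfolding B A_def[symmetric] by (simp flip: blinfun.add_right)
  have nA: "norm (A (\<xi>, 0)) \<le> a * norm \<xi>" for \<xi>
    using norm_blinfun[of A "(\<xi>, 0)"] unfolding a_def by (simp add: norm_Pair)

  define Z where "Z = {z. z \<in> Q \<and> (\<forall>d\<in>D. (snd z - y0) \<bullet> d = 0) \<and> g z = 0}"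
  define C where "C = {z. z \<in> Z \<and> (\<exists>v. norm v = 1 \<and> (\<forall>d\<in>D. v \<bullet> d = 0) \<and> g' z (0, v) = 0)}"
  have ZA: "norm (A (z' - z)) \<le> \<eta> * (norm (fst z' - fst z) + norm (snd z' - snd z))" if "z \<in> Z" "z' \<in> Z" for z z'
  proof -
    have "norm (A (z' - z)) \<le> \<eta> * norm (z' - z)"
      using lin[of z z'] that unfolding Z_def by simp
    also have "norm (z' - z) \<le> norm (fst z' - fst z) + norm (snd z' - snd z)"
      using norm_Pair_le[of "fst z' - fst z" "snd z' - snd z"] by (simp add: minus_prod_def)
    finally show ?thesis using \<eta>(1) by simp
  qed
  have Zperp: "(snd z' - snd z) \<bullet> d = 0" if "z \<in> Z" "z' \<in> Z" "d \<in> D" for z z' d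
    using that unfolding Z_def by (simp add: inner_diff_left)
  \<comment> \<open>After \<open>fourier J u\<close> is split off, the rest of \<open>u\<close> is
    bounded by \<open>B u = A (\<xi>, u) - A (\<xi>, 0)\<close>, where \<open>A (\<xi>, u)\<close>
    is small because \<open>g\<close> vanishes at both points.\<close>
  have E1: "norm (snd z' - snd z) \<le> 2 * norm (fourier J (snd z' - snd z)) + c1 * norm (fst z' - fst z)"
    if zz: "z \<in> Z" "z' \<in> Z" for z z'
  proof -
    define \<xi> u where "\<xi> = fst z' - fst z" and "u = snd z' - snd z"
    have zu: "z' - z = (\<xi>, u)" unfolding \<xi>_def u_def by (simp add: minus_prod_def)
    have "norm (B u) \<le> norm (A (\<xi>, u)) + norm (A (\<xi>, 0))"
      using norm_triangle_ineq4[of "A (\<xi>, u)" "A (\<xi>, 0)"] unfolding Apair[of \<xi> u] by simp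
    also have "\<dots> \<le> \<eta> * (norm \<xi> + norm u) + a * norm \<xi>"
      using ZA[OF zz] nA[of \<xi>] unfolding zu \<xi>_def[symmetric] u_def[symmetric] by (rule add_mono)
    finally have "C0 * norm (B u) \<le> C0 * (\<eta> * (norm \<xi> + norm u) + a * norm \<xi>)"
      using C0(1) by simp
    moreover have "norm u \<le> norm (fourier J u) + norm (u - fourier J u)"
      using norm_triangle_ineq[of "fourier J u" "u - fourier J u"] by simp
    moreover have "norm (u - fourier J u) \<le> C0 * norm (B u)"
      using Zperp[OF zz] unfolding u_def by (rule coercive)
    ultimately have "norm u \<le> norm (fourier J u) + C0 * (\<eta> + a) * norm \<xi> + (C0 * \<eta>) * norm u"
      by (simp add: algebra_simps)
    moreover have "(C0 * \<eta>) * norm u \<le> 1/2 * norm u" using \<eta>(3) by (rule mult_right_mono) simp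
    moreover have "C0 * (\<eta> + a) * norm \<xi> \<le> C0 * (1 + a) * norm \<xi>"
      using C0(1) \<eta>(2) by (intro mult_right_mono mult_left_mono) auto
    ultimately have "norm u \<le> 2 * norm (fourier J u) + 2 * (C0 * (1 + a) * norm \<xi>)" by linarith
    thus ?thesis unfolding c1_def u_def \<xi>_def by (simp add: mult.assoc)
  qed
  \<comment> \<open>Evaluating \<open>A (\<xi>, u)\<close> at \<open>i \<in> J\<close> kills
    \<open>B u\<close>, by symmetry because \<open>i\<close> is in the kernel, and returns
    \<open>t i\<close> by duality of \<open>e\<close>. Hence the increment of \<open>x\<close> is
    small against that of \<open>y\<close> and can be absorbed in \<open>E1\<close>. The constant 8
    comes from \<open>norm u \<le> 4 * norm (fourier J u)\<close> and
    \<open>norm \<xi> \<le> norm u\<close>.\<close>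
  have E2: "norm (fst z' - fst z) + norm (snd z' - snd z) \<le> 8 * norm (fourier J (snd z' - snd z))"
    and E2': "\<And>i. i \<in> J \<Longrightarrow> \<bar>t i\<bar> \<le> 8 * norm (fourier J (snd z' - snd z))"
    if zz: "z \<in> Z" "z' \<in> Z" and t: "fst z' - fst z = (\<Sum>j\<in>J. t j *\<^sub>R e j)" for z z' t
  proof -
    define \<xi> u where "\<xi> = fst z' - fst z" and "u = snd z' - snd z"
    have zu: "z' - z = (\<xi>, u)" unfolding \<xi>_def u_def by (simp add: minus_prod_def)
    have Ale: "norm (A (\<xi>, u)) \<le> \<eta> * (norm \<xi> + norm u)"
      using ZA[OF zz] unfolding zu \<xi>_def[symmetric] u_def[symmetric] .
    have ti: "\<bar>t i\<bar> \<le> \<eta> * (norm \<xi> + norm u)" if i: "i \<in> J" for i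
    proof -
      have "A (\<xi>, 0) = (\<Sum>j\<in>J. t j *\<^sub>R A (e j, 0))"
      proof -
        have "(\<xi>, 0) = (\<Sum>j\<in>J. t j *\<^sub>R (e j, 0 :: 'h))"
          unfolding \<xi>_def t by (simp add: sum_prod)
        thus ?thesis by (simp only: blinfun.sum_right blinfun.scaleR_right)
      qed
      hence "A (\<xi>, 0) i = (\<Sum>j\<in>J. t j * A (e j, 0) i)"
        by (simp add: blinfun.sum_left blinfun.scaleR_left)
      also have "\<dots> = (\<Sum>j\<in>J. if j = i then t i else 0)" using e i by (intro sum.cong) auto
      finally have "A (\<xi>, 0) i = t i" using i J(1) by simp
      moreover have "B u i = 0" using Bsym[of u i] B0[OF JN(1)[OF i]] by simp
      ultimately have "A (\<xi>, u) i = t i" unfolding Apair[of \<xi> u] by (simp add: blinfun.add_left)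
      moreover have "norm (A (\<xi>, u) i) \<le> norm (A (\<xi>, u)) * 1"
        using norm_blinfun[of "A (\<xi>, u)" i] JN(3)[OF i] by simp
      ultimately show ?thesis using Ale by simp
    qed
    have "norm \<xi> \<le> (\<Sum>j\<in>J. \<eta> * (norm \<xi> + norm u) * norm (e j))"
      unfolding \<xi>_def t
      by (rule sum_norm_le) (use ti in \<open>auto intro!: mult_right_mono simp: \<xi>_def[symmetric] t[symmetric]\<close>)
    also have "\<dots> = (M * \<eta>) * (norm \<xi> + norm u)"
      unfolding M_def by (simp add: sum_distrib_right sum_distrib_left mult_ac)
    finally have x1: "norm \<xi> \<le> (M * \<eta>) * (norm \<xi> + norm u)" .
    also have "\<dots> \<le> (M * \<eta>) * norm u + 1/2 * norm \<xi>"
      using mult_right_mono[OF \<eta>(4) norm_ge_zero[of \<xi>]] by (simp add: distrib_left)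
    finally have x2: "norm \<xi> \<le> 2 * (M * \<eta>) * norm u" by simp
    have x3: "norm \<xi> \<le> norm u"
      using x2 mult_right_mono[OF \<eta>(4) norm_ge_zero[of u]] by linarith
    have "c1 * norm \<xi> \<le> c1 * (2 * (M * \<eta>) * norm u)" using x2 c1 by simp
    also have "\<dots> \<le> 1/2 * norm u"
      using mult_right_mono[OF \<eta>(5) norm_ge_zero[of u]] by (simp add: mult_ac)
    finally have "norm u \<le> 2 * norm (fourier J u) + 1/2 * norm u"
      using E1[OF zz] unfolding \<xi>_def[symmetric] u_def[symmetric] by linarith
    hence le: "norm \<xi> + norm u \<le> 8 * norm (fourier J u)" using x3 by linarith
    thus "norm (fst z' - fst z) + norm (snd z' - snd z) \<le> 8 * norm (fourier J (snd z' - snd z))"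
      unfolding \<xi>_def u_def .
    show "\<bar>t i\<bar> \<le> 8 * norm (fourier J (snd z' - snd z))" if "i \<in> J" for i
    proof -
      have "\<eta> * (norm \<xi> + norm u) \<le> 1 * (norm \<xi> + norm u)" using \<eta>(2) by (intro mult_right_mono) auto
      from order_trans[OF order_trans[OF ti[OF that] this]] le show ?thesis unfolding u_def by simp
    qed
  qed
  have kerB: "norm (B v) \<le> \<eta> * norm v" if "z \<in> Q" "g' z (0, v) = 0" for z v
  proof -
    have "B v = - ((g' z - A) (0, v))"
      using that(2) unfolding B A_def[symmetric] by (simp add: blinfun.diff_left)
    thus ?thesis using norm_blinfun_le[OF QA[OF that(1)], of "(0, v)" "norm v"] by (simp add: norm_Pair)
  qed
  \<comment> \<open>\<open>v\<close> is close to its component in \<open>span J\<close>, which has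
    norm at least 1/2; the choice of \<open>c3\<close> then makes some coordinate
    \<open>v \<bullet> i\<close> exceed \<open>2 * c3\<close> in absolute value. By duality
    \<open>A (e i, 0)\<close> reads off this coordinate, and the remaining terms amount to at most
    \<open>c3\<close>.\<close>
  have E3: "\<exists>i\<in>J. \<bar>g' z (e i, 0) v\<bar> \<ge> c3"
    if z: "z \<in> Q" and v: "norm v = 1" "\<And>d. d \<in> D \<Longrightarrow> v \<bullet> d = 0" "g' z (0, v) = 0" for z v
  proof -
    have "norm (v - fourier J v) \<le> C0 * norm (B v)" by (rule coercive[OF v(2)])
    also have "\<dots> \<le> C0 * \<eta>" using kerB[OF z v(3)] v(1) C0(1) by simp
    finally have vf: "norm (v - fourier J v) \<le> C0 * \<eta>" .
    hence "norm (fourier J v) \<ge> 1/2"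
      using \<eta>(3) norm_triangle_ineq[of "fourier J v" "v - fourier J v"] v(1) by simp
    moreover have "norm (fourier J v) \<le> p * (2 * c3)" if "\<And>j. j \<in> J \<Longrightarrow> \<bar>v \<bullet> j\<bar> \<le> 2 * c3"
      using norm_fourier_le_card[OF J(2), of v "2 * c3"] that unfolding p_def by blast
    moreover have "p * (2 * c3) < 1/2" unfolding c3_def using p0 by (simp add: field_simps)
    ultimately obtain i where i: "i \<in> J" "\<bar>v \<bullet> i\<bar> > 2 * c3" by fastforce
    have "A (e i, 0) (fourier J v) = (\<Sum>j\<in>J. (v \<bullet> j) * A (e i, 0) j)"
      unfolding fourier_def by (simp add: blinfun.sum_right blinfun.scaleR_right)
    also have "\<dots> = (\<Sum>j\<in>J. if j = i then v \<bullet> i else 0)" using e i(1) by (intro sum.cong) auto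
    finally have 1: "A (e i, 0) (fourier J v) = v \<bullet> i" using i(1) J(1) by simp
    have ei: "norm (e i, 0 :: 'h) \<le> M" using eM[OF i(1)] by (simp add: norm_Pair)
    have "norm (A (e i, 0)) \<le> a * M" unfolding a_def by (rule norm_blinfun_le[OF order_refl ei])
    hence 2: "\<bar>A (e i, 0) (v - fourier J v)\<bar> \<le> (a * M) * (C0 * \<eta>)"
      using norm_blinfun_le[OF _ vf] by fastforce
    have "norm ((g' z - A) (e i, 0)) \<le> \<eta> * M" by (rule norm_blinfun_le[OF QA[OF z] ei])
    hence 3: "\<bar>(g' z - A) (e i, 0) v\<bar> \<le> (\<eta> * M) * 1"
      using norm_blinfun_le[of "(g' z - A) (e i, 0)" "\<eta> * M" v 1] v(1) by simp
    have "g' z (e i, 0) v = A (e i, 0) (fourier J v) + A (e i, 0) (v - fourier J v) + (g' z - A) (e i, 0) v"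
      by (simp add: blinfun.diff_left blinfun.diff_right)
    hence "\<bar>g' z (e i, 0) v\<bar> \<ge> 2 * c3 - (a * M) * (C0 * \<eta>) - \<eta> * M" using 1 2 3 i(2) by linarith
    also have "(a * M) * (C0 * \<eta>) + \<eta> * M \<le> c3" using \<eta>(6) by (simp add: algebra_simps)
    hence "2 * c3 - (a * M) * (C0 * \<eta>) - \<eta> * M \<ge> c3" by linarith
    finally show ?thesis using i(1) by (intro bexI[of _ i]) auto
  qed

  \<comment> \<open>The projection to the first factor is proper on \<open>C\<close>. Along a
    subsequence the finitely many \<open>J\<close>-coordinates of \<open>y\<close> and of
    \<open>v\<close> converge; \<open>E1\<close> and \<open>coercive\<close> extend this to
    \<open>y\<close> and \<open>v\<close> themselves, so that both equations pass to the
    limit.\<close>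
  have proper: "\<exists>s l. strict_mono (s :: nat \<Rightarrow> nat) \<and> l \<in> C \<and> (z \<circ> s) \<longlonglongrightarrow> l \<and> fst l = x"
    if z: "\<And>n. z n \<in> C" and x: "(\<lambda>n. fst (z n)) \<longlonglongrightarrow> x" for z :: "nat \<Rightarrow> 'e \<times> 'h" and x
  proof -
    have zZ: "z n \<in> Z" and zQ: "z n \<in> Q" for n using z[of n] unfolding C_def Z_def by auto
    obtain v where v: "\<And>n. norm (v n) = 1" "\<And>n d. d \<in> D \<Longrightarrow> v n \<bullet> d = 0" "\<And>n. g' (z n) (0, v n) = 0"
      using z unfolding C_def by (simp add: Bex_def) metis
    have "norm (snd (z n) - y0) \<le> r" for n
      using zQ[of n] unfolding Q_def by (auto simp: dist_norm norm_minus_commute)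
    then obtain s1 where s1: "strict_mono (s1 :: nat \<Rightarrow> nat)"
      "convergent (fourier J \<circ> (\<lambda>n. snd (z n) - y0) \<circ> s1)"
      using bounded_fourier_subsequence[OF J(1), of "\<lambda>n. snd (z n) - y0" r] by blast
    have "norm ((v \<circ> s1) n) \<le> 1" for n using v(1) by simp
    then obtain s2 where s2: "strict_mono (s2 :: nat \<Rightarrow> nat)" "convergent (fourier J \<circ> (v \<circ> s1) \<circ> s2)"
      using bounded_fourier_subsequence[OF J(1), of "v \<circ> s1" 1] by blast
    define s where "s = s1 \<circ> s2"
    have s: "strict_mono s" unfolding s_def by (rule strict_mono_o[OF s1(1) s2(1)])
    have xs: "(\<lambda>n. fst (z (s n))) \<longlonglongrightarrow> x" using LIMSEQ_subseq_LIMSEQ[OF x s] by (simp add: o_def)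
    have cy: "convergent (\<lambda>n. fourier J (snd (z (s n)) - y0))"
      using convergent_subseq_convergent[OF s1(2) s2(1)] by (simp add: o_def s_def)
    have cv: "convergent (\<lambda>n. fourier J (v (s n)))" using s2(2) by (simp add: o_def s_def)
    have fd: "fourier J u - fourier J w = fourier J (u - w)" for u w
      using linear_diff[OF bounded_linear.linear[OF bounded_linear_fourier]] by metis
    have "Cauchy (\<lambda>n. snd (z (s n)))"
    proof (rule Cauchy_of_estimate[OF _ cy convergentI[OF xs]])
      show "norm (snd (z (s m)) - snd (z (s n))) \<le> 2 * norm (fourier J (snd (z (s m)) - y0) -
          fourier J (snd (z (s n)) - y0)) + c1 * norm (fst (z (s m)) - fst (z (s n)))" for m n
        using E1[OF zZ zZ, of "s m" "s n"] unfolding fd by simp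
    qed (use c1 in auto)
    then obtain y where y: "(\<lambda>n. snd (z (s n))) \<longlonglongrightarrow> y" using Cauchy_convergent convergent_def by blast
    define l where "l = (x, y)"
    have zl: "(\<lambda>n. z (s n)) \<longlonglongrightarrow> l"
      using tendsto_Pair[OF xs y] unfolding l_def by simp
    have "closed Q" unfolding Q_def by (intro closed_Times closed_cball)
    hence lQ: "l \<in> Q" using closed_sequentially[OF _ _ zl] zQ by blast
    hence lS: "l \<in> S" by (rule QS)
    have "isCont g' l" using cont S(1) lS by (simp add: continuous_on_eq_continuous_at)
    hence g'l: "(\<lambda>n. g' (z (s n))) \<longlonglongrightarrow> g' l" using zl by (rule isCont_tendsto_compose)
    have "isCont g l" by (rule has_derivative_continuous[OF der[OF lS]])
    hence gl: "(\<lambda>n. g (z (s n))) \<longlonglongrightarrow> g l" using zl by (rule isCont_tendsto_compose)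
    have "g (z (s n)) = 0" for n using zZ unfolding Z_def by blast
    hence gl0: "g l = 0" using gl LIMSEQ_unique[OF tendsto_const, of 0 "g l"] by simp
    have "(snd l - y0) \<bullet> d = 0" if "d \<in> D" for d
    proof -
      have "(\<lambda>n. (snd (z (s n)) - y0) \<bullet> d) \<longlonglongrightarrow> (snd l - y0) \<bullet> d"
        unfolding l_def snd_conv by (intro tendsto_intros y)
      moreover have "(snd (z (s n)) - y0) \<bullet> d = 0" for n using zZ that unfolding Z_def by blast
      ultimately show ?thesis using LIMSEQ_unique[OF tendsto_const, of 0] by simp
    qed
    hence lZ: "l \<in> Z" unfolding Z_def using lQ gl0 by blast
    have "Cauchy (\<lambda>n. v (s n))"
    proof (rule Cauchy_of_estimate[OF _ cv convergentI[OF g'l]])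
      fix m n
      define w where "w = v (s m) - v (s n)"
      have "w \<bullet> d = 0" if "d \<in> D" for d unfolding w_def using v(2) that by (simp add: inner_diff_left)
      hence "norm w \<le> norm (fourier J w) + C0 * norm (B w)"
        using coercive[of w] norm_triangle_ineq[of "fourier J w" "w - fourier J w"] by simp
      moreover have "norm (B w) \<le> \<eta> * norm w + norm (g' (z (s m)) - g' (z (s n)))"
      proof -
        have "(0, w) = (0, v (s m)) - (0 :: 'e, v (s n))" unfolding w_def by simp
        hence "g' (z (s m)) (0, w) = g' (z (s m)) (0, v (s m)) - g' (z (s m)) (0, v (s n))"
          by (simp only: blinfun.diff_right)
        also have "\<dots> = - ((g' (z (s m)) - g' (z (s n))) (0, v (s n)))"
          using v(3) by (simp add: blinfun.diff_left)
        finally have "B w = - ((g' (z (s m)) - A) (0, w)) - (g' (z (s m)) - g' (z (s n))) (0, v (s n))"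
          unfolding B A_def[symmetric] by (simp add: blinfun.diff_left)
        hence "norm (B w) \<le> norm ((g' (z (s m)) - A) (0, w)) + norm ((g' (z (s m)) - g' (z (s n))) (0, v (s n)))"
          by (metis norm_minus_cancel norm_triangle_ineq4)
        also have "\<dots> \<le> \<eta> * norm w + norm (g' (z (s m)) - g' (z (s n))) * 1"
          using v(1) by (intro add_mono norm_blinfun_le QA zQ) (auto simp: norm_Pair)
        finally show ?thesis by simp
      qed
      hence "C0 * norm (B w) \<le> C0 * (\<eta> * norm w + norm (g' (z (s m)) - g' (z (s n))))" using C0(1) by simp
      moreover have "(C0 * \<eta>) * norm w \<le> 1/2 * norm w" using \<eta>(3) by (rule mult_right_mono) simp
      ultimately have "norm w \<le> 2 * norm (fourier J w) + 2 * (C0 * norm (g' (z (s m)) - g' (z (s n))))"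
        by (simp add: distrib_left)
      thus "norm (v (s m) - v (s n)) \<le> 2 * norm (fourier J (v (s m)) - fourier J (v (s n)))
          + (2 * C0) * norm (g' (z (s m)) - g' (z (s n)))"
        unfolding w_def fd by simp
    qed (use C0(1) in auto)
    then obtain w where w: "(\<lambda>n. v (s n)) \<longlonglongrightarrow> w" using Cauchy_convergent convergent_def by blast
    have "(\<lambda>n. norm (v (s n))) \<longlonglongrightarrow> norm w" by (intro tendsto_intros w)
    hence w1: "norm w = 1" using v(1) LIMSEQ_unique[OF tendsto_const, of 1 "norm w"] by simp
    have wD: "w \<bullet> d = 0" if "d \<in> D" for d
    proof -
      have "(\<lambda>n. v (s n) \<bullet> d) \<longlonglongrightarrow> w \<bullet> d" by (intro tendsto_intros w)
      thus ?thesis using v(2)[OF that] LIMSEQ_unique[OF tendsto_const, of 0] by simp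
    qed
    have "(\<lambda>n. g' (z (s n)) (0, v (s n))) \<longlonglongrightarrow> g' l (0, w)"
      by (intro tendsto_intros g'l w)
    hence "g' l (0, w) = 0" using v(3) LIMSEQ_unique[OF tendsto_const, of 0] by simp
    hence "l \<in> C" unfolding C_def using lZ w1 wD by blast
    thus ?thesis using s zl unfolding l_def o_def by (intro exI[of _ s] exI[of _ "(x, y)"]) auto
  qed

  have closed: "closed (fst ` C)"
    unfolding closed_sequential_limits
  proof (intro allI impI, elim conjE)
    fix x l assume x: "\<forall>n. x n \<in> fst ` C" "x \<longlonglongrightarrow> l"
    have "\<exists>z\<in>C. fst z = x n" for n using spec[OF x(1), of n] by (elim imageE) (rule bexI, auto)
    then obtain z where z: "\<And>n. z n \<in> C" "\<And>n. fst (z n) = x n" by metis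
    have "\<exists>s l'. strict_mono (s :: nat \<Rightarrow> nat) \<and> l' \<in> C \<and> (z \<circ> s) \<longlonglongrightarrow> l' \<and> fst l' = l"
      using proper[of z l] z x(2) by simp
    thus "l \<in> fst ` C" by blast
  qed
  have "interior (fst ` C) = {}"
  proof (rule ccontr)
    assume "interior (fst ` C) \<noteq> {}"
    then obtain x1 \<rho> where \<rho>: "\<rho> > 0" "ball x1 \<rho> \<subseteq> fst ` C" unfolding ex_in_conv[symmetric] mem_interior by blast
    have Jne: "J \<noteq> {}"
    proof -
      have "x1 \<in> fst ` C" using \<rho> by auto
      then obtain z v where "z \<in> Q" "norm v = 1" "\<And>d. d \<in> D \<Longrightarrow> v \<bullet> d = 0" "g' z (0, v) = 0"
        unfolding C_def Z_def by auto
      thus ?thesis using E3 by blast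
    qed
    have p: "p > 0" unfolding p_def using Jne J(1) by (simp add: card_gt_0_iff)
    \<comment> \<open>Chosen for \<open>\<tau> * M < \<rho>\<close>, which keeps the image of the
      cube under \<open>X\<close> inside the ball; \<open>M + 1\<close> is positive even if all
      \<open>e j\<close> vanish.\<close>
    define \<tau> where "\<tau> = \<rho> / (2 * (M + 1))"
    have \<tau>: "\<tau> > 0" unfolding \<tau>_def using \<rho>(1) M by simp
    define T where "T = {t. \<forall>j\<in>J. 0 \<le> t j \<and> t j \<le> \<tau>}"
    define X where "X t = x1 + (\<Sum>j\<in>J. t j *\<^sub>R e j)" for t
    have "X t \<in> ball x1 \<rho>" if "t \<in> T" for t
    proof -
      have "norm (\<Sum>j\<in>J. t j *\<^sub>R e j) \<le> (\<Sum>j\<in>J. \<tau> * norm (e j))"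
        by (rule sum_norm_le) (use that in \<open>auto simp: T_def intro!: mult_right_mono\<close>)
      also have "\<dots> = \<tau> * M" unfolding M_def by (simp add: sum_distrib_left)
      also have "\<dots> < \<rho>" unfolding \<tau>_def using \<rho>(1) M by (simp add: field_simps) (simp add: add_nonneg_pos)
      finally show ?thesis unfolding X_def by (simp add: dist_norm)
    qed
    hence "\<exists>y. (X t, y) \<in> C" if "t \<in> T" for t using \<rho>(2) that by force
    \<comment> \<open>\<open>Y\<close> is a mere choice of a degenerate zero over each
      \<open>X t\<close>; by \<open>E2\<close> and \<open>E2'\<close> both \<open>t\<close> and
      \<open>Y t\<close> depend on the coordinates \<open>q\<close> in a Lipschitz way.\<close>
    then obtain Y where Y: "\<And>t. t \<in> T \<Longrightarrow> (X t, Y t) \<in> C" by metis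
    have YZ: "(X t, Y t) \<in> Z" and YQ: "(X t, Y t) \<in> Q" if "t \<in> T" for t
      using Y[OF that] unfolding C_def Z_def by auto
    define q where "q t j = (Y t - y0) \<bullet> j" for t j
    have Xd: "X t' - X t = (\<Sum>j\<in>J. (t' j - t j) *\<^sub>R e j)" for t t'
      unfolding X_def by (simp add: scaleR_diff_left sum_subtractf)
    have fY: "norm (fourier J (Y t' - Y t)) \<le> p * h" if "\<And>j. j \<in> J \<Longrightarrow> \<bar>q t' j - q t j\<bar> \<le> h" for t t' h
      unfolding p_def using that by (intro norm_fourier_le_card[OF J(2)]) (simp add: q_def inner_diff_left)
    \<comment> \<open>The graph over the cube is relatively compact: the parameters converge along a
      subsequence, hence so do the points \<open>X t\<close>, and \<open>proper\<close> supplies a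
      limit in \<open>C\<close>.\<close>
    have cpt: "\<exists>s l. strict_mono (s :: nat \<Rightarrow> nat) \<and> l \<in> S \<and> (z \<circ> s) \<longlonglongrightarrow> l"
      if zT: "range z \<subseteq> (\<lambda>t. (X t, Y t)) ` T" for z :: "nat \<Rightarrow> _"
    proof -
      have "\<forall>n. \<exists>t\<in>T. z n = (X t, Y t)" using zT by blast
      then obtain t where t: "\<And>n. t n \<in> T" "\<And>n. z n = (X (t n), Y (t n))" by metis
      have "bounded (range (\<lambda>n. t n j))" if "j \<in> J" for j
      proof (rule boundedI[of _ \<tau>])
        fix c assume "c \<in> range (\<lambda>n. t n j)"
        then obtain n where "c = t n j" by blast
        thus "norm c \<le> \<tau>" using t(1)[of n] that unfolding T_def by auto
      qed
      then obtain s1 where s1: "strict_mono (s1 :: nat \<Rightarrow> nat)" "\<And>j. j \<in> J \<Longrightarrow> convergent ((\<lambda>n. t n j) \<circ> s1)"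
        using finitely_many_bounded_sequences[OF J(1), of "\<lambda>j n. t n j"] by blast
      have "\<forall>j\<in>J. \<exists>l. (\<lambda>n. t (s1 n) j) \<longlonglongrightarrow> l" using s1(2) by (auto simp: convergent_def o_def)
      then obtain \<theta> where \<theta>: "\<And>j. j \<in> J \<Longrightarrow> (\<lambda>n. t (s1 n) j) \<longlonglongrightarrow> \<theta> j" by metis
      have "(\<lambda>n. fst ((z \<circ> s1) n)) \<longlonglongrightarrow> X \<theta>"
        unfolding X_def o_def t(2) fst_conv by (intro tendsto_intros \<theta>)
      moreover have "(z \<circ> s1) n \<in> C" for n using Y t by simp
      ultimately obtain s2 l where s2: "strict_mono (s2 :: nat \<Rightarrow> nat)" "l \<in> C" "(z \<circ> s1 \<circ> s2) \<longlonglongrightarrow> l"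
        using proper[of "z \<circ> s1"] by blast
      have "l \<in> S" using s2(2) QS unfolding C_def Z_def by blast
      thus ?thesis using s2 strict_mono_o[OF s1(1) s2(1)] by (metis o_assoc)
    qed
    show False
    proof (rule lattice_sard[OF J(1) Jne \<tau> r _ T_def, of "8 * p" q])
      show "8 * p > 0" using p by simp
      show "\<bar>q t j\<bar> \<le> r" if "t \<in> T" "j \<in> J" for t j
      proof -
        have "\<bar>q t j\<bar> \<le> norm (Y t - y0) * norm j" unfolding q_def by (rule Cauchy_Schwarz_ineq2)
        thus ?thesis using YQ[OF that(1)] JN(3)[OF that(2)] unfolding Q_def by (simp add: dist_norm norm_minus_commute)
      qed
      show "\<bar>t' j - t j\<bar> \<le> 8 * p * h"
        if tt: "t \<in> T" "t' \<in> T" and h: "\<And>j. j \<in> J \<Longrightarrow> \<bar>q t' j - q t j\<bar> \<le> h" and j: "j \<in> J" for t t' h j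
        using E2'[OF YZ[OF tt(1)] YZ[OF tt(2)], of "\<lambda>j. t' j - t j" j] fY[OF h] j Xd by simp
      fix \<epsilon> :: real assume \<epsilon>: "\<epsilon> > 0"
      \<comment> \<open>Distances on the graph are at most \<open>8 * p * h\<close>, and the
        covector will be divided by a number of absolute value at least \<open>c3\<close>; both
        factors are compensated here.\<close>
      define \<epsilon>' where "\<epsilon>' = \<epsilon> * c3 / (8 * p)"
      have \<epsilon>': "\<epsilon>' > 0" unfolding \<epsilon>'_def using \<epsilon> c3 p by simp
      define K where "K = (\<lambda>t. (X t, Y t)) ` T"
      have "\<exists>\<delta>>0. \<forall>z\<in>K. \<forall>z'\<in>K. norm (z' - z) < \<delta> \<longrightarrow> norm (g z' - g z - g' z (z' - z)) \<le> \<epsilon>' * norm (z' - z)"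
        by (rule C1_uniform_remainder[OF S(1) der cont cpt \<epsilon>']) (simp_all add: K_def)
      then obtain \<delta> where \<delta>: "\<delta> > 0" and rem: "\<And>z z'. z \<in> K \<Longrightarrow> z' \<in> K \<Longrightarrow>
          norm (z' - z) < \<delta> \<Longrightarrow> norm (g z' - g z - g' z (z' - z)) \<le> \<epsilon>' * norm (z' - z)"
        by auto
      show "\<exists>\<delta>>0. \<forall>t\<in>T. \<exists>l. \<exists>i\<in>J. \<bar>l i\<bar> = 1 \<and> (\<forall>t'\<in>T. \<forall>h<\<delta>. (\<forall>j\<in>J. \<bar>q t' j - q t j\<bar> \<le> h)
        \<longrightarrow> \<bar>\<Sum>j\<in>J. l j * (t' j - t j)\<bar> \<le> \<epsilon> * h)"
      proof (intro exI[of _ "\<delta> / (8 * p)"] conjI ballI)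
        show "\<delta> / (8 * p) > 0" using \<delta> p by simp
        fix t assume t: "t \<in> T"
        define z where "z = (X t, Y t)"
        have zQ: "z \<in> Q" unfolding z_def by (rule YQ[OF t])
        obtain v where v: "norm v = 1" "\<And>d. d \<in> D \<Longrightarrow> v \<bullet> d = 0" "g' z (0, v) = 0"
          using Y[OF t] unfolding C_def z_def by blast
        \<comment> \<open>Pairing the remainder estimate with \<open>v\<close> isolates this
          covector: \<open>g\<close> vanishes at both points, and by symmetry
          \<open>g' z (0, Y t' - Y t) v = g' z (0, v) (Y t' - Y t) = 0\<close>, so only the
          variation of \<open>x\<close> remains.\<close>
        define \<mu> where "\<mu> j = g' z (e j, 0) v" for j
        obtain i where i: "i \<in> J" "\<bar>\<mu> i\<bar> \<ge> c3" using E3[OF zQ v] unfolding \<mu>_def by blast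
        have \<mu>i: "\<bar>\<mu> i\<bar> > 0" using i(2) c3 by linarith
        show "\<exists>l. \<exists>i\<in>J. \<bar>l i\<bar> = 1 \<and> (\<forall>t'\<in>T. \<forall>h<\<delta> / (8 * p). (\<forall>j\<in>J. \<bar>q t' j - q t j\<bar> \<le> h)
          \<longrightarrow> \<bar>\<Sum>j\<in>J. l j * (t' j - t j)\<bar> \<le> \<epsilon> * h)"
        proof (intro exI[of _ "\<lambda>j. \<mu> j / \<mu> i"] bexI[OF _ i(1)] conjI ballI allI impI)
          show "\<bar>\<mu> i / \<mu> i\<bar> = 1" using \<mu>i by simp
          fix t' h assume t': "t' \<in> T" and h: "h < \<delta> / (8 * p)" "\<forall>j\<in>J. \<bar>q t' j - q t j\<bar> \<le> h"
          define z' where "z' = (X t', Y t')"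
          have "norm (z' - z) \<le> norm (X t' - X t) + norm (Y t' - Y t)"
            unfolding z_def z'_def by (simp add: norm_Pair_le)
          also have "\<dots> \<le> 8 * norm (fourier J (Y t' - Y t))"
            using E2[OF YZ[OF t] YZ[OF t'], of "\<lambda>j. t' j - t j"] Xd by simp
          also have "\<dots> \<le> 8 * (p * h)" using fY[of t' t h] h(2) by simp
          finally have zz: "norm (z' - z) \<le> 8 * p * h" by simp
          have "8 * p * h < \<delta>" using h(1) p by (simp add: field_simps)
          hence "norm (g z' - g z - g' z (z' - z)) \<le> \<epsilon>' * norm (z' - z)"
            using zz t t' unfolding z_def z'_def K_def[symmetric] by (intro rem) (auto simp: K_def)
          also have "\<dots> \<le> \<epsilon>' * (8 * p * h)" using zz \<epsilon>' by simp
          also have "\<dots> = \<epsilon> * c3 * h" unfolding \<epsilon>'_def using p by simp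
          also have "g z' - g z - g' z (z' - z) = - (g' z (z' - z))"
            using YZ[OF t] YZ[OF t'] unfolding Z_def z_def z'_def by simp
          finally have "norm (g' z (z' - z)) \<le> \<epsilon> * c3 * h" by simp
          hence le: "\<bar>g' z (z' - z) v\<bar> \<le> \<epsilon> * c3 * h"
            using norm_blinfun_le[of "g' z (z' - z)" "\<epsilon> * c3 * h" v 1] v(1) by simp
          have "z' - z = (\<Sum>j\<in>J. (t' j - t j) *\<^sub>R (e j, 0)) + (0, Y t' - Y t)"
            unfolding z_def z'_def using Xd[of t' t] by (simp add: sum_prod)
          hence "g' z (z' - z) v = (\<Sum>j\<in>J. (t' j - t j) * \<mu> j) + g' z (0, Y t' - Y t) v"
            unfolding \<mu>_def
            by (simp only: blinfun.add_right blinfun.sum_right blinfun.scaleR_right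
                blinfun.add_left blinfun.sum_left blinfun.scaleR_left real_scaleR_def)
          also have "g' z (0, Y t' - Y t) v = 0"
            using sym[OF QS[OF zQ], of "Y t' - Y t" v] v(3) by simp
          finally have "\<bar>\<Sum>j\<in>J. \<mu> j * (t' j - t j)\<bar> \<le> \<epsilon> * c3 * h" using le by (simp add: mult.commute)
          hence "\<bar>(\<Sum>j\<in>J. \<mu> j * (t' j - t j)) / \<mu> i\<bar> \<le> \<epsilon> * c3 * h / \<bar>\<mu> i\<bar>"
            using \<mu>i by (simp add: abs_divide divide_right_mono)
          also have "\<dots> \<le> \<epsilon> * h"
          proof -
            have "0 \<le> h" using h(2) i(1) by fastforce
            hence "(\<epsilon> * h) * c3 \<le> (\<epsilon> * h) * \<bar>\<mu> i\<bar>" using \<epsilon> i(2) by (intro mult_left_mono) auto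
            thus ?thesis using \<mu>i by (simp add: pos_divide_le_eq mult_ac)
          qed
          also have "(\<Sum>j\<in>J. \<mu> j * (t' j - t j)) / \<mu> i = (\<Sum>j\<in>J. \<mu> j / \<mu> i * (t' j - t j))"
            by (simp add: sum_divide_distrib)
          finally show "\<bar>\<Sum>j\<in>J. \<mu> j / \<mu> i * (t' j - t j)\<bar> \<le> \<epsilon> * h" .
        qed
      qed
    qed
  qed
  moreover have "C = degenerate_zeros g g' (x0, y0) D r"
    unfolding degenerate_zeros_def C_def Z_def Q_def by (auto simp: dist_commute mem_Times_iff)
  ultimately show ?thesis using that[of r] r closed by simp
qed

section \<open>Maps of class $C^1$ and $C^2$\<close>

lemma fderiv_eq: "fderiv f x = L" if "(f has_derivative blinfun_apply L) (at x)"
  unfolding fderiv_def frechet_derivative_at[OF that, symmetric] by (rule blinfun_apply_inverse)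

lemma Ck_on_cong:
  assumes "\<And>x. x \<in> S \<Longrightarrow> f x = g x"
  shows "Ck_on n S f \<longleftrightarrow> Ck_on n S g"
  unfolding Ck_on_def using assms by simp

text \<open>The definition demands continuity of the top derivative only. For order \<open>n\<close>
  it follows from differentiability in the operator norm, with the bound \<open>C\<close> of the
  derivative of order \<open>n + 1\<close>.\<close>

lemma Ck_on_Suc:
  fixes f :: "'a::real_normed_vector \<Rightarrow> 'b::real_normed_vector"
  assumes "Ck_on (Suc n) S f"
  shows "Ck_on n S f"
proof -
  obtain D where D0: "\<forall>x\<in>S. D 0 x [] = f x"
    and D1: "\<And>j x. j \<le> Suc n \<Longrightarrow> x \<in> S \<Longrightarrow> bounded_multilinear j (D j x)"
    and D2: "\<And>j x \<epsilon>. j < Suc n \<Longrightarrow> x \<in> S \<Longrightarrow> \<epsilon> > 0 \<Longrightarrow> \<exists>\<delta>>0. \<forall>y\<in>S. norm (y - x) < \<delta> \<longrightarrow>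
        (\<forall>vs. length vs = j \<longrightarrow>
           norm (D j y vs - D j x vs - D (Suc j) x ((y - x) # vs))
             \<le> \<epsilon> * norm (y - x) * prod_list (map norm vs))"
    using assms unfolding Ck_on_def by auto
  have "\<exists>\<delta>>0. \<forall>y\<in>S. norm (y - x) < \<delta> \<longrightarrow>
        (\<forall>vs. length vs = n \<longrightarrow> norm (D n y vs - D n x vs) \<le> \<epsilon> * prod_list (map norm vs))"
    if x: "x \<in> S" and \<epsilon>: "\<epsilon> > 0" for x \<epsilon>
  proof -
    obtain \<delta> where \<delta>: "\<delta> > 0" "\<And>y vs. y \<in> S \<Longrightarrow> norm (y - x) < \<delta> \<Longrightarrow> length vs = n \<Longrightarrow>
           norm (D n y vs - D n x vs - D (Suc n) x ((y - x) # vs)) \<le> 1 * norm (y - x) * prod_list (map norm vs)"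
      using D2[of n x 1] x by auto
    obtain C where C: "\<And>vs. length vs = Suc n \<Longrightarrow> norm (D (Suc n) x vs) \<le> C * prod_list (map norm vs)"
      using D1[of "Suc n" x] x unfolding bounded_multilinear_def by auto
    define \<delta>' where "\<delta>' = min \<delta> (\<epsilon> / (\<bar>C\<bar> + 1))"
    show ?thesis
    proof (intro exI conjI ballI impI allI)
      show "\<delta>' > 0" unfolding \<delta>'_def using \<delta> \<epsilon> by (simp add: add_nonneg_pos)
      fix y and vs :: "'a list" assume y: "y \<in> S" "norm (y - x) < \<delta>'" and vs: "length vs = n"
      define P where "P = prod_list (map norm vs)"
      have P: "P \<ge> 0" unfolding P_def by (induction vs) auto
      have 1: "norm (D n y vs - D n x vs - D (Suc n) x ((y - x) # vs)) \<le> norm (y - x) * P"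
        using \<delta>(2)[OF y(1) _ vs] y(2) unfolding \<delta>'_def P_def by simp
      have "norm (D (Suc n) x ((y - x) # vs)) \<le> C * (norm (y - x) * P)"
        using C[of "(y - x) # vs"] vs unfolding P_def by simp
      also have "\<dots> \<le> \<bar>C\<bar> * (norm (y - x) * P)" using P by (intro mult_right_mono) auto
      finally have "norm (D n y vs - D n x vs) \<le> norm (y - x) * P + \<bar>C\<bar> * (norm (y - x) * P)"
        using 1 norm_triangle_ineq[of "D n y vs - D n x vs - D (Suc n) x ((y - x) # vs)" "D (Suc n) x ((y - x) # vs)"]
        by simp
      also have "\<dots> = (norm (y - x) * (\<bar>C\<bar> + 1)) * P" by (simp add: algebra_simps)
      also have "\<dots> \<le> \<epsilon> * P"
        using y(2) P unfolding \<delta>'_def by (intro mult_right_mono) (simp_all add: field_simps add_nonneg_pos)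
      finally show "norm (D n y vs - D n x vs) \<le> \<epsilon> * prod_list (map norm vs)" unfolding P_def .
    qed
  qed
  thus ?thesis
    unfolding Ck_on_def using D0 D1 D2 by (intro exI[of _ D]) simp
qed

lemma Ck_on_le: "Ck_on n S f \<Longrightarrow> m \<le> n \<Longrightarrow> Ck_on m S f"
  by (induction n) (auto simp: le_Suc_eq dest: Ck_on_Suc)

lemma bounded_multilinear_1:
  assumes "bounded_multilinear 1 M"
  shows "bounded_linear (\<lambda>v. M [v])"
proof -
  obtain C where C: "\<And>vs. length vs = 1 \<Longrightarrow> norm (M vs) \<le> C * prod_list (map norm vs)"
    using assms unfolding bounded_multilinear_def by blast
  have "linear (\<lambda>v. M ([0][0 := v]))"
    using assms unfolding bounded_multilinear_def by (metis One_nat_def length_Cons list.size(3) zero_less_one)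
  thus ?thesis
    using C[of "[_]"] by (intro bounded_linear_intro[of _ C])
      (auto simp: linear_add[of "\<lambda>v. M [v]"] linear_scale[of "\<lambda>v. M [v]"] mult.commute)
qed

text \<open>Passes from the list encoding to nested bounded linear maps, so that the second
  derivative becomes a Frechet derivative of the first.\<close>

lemma bounded_multilinear_2:
  assumes "bounded_multilinear 2 M"
  obtains T where "\<And>u v. blinfun_apply (blinfun_apply T u) v = M [u, v]"
proof -
  obtain C where C: "\<And>vs. length vs = 2 \<Longrightarrow> norm (M vs) \<le> C * prod_list (map norm vs)"
    using assms unfolding bounded_multilinear_def by blast
  have lin: "linear (\<lambda>v. M (vs[i := v]))" if "length vs = 2" "i < 2" for vs i
    using assms that unfolding bounded_multilinear_def by blast
  have l1: "linear (\<lambda>u. M [u, v])" for v using lin[of "[0, v]" 0] by simp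
  have l2: "linear (\<lambda>v. M [u, v])" for u using lin[of "[u, 0]" 1] by simp
  have le: "norm (M [u, v]) \<le> (\<bar>C\<bar> * norm u) * norm v" for u v
  proof -
    have "norm (M [u, v]) \<le> C * (norm u * norm v)" using C[of "[u, v]"] by simp
    also have "\<dots> \<le> \<bar>C\<bar> * (norm u * norm v)" by (intro mult_right_mono) auto
    finally show ?thesis by (simp add: mult.assoc)
  qed
  have b2: "bounded_linear (\<lambda>v. M [u, v])" for u
    using le[of u] by (intro bounded_linear_intro[of _ "\<bar>C\<bar> * norm u"])
      (auto simp: linear_add[OF l2] linear_scale[OF l2] mult.commute)
  define T0 where "T0 u = Blinfun (\<lambda>v. M [u, v])" for u
  have T0: "blinfun_apply (T0 u) v = M [u, v]" for u v
    unfolding T0_def by (simp add: bounded_linear_Blinfun_apply[OF b2])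
  have "bounded_linear T0"
  proof (rule bounded_linear_intro[of _ "\<bar>C\<bar>"])
    show "T0 (u + w) = T0 u + T0 w" for u w
      by (rule blinfun_eqI) (simp add: T0 blinfun.add_left linear_add[OF l1])
    show "T0 (c *\<^sub>R u) = c *\<^sub>R T0 u" for c u
      by (rule blinfun_eqI) (simp add: T0 blinfun.scaleR_left linear_scale[OF l1])
    show "norm (T0 u) \<le> norm u * \<bar>C\<bar>" for u
      using le[of u] by (intro norm_blinfun_bound) (auto simp: T0 mult.commute)
  qed
  hence "blinfun_apply (blinfun_apply (Blinfun T0) u) v = M [u, v]" for u v
    by (simp add: bounded_linear_Blinfun_apply T0)
  thus ?thesis using that by blast
qed

lemma has_derivative_at_open:
  fixes f :: "'a::real_normed_vector \<Rightarrow> 'b::real_normed_vector" and L :: "'a \<Rightarrow>\<^sub>L 'b"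
  assumes S: "open S" "x \<in> S"
    and est: "\<And>e. e > 0 \<Longrightarrow> \<exists>d>0. \<forall>y\<in>S. norm (y - x) < d \<longrightarrow> norm (f y - f x - L (y - x)) \<le> e * norm (y - x)"
  shows "(f has_derivative blinfun_apply L) (at x)"
  unfolding has_derivative_at_alt
proof (intro conjI allI impI)
  show "bounded_linear (blinfun_apply L)" by (rule blinfun.bounded_linear_right)
  fix e :: real assume "e > 0"
  then obtain d1 where d1: "d1 > 0"
    "\<And>y. y \<in> S \<Longrightarrow> norm (y - x) < d1 \<Longrightarrow> norm (f y - f x - L (y - x)) \<le> e * norm (y - x)"
    using est by blast
  obtain d2 where d2: "d2 > 0" "ball x d2 \<subseteq> S" using S openE by blast
  have "norm (f y - f x - L (y - x)) \<le> e * norm (y - x)" if "norm (y - x) < min d1 d2" for y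
    using that d2(2) by (intro d1(2)) (auto simp: dist_norm norm_minus_commute)
  thus "\<exists>d>0. \<forall>y. norm (y - x) < d \<longrightarrow> norm (f y - f x - L (y - x)) \<le> e * norm (y - x)"
    using d1(1) d2(1) by (intro exI[of _ "min d1 d2"]) simp
qed

lemma Ck_on_1_derivative:
  fixes f :: "'a::real_normed_vector \<Rightarrow> 'b::real_normed_vector"
  assumes "Ck_on 1 S f" "open S"
  obtains f' where "\<And>x. x \<in> S \<Longrightarrow> (f has_derivative blinfun_apply (f' x)) (at x)" "continuous_on S f'"
proof -
  obtain D where D0: "\<forall>x\<in>S. D 0 x [] = f x"
    and D1: "\<forall>j\<le>1. \<forall>x\<in>S. bounded_multilinear j (D j x)"
    and D2: "\<forall>j<1. \<forall>x\<in>S. \<forall>\<epsilon>>0. \<exists>\<delta>>0. \<forall>y\<in>S. norm (y - x) < \<delta> \<longrightarrow>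
        (\<forall>vs. length vs = j \<longrightarrow>
           norm (D j y vs - D j x vs - D (Suc j) x ((y - x) # vs))
             \<le> \<epsilon> * norm (y - x) * prod_list (map norm vs))"
    and D3: "\<forall>x\<in>S. \<forall>\<epsilon>>0. \<exists>\<delta>>0. \<forall>y\<in>S. norm (y - x) < \<delta> \<longrightarrow>
        (\<forall>vs. length vs = 1 \<longrightarrow> norm (D 1 y vs - D 1 x vs) \<le> \<epsilon> * prod_list (map norm vs))"
    using assms(1) unfolding Ck_on_def by (elim exE conjE) (rule that)
  define f' where "f' x = Blinfun (\<lambda>v. D 1 x [v])" for x
  have f': "blinfun_apply (f' x) v = D 1 x [v]" if "x \<in> S" for x v
    unfolding f'_def bounded_linear_Blinfun_apply[OF bounded_multilinear_1[OF D1[rule_format, OF order_refl that]]] ..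
  have der: "(f has_derivative blinfun_apply (f' x)) (at x)" if x: "x \<in> S" for x
  proof (rule has_derivative_at_open[OF assms(2) x])
    fix e :: real assume e: "e > 0"
    obtain d where "d > 0" "\<And>y. y \<in> S \<Longrightarrow> norm (y - x) < d \<Longrightarrow>
        norm (D 0 y [] - D 0 x [] - D 1 x [y - x]) \<le> e * norm (y - x)"
      using D2[rule_format, OF zero_less_one x e] by auto
    thus "\<exists>d>0. \<forall>y\<in>S. norm (y - x) < d \<longrightarrow> norm (f y - f x - f' x (y - x)) \<le> e * norm (y - x)"
      using x by (intro exI[of _ d]) (simp add: D0 f')
  qed
  have "continuous_on S f'"
    unfolding continuous_on_iff
  proof (intro ballI allI impI)
    fix x and e :: real assume x: "x \<in> S" and e: "e > 0"
    obtain d where d: "d > 0" "\<And>y v. y \<in> S \<Longrightarrow> norm (y - x) < d \<Longrightarrow> norm (D 1 y [v] - D 1 x [v]) \<le> (e / 2) * norm v"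
    proof -
      obtain d where d: "d > 0" "\<And>y vs. y \<in> S \<Longrightarrow> norm (y - x) < d \<Longrightarrow> length vs = 1 \<Longrightarrow>
          norm (D 1 y vs - D 1 x vs) \<le> (e / 2) * prod_list (map norm vs)"
        using D3[rule_format, OF x half_gt_zero[OF e]] by auto
      show ?thesis by (rule that[OF d(1)]) (use d(2)[of _ "[_]"] in simp)
    qed
    show "\<exists>d>0. \<forall>y\<in>S. dist y x < d \<longrightarrow> dist (f' y) (f' x) < e"
    proof (intro exI conjI ballI impI)
      fix y assume y: "y \<in> S" "dist y x < d"
      have "norm (f' y - f' x) \<le> e / 2"
        using e d(2)[OF y(1)] y x by (intro norm_blinfun_bound) (auto simp: blinfun.diff_left f' dist_norm)
      thus "dist (f' y) (f' x) < e" using e by (simp add: dist_norm)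
    qed (rule d(1))
  qed
  thus ?thesis using that der by blast
qed

lemma Ck_on_2_derivatives:
  fixes f :: "'a::real_normed_vector \<Rightarrow> 'b::real_normed_vector"
  assumes "Ck_on 2 S f" "open S"
  obtains f' f'' where "\<And>x. x \<in> S \<Longrightarrow> (f has_derivative blinfun_apply (f' x)) (at x)"
    "\<And>x. x \<in> S \<Longrightarrow> (f' has_derivative blinfun_apply (f'' x)) (at x)" "continuous_on S f''"
proof -
  obtain D where D0: "\<forall>x\<in>S. D 0 x [] = f x"
    and D1: "\<forall>j\<le>2. \<forall>x\<in>S. bounded_multilinear j (D j x)"
    and D2: "\<forall>j<2. \<forall>x\<in>S. \<forall>\<epsilon>>0. \<exists>\<delta>>0. \<forall>y\<in>S. norm (y - x) < \<delta> \<longrightarrow>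
        (\<forall>vs. length vs = j \<longrightarrow>
           norm (D j y vs - D j x vs - D (Suc j) x ((y - x) # vs))
             \<le> \<epsilon> * norm (y - x) * prod_list (map norm vs))"
    and D3: "\<forall>x\<in>S. \<forall>\<epsilon>>0. \<exists>\<delta>>0. \<forall>y\<in>S. norm (y - x) < \<delta> \<longrightarrow>
        (\<forall>vs. length vs = 2 \<longrightarrow> norm (D 2 y vs - D 2 x vs) \<le> \<epsilon> * prod_list (map norm vs))"
    using assms(1) unfolding Ck_on_def by (elim exE conjE) (rule that)
  define f' where "f' x = Blinfun (\<lambda>v. D 1 x [v])" for x
  have f': "blinfun_apply (f' x) v = D 1 x [v]" if "x \<in> S" for x v
    unfolding f'_def using D1[rule_format, of 1 x] that
    by (simp add: bounded_linear_Blinfun_apply[OF bounded_multilinear_1])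
  have "\<exists>T. \<forall>u v. blinfun_apply (blinfun_apply T u) v = D 2 x [u, v]" if x: "x \<in> S" for x
    using bounded_multilinear_2[OF D1[rule_format, OF order_refl x]] by metis
  then obtain f'' where f'': "\<And>x u v. x \<in> S \<Longrightarrow> blinfun_apply (blinfun_apply (f'' x) u) v = D 2 x [u, v]"
    by metis
  have der: "(f has_derivative blinfun_apply (f' x)) (at x)" if x: "x \<in> S" for x
  proof (rule has_derivative_at_open[OF assms(2) x])
    fix e :: real assume e: "e > 0"
    obtain d where "d > 0" "\<And>y. y \<in> S \<Longrightarrow> norm (y - x) < d \<Longrightarrow>
        norm (D 0 y [] - D 0 x [] - D 1 x [y - x]) \<le> e * norm (y - x)"
      using D2[rule_format, OF _ x e, of 0] by auto
    thus "\<exists>d>0. \<forall>y\<in>S. norm (y - x) < d \<longrightarrow> norm (f y - f x - f' x (y - x)) \<le> e * norm (y - x)"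
      using x by (intro exI[of _ d]) (simp add: D0 f')
  qed
  have der2: "(f' has_derivative blinfun_apply (f'' x)) (at x)" if x: "x \<in> S" for x
  proof (rule has_derivative_at_open[OF assms(2) x])
    fix e :: real assume e: "e > 0"
    obtain d where d: "d > 0" and d': "\<And>y vs. y \<in> S \<Longrightarrow> norm (y - x) < d \<Longrightarrow> length vs = 1 \<Longrightarrow>
        norm (D 1 y vs - D 1 x vs - D (Suc 1) x ((y - x) # vs)) \<le> e * norm (y - x) * prod_list (map norm vs)"
      using D2[rule_format, OF _ x e, of 1] by auto
    show "\<exists>d>0. \<forall>y\<in>S. norm (y - x) < d \<longrightarrow> norm (f' y - f' x - f'' x (y - x)) \<le> e * norm (y - x)"
    proof (intro exI conjI ballI impI)
      fix y assume y: "y \<in> S" "norm (y - x) < d"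
      have "norm (D 1 y [v] - D 1 x [v] - D 2 x [y - x, v]) \<le> e * norm (y - x) * norm v" for v
        using d'[OF y, of "[v]"] by (simp add: numeral_2_eq_2)
      thus "norm (f' y - f' x - f'' x (y - x)) \<le> e * norm (y - x)"
        using e by (intro norm_blinfun_bound) (auto simp: blinfun.diff_left f'[OF y(1)] f'[OF x] f''[OF x])
    qed (rule d)
  qed
  have "continuous_on S f''"
    unfolding continuous_on_iff
  proof (intro ballI allI impI)
    fix x and e :: real assume x: "x \<in> S" and e: "e > 0"
    obtain d where d: "d > 0" and d': "\<And>y vs. y \<in> S \<Longrightarrow> norm (y - x) < d \<Longrightarrow> length vs = 2 \<Longrightarrow>
        norm (D 2 y vs - D 2 x vs) \<le> (e / 2) * prod_list (map norm vs)"
      using D3[rule_format, OF x half_gt_zero[OF e]] by auto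
    show "\<exists>d>0. \<forall>y\<in>S. dist y x < d \<longrightarrow> dist (f'' y) (f'' x) < e"
    proof (intro exI conjI ballI impI)
      fix y assume y: "y \<in> S" "dist y x < d"
      have "norm (D 2 y [u, v] - D 2 x [u, v]) \<le> ((e / 2) * norm u) * norm v" for u v
        using d'[OF y(1), of "[u, v]"] y(2) by (simp add: dist_norm mult.assoc)
      hence "norm (f'' y - f'' x) \<le> e / 2"
        using e by (intro norm_blinfun_bound) (auto simp: blinfun.diff_left f''[OF x] f''[OF y(1)])
      thus "dist (f'' y) (f'' x) < e" using e by (simp add: dist_norm)
    qed (rule d)
  qed
  thus ?thesis using that der der2 by blast
qed

section \<open>Transformation of second derivatives, and slices\<close>

lemma has_derivative_difference_quotient:
  fixes F :: "'a::real_normed_vector \<Rightarrow> 'b::real_normed_vector"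
  assumes "(F has_derivative F') (at p)"
  shows "((\<lambda>t. (1 / t) *\<^sub>R (F (p + t *\<^sub>R u) - F p)) \<longlongrightarrow> F' u) (at (0::real))"
proof -
  have 1: "((\<lambda>t. p + t *\<^sub>R u) has_derivative (\<lambda>t. t *\<^sub>R u)) (at (0::real))"
    by (auto intro!: derivative_eq_intros)
  have "((\<lambda>t. F (p + t *\<^sub>R u)) has_derivative (\<lambda>t. F' (t *\<^sub>R u))) (at (0::real))"
    using has_derivative_compose[OF 1, of F F'] assms by simp
  hence "((\<lambda>t. norm (F (p + t *\<^sub>R u) - F p - F' (t *\<^sub>R u)) / norm t) \<longlongrightarrow> 0) (at (0::real))"
    unfolding has_derivative_iff_norm by simp
  moreover have "eventually (\<lambda>t. norm (F (p + t *\<^sub>R u) - F p - F' (t *\<^sub>R u)) / norm t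
      = norm ((1 / t) *\<^sub>R (F (p + t *\<^sub>R u) - F p) - F' u)) (at (0::real))"
    unfolding eventually_at_filter
  proof (intro always_eventually allI impI)
    fix t :: real assume t: "t \<noteq> 0"
    have "F' (t *\<^sub>R u) = t *\<^sub>R F' u" using has_derivative_linear[OF assms] by (rule linear_scale)
    hence "(1 / t) *\<^sub>R (F (p + t *\<^sub>R u) - F p) - F' u = (1 / t) *\<^sub>R (F (p + t *\<^sub>R u) - F p - F' (t *\<^sub>R u))"
      using t by (simp add: scaleR_diff_right)
    thus "norm (F (p + t *\<^sub>R u) - F p - F' (t *\<^sub>R u)) / norm t
      = norm ((1 / t) *\<^sub>R (F (p + t *\<^sub>R u) - F p) - F' u)" by simp
  qed
  ultimately have "((\<lambda>t. norm ((1 / t) *\<^sub>R (F (p + t *\<^sub>R u) - F p) - F' u)) \<longlongrightarrow> 0) (at (0::real))"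
    by (rule Lim_transform_eventually)
  thus ?thesis by (rule LIM_zero_cancel[OF tendsto_norm_zero_cancel])
qed

text \<open>
  At a critical point the second derivative transforms tensorially even under a map \<open>\<psi>\<close> that is only
  of class $C^1$, because \<open>G2\<close> vanishes there.
\<close>

lemma second_derivative_transform:
  fixes G1 :: "'a::real_normed_vector \<Rightarrow> 'a \<Rightarrow>\<^sub>L real" and G2 :: "'b::real_normed_vector \<Rightarrow> 'b \<Rightarrow>\<^sub>L real"
  assumes P: "open P" "p \<in> P" and eq: "\<And>b. b \<in> P \<Longrightarrow> G1 b = G2 (\<psi> b) o\<^sub>L \<psi>' b"
    and \<psi>': "continuous_on P \<psi>'" and \<psi>: "(\<psi> has_derivative blinfun_apply (\<psi>' p)) (at p)"
    and G1: "(G1 has_derivative blinfun_apply H1) (at p)"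
    and G2: "(G2 has_derivative blinfun_apply H2) (at (\<psi> p))" "G2 (\<psi> p) = 0"
  shows "H1 u v = H2 (\<psi>' p u) (\<psi>' p v)"
proof -
  have G1p: "G1 p = 0" using eq[OF P(2)] G2(2) by simp
  have line: "((\<lambda>t. p + t *\<^sub>R u) \<longlongrightarrow> p) (at (0::real))"
    by (auto intro!: tendsto_eq_intros)
  have "((\<lambda>t. (1 / t) *\<^sub>R (G1 (p + t *\<^sub>R u) - G1 p)) \<longlongrightarrow> H1 u) (at (0::real))"
    by (rule has_derivative_difference_quotient[OF G1])
  hence lim1: "((\<lambda>t. ((1 / t) *\<^sub>R (G1 (p + t *\<^sub>R u) - G1 p)) v) \<longlongrightarrow> H1 u v) (at (0::real))"
    by (rule blinfun.tendsto[OF _ tendsto_const])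
  have "((G2 \<circ> \<psi>) has_derivative (\<lambda>x. H2 (\<psi>' p x))) (at p)"
    using has_derivative_compose[OF \<psi> G2(1)] by (simp add: o_def)
  hence "((\<lambda>t. (1 / t) *\<^sub>R ((G2 \<circ> \<psi>) (p + t *\<^sub>R u) - (G2 \<circ> \<psi>) p)) \<longlongrightarrow> H2 (\<psi>' p u)) (at (0::real))"
    by (rule has_derivative_difference_quotient)
  moreover have "((\<lambda>t. \<psi>' (p + t *\<^sub>R u)) \<longlongrightarrow> \<psi>' p) (at (0::real))"
    using \<psi>' P by (intro isCont_tendsto_compose[OF _ line]) (simp add: continuous_on_eq_continuous_at)
  \<comment> \<open>\<open>G1\<close> and \<open>G2 \<circ> \<psi>\<close> both vanish at
    \<open>p\<close>, so the difference quotient of \<open>G1\<close> is that of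
    \<open>G2 \<circ> \<psi>\<close> composed with \<open>\<psi>'\<close> at the moving point. The
    limit of the second factor is a matter of continuity of \<open>\<psi>'\<close>.\<close>
  ultimately have lim2: "((\<lambda>t. ((1 / t) *\<^sub>R ((G2 \<circ> \<psi>) (p + t *\<^sub>R u) - (G2 \<circ> \<psi>) p)) (\<psi>' (p + t *\<^sub>R u) v))
      \<longlongrightarrow> H2 (\<psi>' p u) (\<psi>' p v)) (at (0::real))"
    by (intro tendsto_intros)
  have "eventually (\<lambda>t. p + t *\<^sub>R u \<in> P) (at (0::real))"
    using topological_tendstoD[OF line P] .
  hence "eventually (\<lambda>t. ((1 / t) *\<^sub>R (G1 (p + t *\<^sub>R u) - G1 p)) v
      = ((1 / t) *\<^sub>R ((G2 \<circ> \<psi>) (p + t *\<^sub>R u) - (G2 \<circ> \<psi>) p)) (\<psi>' (p + t *\<^sub>R u) v)) (at (0::real))"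
    by eventually_elim (simp add: G1p G2(2) eq blinfun.scaleR_left)
  hence "((\<lambda>t. ((1 / t) *\<^sub>R (G1 (p + t *\<^sub>R u) - G1 p)) v) \<longlongrightarrow> H2 (\<psi>' p u) (\<psi>' p v)) (at (0::real))"
    using lim2 by (rule tendsto_cong[THEN iffD2])
  thus ?thesis using tendsto_unique[OF _ lim1] by simp
qed

text \<open>
  Banach's fixed point theorem on \<open>D\<close>, applied to \<open>d \<mapsto> d - P\<^sub>D (\<alpha> (m0 + E d, b) - p)\<close> for a right inverse
  \<open>E\<close> of the partial derivative of \<open>\<alpha>\<close>.
\<close>

lemma slice_through_point:
  fixes \<alpha> :: "'m::real_normed_vector \<times> 'h::{real_inner,banach} \<Rightarrow> 'h"
  assumes S: "open S" "(m0, p) \<in> S"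
    and der: "\<And>z. z \<in> S \<Longrightarrow> (\<alpha> has_derivative blinfun_apply (\<alpha>' z)) (at z)"
    and cont: "continuous_on S \<alpha>'"
    and id: "\<And>b. (m0, b) \<in> S \<Longrightarrow> \<alpha> (m0, b) = b"
    and D: "D = range (\<lambda>m. \<alpha>' (m0, p) (m, 0))" "finite_dimensional D"
    and \<epsilon>: "\<epsilon> > 0"
  shows "\<exists>\<delta>>0. \<forall>b. dist b p < \<delta> \<longrightarrow>
    (\<exists>m. (m, b) \<in> S \<and> dist (\<alpha> (m, b)) p < \<epsilon> \<and> (\<forall>d\<in>D. (\<alpha> (m, b) - p) \<bullet> d = 0))"
proof -
  define A where "A = \<alpha>' (m0, p)"
  have "subspace D"
  proof -
    have "linear (\<lambda>m. (m, 0 :: 'h))" by (rule linearI) auto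
    hence "linear (\<lambda>m. A (m, 0))"
      using linear_compose[OF _ bounded_linear.linear[OF blinfun.bounded_linear_right]] by (auto simp: o_def)
    thus ?thesis unfolding D(1) A_def[symmetric] by (rule linear_subspace_image) simp
  qed
  then obtain J where J: "finite J" "orthonormal J" "span J = D"
    using finite_dimensional_orthonormal_basis D(2) by metis
  have "\<forall>j\<in>J. \<exists>m. A (m, 0) = j" using J(3) span_base unfolding D(1) A_def[symmetric] by fastforce
  then obtain e where e: "\<And>j. j \<in> J \<Longrightarrow> A (e j, 0) = j" by metis
  define E where "E d = (\<Sum>j\<in>J. (d \<bullet> j) *\<^sub>R e j)" for d
  have "bounded_linear E"
    unfolding E_def
    by (intro bounded_linear_sum bounded_linear_scaleR_left[THEN bounded_linear_compose] bounded_linear_inner_left)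
  then obtain K where K: "K > 0" "\<And>d. norm (E d) \<le> norm d * K" and Elin: "linear E"
    using bounded_linear.pos_bounded bounded_linear.linear by blast
  have AE: "A (E d, 0) = d" if "d \<in> D" for d
  proof -
    have "(E d, 0 :: 'h) = (\<Sum>j\<in>J. (d \<bullet> j) *\<^sub>R (e j, 0))" unfolding E_def by (simp add: sum_prod)
    hence "A (E d, 0) = (\<Sum>j\<in>J. (d \<bullet> j) *\<^sub>R A (e j, 0))" by (simp only: blinfun.sum_right blinfun.scaleR_right)
    also have "\<dots> = fourier J d" unfolding fourier_def using e by (intro sum.cong) auto
    also have "\<dots> = d" using fourier_id[OF J(1,2)] that J(3) by blast
    finally show ?thesis .
  qed
  \<comment> \<open>\<open>E\<close> stretches norms by at most \<open>K\<close> and the projection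
    does not increase them, so this bound on the remainder makes \<open>\<Theta>\<close> a
    contraction with factor 1/2.\<close>
  define \<eta> where "\<eta> = 1 / (2 * K)"
  have \<eta>: "\<eta> > 0" unfolding \<eta>_def using K(1) by simp
  have "isCont \<alpha>' (m0, p)" using cont S by (simp add: continuous_on_eq_continuous_at)
  then obtain r1 where r1: "r1 > 0" "\<And>z. dist z (m0, p) < r1 \<Longrightarrow> dist (\<alpha>' z) A < \<eta>"
    unfolding continuous_at_eps_delta A_def using \<eta> by blast
  have "isCont \<alpha> (m0, p)" by (rule has_derivative_continuous[OF der[OF S(2)]])
  then obtain r2 where r2: "r2 > 0" "\<And>z. dist z (m0, p) < r2 \<Longrightarrow> dist (\<alpha> z) (\<alpha> (m0, p)) < \<epsilon>"
    unfolding continuous_at_eps_delta using \<epsilon> by blast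
  obtain r3 where r3: "r3 > 0" "ball (m0, p) r3 \<subseteq> S" using S openE by blast
  define r where "r = min r1 (min r2 r3)"
  have r: "r > 0" unfolding r_def using r1 r2 r3 by simp
  have lin: "norm (\<alpha> z' - \<alpha> z - A (z' - z)) \<le> \<eta> * norm (z' - z)"
    if zz: "z \<in> ball (m0, p) r" "z' \<in> ball (m0, p) r" for z z'
    unfolding A_def
  proof (rule convex_linearization[OF convex_ball zz])
    show "(m0, p) \<in> ball (m0, p) r" using r by simp
    show "(\<alpha> has_derivative blinfun_apply (\<alpha>' w)) (at w)" if "w \<in> ball (m0, p) r" for w
      using that r3(2) unfolding r_def by (intro der) auto
    show "norm (\<alpha>' w - \<alpha>' (m0, p)) \<le> \<eta>" if "w \<in> ball (m0, p) r" for w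
      using r1(2)[of w] that unfolding r_def A_def by (simp add: dist_norm norm_minus_commute)
  qed
  define \<rho> where "\<rho> = r / (4 * K)"
  have \<rho>: "\<rho> > 0" unfolding \<rho>_def using r K(1) by simp
  \<comment> \<open>With \<open>\<rho> * K = r / 4\<close>, the first bound keeps
    \<open>(m0 + E d, b)\<close> in the ball of radius \<open>r\<close>. The second gives
    \<open>norm (\<Theta> 0) \<le> \<rho> / 2\<close>, so that \<open>\<Theta>\<close> maps
    \<open>Q\<close> into itself.\<close>
  define \<delta> where "\<delta> = min (r / 4) (\<rho> / 2)"
  show ?thesis
  proof (intro exI[of _ \<delta>] conjI allI impI)
    show "\<delta> > 0" unfolding \<delta>_def using r \<rho> by simp
    fix b assume b: "dist b p < \<delta>"
    define Q where "Q = cball 0 \<rho> \<inter> D"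
    have inb: "(m0 + E d, b) \<in> ball (m0, p) r" if "d \<in> Q" for d
    proof -
      have "dist (m0, p) (m0 + E d, b) \<le> norm (E d) + dist b p"
        using norm_Pair_le[of "- E d" "p - b"] by (simp add: dist_norm norm_minus_commute)
      also have "norm (E d) \<le> \<rho> * K" using order_trans[OF K(2)[of d]] that K(1) unfolding Q_def by simp
      also have "\<rho> * K + dist b p < r" using b r K(1) unfolding \<rho>_def \<delta>_def by simp
      finally show ?thesis by simp
    qed
    define \<Theta> where "\<Theta> d = d - fourier J (\<alpha> (m0 + E d, b) - p)" for d
    have fdiff: "fourier J u - fourier J w = fourier J (u - w)" for u w
      using linear_diff[OF bounded_linear.linear[OF bounded_linear_fourier]] by metis
    have lip: "dist (\<Theta> d) (\<Theta> d') \<le> 1/2 * dist d d'" if dd: "d \<in> Q" "d' \<in> Q" for d d'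
    proof -
      define z z' where "z = (m0 + E d, b)" and "z' = (m0 + E d', b)"
      have dD: "d - d' \<in> D" using dd \<open>subspace D\<close> unfolding Q_def by (auto intro: subspace_diff)
      have zz: "z - z' = (E (d - d'), 0)" unfolding z_def z'_def by (simp add: linear_diff[OF Elin])
      have "\<Theta> d - \<Theta> d' = (d - d') - (fourier J (\<alpha> z - p) - fourier J (\<alpha> z' - p))"
        unfolding \<Theta>_def z_def z'_def by simp
      \<comment> \<open>\<open>d - d'\<close> is at once its own projection and the value of
        \<open>A\<close> at \<open>(E (d - d'), 0)\<close>, so the linear part of
        \<open>\<alpha>\<close> cancels and only its remainder is left.\<close>
      also have "\<dots> = fourier J (d - d') - fourier J (\<alpha> z - \<alpha> z')"
        using fourier_id[OF J(1,2), of "d - d'"] dD J(3) by (simp add: fdiff)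
      also have "\<dots> = fourier J (A (z - z') - (\<alpha> z - \<alpha> z'))"
        unfolding fdiff zz AE[OF dD] ..
      finally have "norm (\<Theta> d - \<Theta> d') \<le> norm (A (z - z') - (\<alpha> z - \<alpha> z'))"
        using norm_fourier_le[OF J(1,2)] by simp
      also have "\<dots> \<le> \<eta> * norm (z - z')"
        using lin[OF inb[OF dd(2)] inb[OF dd(1)]] unfolding z_def z'_def by (simp only: norm_minus_commute)
      also have "\<eta> * norm (z - z') \<le> \<eta> * (norm (d - d') * K)"
        unfolding zz using \<eta> K(2) by (simp add: norm_Pair)
      also have "\<dots> = 1/2 * norm (d - d')" using K(1) unfolding \<eta>_def by simp
      finally show ?thesis by (simp add: dist_norm)
    qed
    have zQ: "0 \<in> Q" unfolding Q_def using \<rho> \<open>subspace D\<close> by (simp add: subspace_0)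
    have \<Theta>0: "norm (\<Theta> 0) \<le> \<rho> / 2"
    proof -
      have "(m0, b) \<in> S" using inb[OF zQ] r3(2) unfolding r_def by (auto simp: linear_0[OF Elin])
      hence "\<Theta> 0 = - fourier J (b - p)" unfolding \<Theta>_def by (simp add: linear_0[OF Elin] id)
      also have "norm \<dots> \<le> norm (b - p)" using norm_fourier_le[OF J(1,2)] by simp
      finally show ?thesis using b unfolding \<delta>_def by (simp add: dist_norm)
    qed
    have "\<exists>!d\<in>Q. \<Theta> d = d"
    proof (rule Banach_fix[of Q "1/2"])
      have "closed D"
      proof -
        have "D = {u. fourier J u = u}"
          using fourier_id[OF J(1,2)] fourier_in_span[of J] J(3) by (metis (mono_tags, lifting) Collect_cong Collect_mem_eq)
        thus ?thesis
          using bounded_linear.linear[OF bounded_linear_fourier] linear_continuous_on[OF bounded_linear_fourier]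
          by (auto intro!: closed_Collect_eq simp: continuous_on_id)
      qed
      thus "complete Q" unfolding Q_def complete_eq_closed by (intro closed_Int closed_cball)
      show "Q \<noteq> {}" using zQ by blast
      show "\<Theta> ` Q \<subseteq> Q"
      proof
        fix x assume "x \<in> \<Theta> ` Q"
        then obtain d where d: "d \<in> Q" "x = \<Theta> d" by blast
        have "norm (\<Theta> d) \<le> norm (\<Theta> d - \<Theta> 0) + norm (\<Theta> 0)" using norm_triangle_ineq[of "\<Theta> d - \<Theta> 0" "\<Theta> 0"] by simp
        also have "\<dots> \<le> 1/2 * norm d + \<rho> / 2" using lip[OF d(1) zQ] \<Theta>0 by (simp add: dist_norm)
        also have "\<dots> \<le> \<rho>" using d(1) unfolding Q_def by simp
        finally have "norm (\<Theta> d) \<le> \<rho>" .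
        moreover have "\<Theta> d \<in> D"
          unfolding \<Theta>_def using d(1) fourier_in_span[of J] J(3)
          by (intro subspace_diff[OF \<open>subspace D\<close>]) (auto simp: Q_def)
        ultimately show "x \<in> Q" unfolding Q_def d(2) by simp
      qed
    qed (use lip in auto)
    then obtain d where d: "d \<in> Q" "\<Theta> d = d" by blast
    define z where "z = (m0 + E d, b)"
    have zb: "z \<in> ball (m0, p) r" unfolding z_def by (rule inb[OF d(1)])
    have f0: "fourier J (\<alpha> z - p) = 0" using d(2) unfolding \<Theta>_def z_def by simp
    have "(\<alpha> z - p) \<bullet> w = 0" if "w \<in> D" for w
      using fourier_orthogonal[OF J(1,2), of w "\<alpha> z - p"] that J(3) f0 by simp
    moreover have "z \<in> S" using zb r3(2) unfolding r_def by auto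
    moreover have "dist (\<alpha> z) p < \<epsilon>"
      using r2(2)[of z] zb id[OF S(2)] unfolding r_def by (simp add: dist_commute)
    ultimately show "\<exists>m. (m, b) \<in> S \<and> dist (\<alpha> (m, b)) p < \<epsilon> \<and> (\<forall>d\<in>D. (\<alpha> (m, b) - p) \<bullet> d = 0)"
      unfolding z_def by blast
  qed
qed

section \<open>Charts\<close>

lemma smooth_atlasD:
  assumes "smooth_atlas \<A>" "c \<in> \<A>"
  shows "open (fst c)" "open (snd c ` fst c)" "continuous_on (fst c) (snd c)"
    "continuous_on (snd c ` fst c) (chart_inv c)"
    "\<And>p. p \<in> fst c \<Longrightarrow> chart_inv c (snd c p) = p"
    "\<And>a. a \<in> snd c ` fst c \<Longrightarrow> chart_inv c a \<in> fst c"
    "\<And>a. a \<in> snd c ` fst c \<Longrightarrow> snd c (chart_inv c a) = a"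
  using assms unfolding smooth_atlas_def homeomorphism_def by auto

lemma chart_at:
  assumes "smooth_atlas \<A>"
  shows "chart_at \<A> p \<in> \<A>" "p \<in> fst (chart_at \<A> p)"
proof -
  have "\<exists>c. c \<in> \<A> \<and> p \<in> fst c" using assms unfolding smooth_atlas_def by blast
  hence "chart_at \<A> p \<in> \<A> \<and> p \<in> fst (chart_at \<A> p)" unfolding chart_at_def by (rule someI_ex)
  thus "chart_at \<A> p \<in> \<A>" "p \<in> fst (chart_at \<A> p)" by auto
qed

text \<open>\<open>chart_inv\<close> of a product chart is an \<open>inv_into\<close>, which agrees
  with the pair of inverses only on the image of the chart. The statement fixes the explicit pair,
  so that derivatives can be taken on an open subset of the product of the model spaces.\<close>

lemma Ck_map_prod_chart:
  assumes A: "smooth_atlas \<A>" "c \<in> \<A>" and B: "smooth_atlas \<B>" "d \<in> \<B>"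
    and k: "k \<in> \<C>" "open (fst k)" and S: "open S" and F: "Ck_map n (prod_atlas \<A> \<B>) S \<C> F"
    and U: "U = {z. fst z \<in> snd c ` fst c \<and> snd z \<in> snd d ` fst d \<and>
      (chart_inv c (fst z), chart_inv d (snd z)) \<in> S \<and> F (chart_inv c (fst z), chart_inv d (snd z)) \<in> fst k}"
  shows "open U" "Ck_on n U (\<lambda>z. snd k (F (chart_inv c (fst z), chart_inv d (snd z))))"
proof -
  define pc where "pc = (fst c \<times> fst d, map_prod (snd c) (snd d))"
  define j where "j z = (chart_inv c (fst z), chart_inv d (snd z))" for z
  have pc: "pc \<in> prod_atlas \<A> \<B>" unfolding pc_def prod_atlas_def using A B by blast
  have contF: "continuous_on S F" using F unfolding Ck_map_def by blast
  define W where "W = (snd c ` fst c) \<times> (snd d ` fst d)"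
  have W: "open W" unfolding W_def by (intro open_Times smooth_atlasD[OF A] smooth_atlasD[OF B])
  have "continuous_on W j" unfolding j_def W_def
    by (intro continuous_on_Pair continuous_on_compose2[OF smooth_atlasD(4)[OF A]]
        continuous_on_compose2[OF smooth_atlasD(4)[OF B]] continuous_intros) auto
  moreover have "open (S \<inter> F -` fst k)" by (rule continuous_open_preimage[OF contF S k(2)])
  ultimately have "open (W \<inter> j -` (S \<inter> F -` fst k))" using W continuous_open_preimage by blast
  moreover have Uj: "U = W \<inter> j -` (S \<inter> F -` fst k)" unfolding U W_def j_def by auto
  ultimately show "open U" by simp
  have inj: "inj_on (snd pc) (fst pc)"
    unfolding pc_def inj_on_def using smooth_atlasD(5)[OF A] smooth_atlasD(5)[OF B]
    by (auto simp: map_prod_def) metis+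
  have cij: "j z \<in> fst pc" "snd pc (j z) = z" if "z \<in> W" for z
    using that smooth_atlasD(6,7)[OF A] smooth_atlasD(6,7)[OF B] unfolding W_def j_def pc_def
    by (auto simp: mem_Times_iff)
  have jj: "j (snd pc w) = w" "snd pc w \<in> W" if "w \<in> fst pc" for w
    using that smooth_atlasD(5)[OF A] smooth_atlasD(5)[OF B] unfolding W_def j_def pc_def
    by (auto simp: mem_Times_iff)
  have img: "snd pc ` (S \<inter> fst pc \<inter> F -` fst k) = U"
  proof
    show "snd pc ` (S \<inter> fst pc \<inter> F -` fst k) \<subseteq> U" unfolding Uj using jj by auto
    show "U \<subseteq> snd pc ` (S \<inter> fst pc \<inter> F -` fst k)"
    proof
      fix z assume z: "z \<in> U"
      hence "j z \<in> S \<inter> fst pc \<inter> F -` fst k" "snd pc (j z) = z" using cij unfolding Uj by auto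
      thus "z \<in> snd pc ` (S \<inter> fst pc \<inter> F -` fst k)" by (metis imageI)
    qed
  qed
  have cinv: "chart_inv pc z = j z" if "z \<in> W" for z
    unfolding chart_inv_def using inv_into_f_eq[OF inj] cij[OF that] by blast
  have "Ck_on n (snd pc ` (S \<inter> fst pc \<inter> F -` fst k)) (snd k \<circ> F \<circ> chart_inv pc)"
    using F pc k(1) unfolding Ck_map_def by blast
  hence "Ck_on n U (snd k \<circ> F \<circ> chart_inv pc)" unfolding img .
  moreover have "(snd k \<circ> F \<circ> chart_inv pc) z = snd k (F (j z))" if "z \<in> U" for z
    using cinv that unfolding Uj by simp
  ultimately show "Ck_on n U (\<lambda>z. snd k (F (chart_inv c (fst z), chart_inv d (snd z))))"
    using Ck_on_cong[of U "snd k \<circ> F \<circ> chart_inv pc" "\<lambda>z. snd k (F (j z))" n] unfolding j_def by simp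
qed

text \<open>The set is relatively closed in the chart domain, but its closure in the manifold may
  leave the domain. An open set meeting the closure meets the set itself, hence the chart domain,
  and the chart turns the common part into an open subset of \<open>B\<close>.\<close>

lemma nowhere_dense_chart_preimage:
  assumes A: "smooth_atlas \<A>" "c \<in> \<A>" and B: "closed B" "interior B = {}"
  shows "interior (closure {x \<in> fst c. snd c x \<in> B}) = {}"
proof (rule ccontr)
  let ?S = "{x \<in> fst c. snd c x \<in> B}"
  assume ne: "interior (closure ?S) \<noteq> {}"
  define O' where "O' = interior (closure ?S) \<inter> fst c"
  have oO: "open O'" unfolding O'_def by (intro open_Int open_interior smooth_atlasD[OF A])
  have "interior (closure ?S) \<inter> closure ?S \<noteq> {}" using ne interior_subset by blast
  hence "interior (closure ?S) \<inter> ?S \<noteq> {}" using open_Int_closure_eq_empty[OF open_interior] by blast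
  hence neO: "O' \<noteq> {}" unfolding O'_def by blast
  have "snd c y \<in> B" if y: "y \<in> O'" for y
  proof (rule ccontr)
    assume nB: "snd c y \<notin> B"
    have "open (fst c \<inter> snd c -` (- B))"
      using B(1) by (intro continuous_open_preimage smooth_atlasD[OF A]) (simp add: open_Compl)
    moreover have "(fst c \<inter> snd c -` (- B)) \<inter> ?S = {}" by blast
    ultimately have "(fst c \<inter> snd c -` (- B)) \<inter> closure ?S = {}" using open_Int_closure_eq_empty by blast
    moreover have "y \<in> fst c" "y \<in> closure ?S" using y interior_subset unfolding O'_def by blast+
    ultimately show False using nB by blast
  qed
  hence sub: "snd c ` O' \<subseteq> B" by blast
  have "snd c ` O' = (snd c ` fst c) \<inter> chart_inv c -` O'"
    using smooth_atlasD(5-7)[OF A] unfolding O'_def by force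
  moreover have "open ((snd c ` fst c) \<inter> chart_inv c -` O')"
    by (intro continuous_open_preimage smooth_atlasD[OF A] oO)
  ultimately have "snd c ` O' \<subseteq> interior B" using sub by (intro interior_maximal) auto
  thus False using neO B(2) by blast
qed

section \<open>Partial derivatives of the family in charts\<close>

definition inr_blinfun :: "'b::real_normed_vector \<Rightarrow>\<^sub>L ('a::real_normed_vector \<times> 'b)" where
  "inr_blinfun = Blinfun (\<lambda>u. (0, u))"

lemma inr_blinfun_apply [simp]: "blinfun_apply inr_blinfun u = (0, u)"
  unfolding inr_blinfun_def
  by (subst bounded_linear_Blinfun_apply) (auto intro!: bounded_linear_Pair bounded_linear_zero bounded_linear_ident)

locale invariant_family =
  fixes \<X> :: "('x::t2_space, 'e::banach) chart set"
    and \<Y> :: "('y::t2_space, 'h::{real_inner, banach}) chart set"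
    and \<G> :: "('g::t2_space, 'm::banach) chart set"
    and G :: "('g, 'k) monoid_scheme"
    and act :: "'g \<Rightarrow> 'y \<Rightarrow> 'y"
    and A :: "('x \<times> 'y) set"
    and f :: "'x \<Rightarrow> 'y \<Rightarrow> real"
  assumes X: "smooth_atlas \<X>" and Y: "smooth_atlas \<Y>"
    and G: "lie_group \<G> G"
    and act: "group_action G UNIV act"
    and act_C1: "Ck_map 1 (prod_atlas \<G> \<Y>) UNIV \<Y> (\<lambda>(g, y). act g y)"
    and dim_D: "\<And>y y'. dim (orbit_tangent \<G> G \<Y> act y) = dim (orbit_tangent \<G> G \<Y> act y')"
    and A_open: "open A"
    and A_inv: "\<And>x y g. (x, y) \<in> A \<Longrightarrow> (x, act g y) \<in> A"
    and f_C2: "Ck_map 2 (prod_atlas \<X> \<Y>) A model_atlas (\<lambda>(x, y). f x y)"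
    and f_inv: "\<And>x y g. (x, y) \<in> A \<Longrightarrow> f x (act g y) = f x y"
    and hyp_a: "\<And>x\<^sub>0 y\<^sub>0. (x\<^sub>0, y\<^sub>0) \<in> A \<Longrightarrow> critical_point \<Y> (f x\<^sub>0) y\<^sub>0 \<Longrightarrow>
      fredholm_form (hessian \<Y> (f x\<^sub>0) y\<^sub>0)"
    and hyp_b: "\<And>x\<^sub>0 y\<^sub>0 v. (x\<^sub>0, y\<^sub>0) \<in> A \<Longrightarrow> critical_point \<Y> (f x\<^sub>0) y\<^sub>0 \<Longrightarrow>
      v \<in> form_kernel (hessian \<Y> (f x\<^sub>0) y\<^sub>0) - orbit_tangent \<G> G \<Y> act y\<^sub>0 \<Longrightarrow>
      \<exists>w. blinfun_apply (blinfun_apply (mixed_derivative \<X> \<Y> f x\<^sub>0 y\<^sub>0) w) v \<noteq> 0"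
begin

lemma atlas_G: "smooth_atlas \<G>" and group_G: "group G" and carrier_G: "carrier G = UNIV"
  and finite_dimensional_model: "finite_dimensional (UNIV :: 'm set)"
  using G unfolding lie_group_def by auto

lemma act_one: "act \<one>\<^bsub>G\<^esub> y = y"
  using group_action.id_eq_one[OF act] by (metis UNIV_I restrict_apply)

lemma act_mult: "act g (act h y) = act (g \<otimes>\<^bsub>G\<^esub> h) y"
  using group_action.composition_rule[OF act, of y g h] carrier_G by simp

lemma act_inv: "act (inv\<^bsub>G\<^esub> h) (act h y) = y" "act h (act (inv\<^bsub>G\<^esub> h) y) = y"
  using group.l_inv[OF group_G, of h] group.r_inv[OF group_G, of h] carrier_G
  by (simp_all add: act_mult act_one)

definition dom :: "('x, 'e) chart \<Rightarrow> ('y, 'h) chart \<Rightarrow> ('e \<times> 'h) set" where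
  "dom cx cy = {z. fst z \<in> snd cx ` fst cx \<and> snd z \<in> snd cy ` fst cy \<and>
     (chart_inv cx (fst z), chart_inv cy (snd z)) \<in> A}"

definition rep :: "('x, 'e) chart \<Rightarrow> ('y, 'h) chart \<Rightarrow> 'e \<times> 'h \<Rightarrow> real" where
  "rep cx cy z = f (chart_inv cx (fst z)) (chart_inv cy (snd z))"

definition dy :: "('x, 'e) chart \<Rightarrow> ('y, 'h) chart \<Rightarrow> 'e \<times> 'h \<Rightarrow> 'h \<Rightarrow>\<^sub>L real" where
  "dy cx cy z = fderiv (\<lambda>b. rep cx cy (fst z, b)) (snd z)"

text \<open>On vectors \<open>(0, u)\<close> this is the Hessian, on vectors \<open>(w, 0)\<close>
  the mixed derivative, so that a single derivative carries both assumptions (a) and (b).\<close>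

definition ddy :: "('x, 'e) chart \<Rightarrow> ('y, 'h) chart \<Rightarrow> 'e \<times> 'h \<Rightarrow> ('e \<times> 'h) \<Rightarrow>\<^sub>L 'h \<Rightarrow>\<^sub>L real" where
  "ddy cx cy z = fderiv (dy cx cy) z"

lemma in_dom:
  assumes "cx \<in> \<X>" "cy \<in> \<Y>" "x \<in> fst cx" "y \<in> fst cy" "(x, y) \<in> A"
  shows "(snd cx x, snd cy y) \<in> dom cx cy"
  using assms smooth_atlasD(5)[OF X] smooth_atlasD(5)[OF Y] unfolding dom_def by simp

lemma f_local:
  assumes cx: "cx \<in> \<X>" and cy: "cy \<in> \<Y>"
  shows open_dom: "open (dom cx cy)"
    and rep_deriv: "\<And>z. z \<in> dom cx cy \<Longrightarrow> ((\<lambda>b. rep cx cy (fst z, b)) has_derivative dy cx cy z) (at (snd z))"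
    and dy_deriv: "\<And>z. z \<in> dom cx cy \<Longrightarrow> (dy cx cy has_derivative ddy cx cy z) (at z)"
    and ddy_cont: "continuous_on (dom cx cy) (ddy cx cy)"
    and ddy_sym: "\<And>z u v. z \<in> dom cx cy \<Longrightarrow> ddy cx cy z (0, u) v = ddy cx cy z (0, v) u"
proof -
  have U: "dom cx cy = {z. fst z \<in> snd cx ` fst cx \<and> snd z \<in> snd cy ` fst cy \<and>
      (chart_inv cx (fst z), chart_inv cy (snd z)) \<in> A \<and>
      (\<lambda>(x, y). f x y) (chart_inv cx (fst z), chart_inv cy (snd z)) \<in> fst (UNIV, id)}"
    unfolding dom_def by simp
  have k: "(UNIV, id) \<in> (model_atlas :: (real, real) chart set)" "open (fst (UNIV :: real set, id :: real \<Rightarrow> real))"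
    unfolding model_atlas_def by auto
  show opn: "open (dom cx cy)" by (rule Ck_map_prod_chart(1)[OF X cx Y cy k A_open f_C2 U])
  have "Ck_on 2 (dom cx cy) (rep cx cy)"
    using Ck_map_prod_chart(2)[OF X cx Y cy k A_open f_C2 U] unfolding rep_def[abs_def] by simp
  then obtain F' F'' where F': "\<And>z. z \<in> dom cx cy \<Longrightarrow> (rep cx cy has_derivative blinfun_apply (F' z)) (at z)"
    and F'': "\<And>z. z \<in> dom cx cy \<Longrightarrow> (F' has_derivative blinfun_apply (F'' z)) (at z)"
    and cF'': "continuous_on (dom cx cy) F''"
    using Ck_on_2_derivatives[OF _ opn] by blast
  \<comment> \<open>Restricting a functional on the product to the second factor is a bounded linear
    operation, so the derivative of \<open>dy\<close> is \<open>R\<close> composed with the second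
    derivative of the representation.\<close>
  define R where "R = Blinfun (\<lambda>T :: ('e \<times> 'h) \<Rightarrow>\<^sub>L real. T o\<^sub>L inr_blinfun)"
  have R: "blinfun_apply R T = T o\<^sub>L inr_blinfun" for T
    unfolding R_def
    by (simp add: bounded_linear_Blinfun_apply bounded_bilinear.bounded_linear_left[OF bounded_bilinear_blinfun_compose])
  have d1: "((\<lambda>b. rep cx cy (fst z, b)) has_derivative blinfun_apply (R (F' z))) (at (snd z))"
    if z: "z \<in> dom cx cy" for z
  proof -
    have 1: "((\<lambda>b. (fst z, b)) has_derivative (\<lambda>u. (0, u))) (at (snd z))"
      by (auto intro!: derivative_eq_intros)
    have "((\<lambda>b. rep cx cy (fst z, b)) has_derivative (\<lambda>u. F' z (0, u))) (at (snd z))"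
      using has_derivative_compose[OF 1, of "rep cx cy" "F' z"] F'[OF z] by simp
    moreover have "blinfun_apply (R (F' z)) = (\<lambda>u. F' z (0, u))" by (auto simp: R)
    ultimately show ?thesis by simp
  qed
  have dy: "dy cx cy z = R (F' z)" if "z \<in> dom cx cy" for z
    unfolding dy_def by (rule fderiv_eq[OF d1[OF that]])
  show "((\<lambda>b. rep cx cy (fst z, b)) has_derivative dy cx cy z) (at (snd z))" if "z \<in> dom cx cy" for z
    using d1[OF that] unfolding dy[OF that] .
  have d2: "(dy cx cy has_derivative blinfun_apply (R o\<^sub>L F'' z)) (at z)" if z: "z \<in> dom cx cy" for z
  proof -
    have "((\<lambda>z. R (F' z)) has_derivative (\<lambda>w. R (F'' z w))) (at z)"
      by (rule bounded_linear.has_derivative[OF blinfun.bounded_linear_right F''[OF z]])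
    hence "(dy cx cy has_derivative (\<lambda>w. R (F'' z w))) (at z)"
      by (rule has_derivative_transform_within_open[OF _ opn z]) (simp add: dy)
    moreover have "blinfun_apply (R o\<^sub>L F'' z) = (\<lambda>w. R (F'' z w))" by auto
    ultimately show ?thesis by simp
  qed
  have ddy: "ddy cx cy z = R o\<^sub>L F'' z" if "z \<in> dom cx cy" for z
    unfolding ddy_def by (rule fderiv_eq[OF d2[OF that]])
  show "(dy cx cy has_derivative ddy cx cy z) (at z)" if "z \<in> dom cx cy" for z
    using d2[OF that] unfolding ddy[OF that] .
  have "continuous_on (dom cx cy) (\<lambda>z. R o\<^sub>L F'' z)" by (intro continuous_intros cF'')
  thus "continuous_on (dom cx cy) (ddy cx cy)" by (rule continuous_on_eq) (simp add: ddy)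
  show "ddy cx cy z (0, u) v = ddy cx cy z (0, v) u" if z: "z \<in> dom cx cy" for z u v
    using second_derivative_symmetric[OF opn z F' F''[OF z], of "(0, u)" "(0, v)"] by (simp add: ddy[OF z] R)
qed

lemma slice_deriv:
  assumes "cx \<in> \<X>" "cy \<in> \<Y>" "(a, b) \<in> dom cx cy"
  shows "((\<lambda>b. dy cx cy (a, b)) has_derivative blinfun_apply (ddy cx cy (a, b) o\<^sub>L inr_blinfun)) (at b)"
proof -
  have 1: "((\<lambda>b. (a, b)) has_derivative (\<lambda>u. (0, u))) (at b)"
    by (auto intro!: derivative_eq_intros)
  have "((\<lambda>b. dy cx cy (a, b)) has_derivative (\<lambda>u. ddy cx cy (a, b) (0, u))) (at b)"
    using has_derivative_compose[OF 1, of "dy cx cy" "ddy cx cy (a, b)"] dy_deriv[OF assms] by simp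
  moreover have "blinfun_apply (ddy cx cy (a, b) o\<^sub>L inr_blinfun) = (\<lambda>u. ddy cx cy (a, b) (0, u))" by auto
  ultimately show ?thesis by simp
qed

lemma critical_point_iff_dy_chart_at:
  assumes "cx \<in> \<X>" "x \<in> fst cx"
  shows "critical_point \<Y> (f x) y \<longleftrightarrow> dy cx (chart_at \<Y> y) (snd cx x, coord \<Y> y y) = 0"
  unfolding critical_point_def differential_real_def dy_def rep_def param_def o_def
  using smooth_atlasD(5)[OF X assms] by simp

text \<open>The chart around \<open>x\<close> is free, because \<open>x\<close> is held fixed in the
  Hessian; the chart around \<open>y\<close> has to be the one that identifies the tangent
  space.\<close>

lemma hessian_eq_ddy:
  assumes "cx \<in> \<X>" "x \<in> fst cx" "(x, y) \<in> A"
  shows "hessian \<Y> (f x) y = ddy cx (chart_at \<Y> y) (snd cx x, coord \<Y> y y) o\<^sub>L inr_blinfun"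
proof -
  have "fderiv (f x \<circ> param \<Y> y) = (\<lambda>b. dy cx (chart_at \<Y> y) (snd cx x, b))"
    unfolding dy_def rep_def param_def o_def using smooth_atlasD(5)[OF X assms(1,2)] by simp
  thus ?thesis
    unfolding hessian_def
    using slice_deriv[OF assms(1) chart_at(1)[OF Y], of "snd cx x" "coord \<Y> y y" y]
      in_dom[OF assms(1) chart_at(1)[OF Y] assms(2) chart_at(2)[OF Y] assms(3)]
    by (simp add: fderiv_eq coord_def)
qed

lemma mixed_derivative_eq_ddy:
  assumes "(x, y) \<in> A"
  shows "mixed_derivative \<X> \<Y> f x y w = ddy (chart_at \<X> x) (chart_at \<Y> y) (coord \<X> x x, coord \<Y> y y) (w, 0)"
proof -
  let ?cx = "chart_at \<X> x" and ?cy = "chart_at \<Y> y"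
  let ?z = "(coord \<X> x x, coord \<Y> y y)"
  have z: "?z \<in> dom ?cx ?cy"
    unfolding coord_def by (intro in_dom chart_at X Y assms)
  have 1: "((\<lambda>a. (a, coord \<Y> y y)) has_derivative (\<lambda>w. (w, 0))) (at (coord \<X> x x))"
    by (auto intro!: derivative_eq_intros)
  have "((\<lambda>a. dy ?cx ?cy (a, coord \<Y> y y)) has_derivative (\<lambda>w. ddy ?cx ?cy ?z (w, 0))) (at (coord \<X> x x))"
    using has_derivative_compose[OF 1, of "dy ?cx ?cy" "ddy ?cx ?cy ?z"] dy_deriv[OF chart_at(1)[OF X] chart_at(1)[OF Y] z]
    by simp
  moreover have "(\<lambda>a. dy ?cx ?cy (a, coord \<Y> y y)) = (\<lambda>x. differential_real \<Y> (f x) y) \<circ> param \<X> x"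
    unfolding dy_def rep_def differential_real_def param_def o_def by simp
  ultimately have d: "(((\<lambda>x. differential_real \<Y> (f x) y) \<circ> param \<X> x) has_derivative (\<lambda>w. ddy ?cx ?cy ?z (w, 0))) (at (coord \<X> x x))"
    by simp
  have "blinfun_apply (Blinfun (\<lambda>w. ddy ?cx ?cy ?z (w, 0))) = (\<lambda>w. ddy ?cx ?cy ?z (w, 0))"
    using has_derivative_bounded_linear[OF d] by (rule bounded_linear_Blinfun_apply)
  hence "mixed_derivative \<X> \<Y> f x y = Blinfun (\<lambda>w. ddy ?cx ?cy ?z (w, 0))"
    unfolding mixed_derivative_def using d by (intro fderiv_eq) simp
  thus ?thesis using \<open>blinfun_apply (Blinfun _) = _\<close> by simp
qed

section \<open>The group action in charts, and the invariance of critical points and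
  Hessians\<close>

lemma act_local:
  assumes cg: "cg \<in> \<G>" and cy: "cy \<in> \<Y>" "cy' \<in> \<Y>"
    and V: "V = {z. fst z \<in> snd cg ` fst cg \<and> snd z \<in> snd cy ` fst cy \<and>
      act (chart_inv cg (fst z)) (chart_inv cy (snd z)) \<in> fst cy'}"
  obtains \<alpha>' where "open V"
    "\<And>z. z \<in> V \<Longrightarrow> ((\<lambda>z. snd cy' (act (chart_inv cg (fst z)) (chart_inv cy (snd z))))
      has_derivative blinfun_apply (\<alpha>' z)) (at z)"
    "continuous_on V \<alpha>'"
proof -
  have U: "V = {z. fst z \<in> snd cg ` fst cg \<and> snd z \<in> snd cy ` fst cy \<and>
      (chart_inv cg (fst z), chart_inv cy (snd z)) \<in> UNIV \<and>
      (\<lambda>(g, y). act g y) (chart_inv cg (fst z), chart_inv cy (snd z)) \<in> fst cy'}"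
    unfolding V by simp
  note * = Ck_map_prod_chart[OF atlas_G cg Y cy(1) cy(2) smooth_atlasD(1)[OF Y cy(2)] open_UNIV act_C1 U]
  have "Ck_on 1 V (\<lambda>z. snd cy' (act (chart_inv cg (fst z)) (chart_inv cy (snd z))))" using *(2) by simp
  thus ?thesis by (rule Ck_on_1_derivative[OF _ *(1)]) (rule that[OF *(1)])
qed

lemma move_local:
  assumes cy: "cy \<in> \<Y>" "cy' \<in> \<Y>"
    and P: "P = {b. b \<in> snd cy ` fst cy \<and> act h (chart_inv cy b) \<in> fst cy'}"
  obtains \<psi>' where "open P"
    "\<And>b. b \<in> P \<Longrightarrow> ((\<lambda>b. snd cy' (act h (chart_inv cy b))) has_derivative blinfun_apply (\<psi>' b)) (at b)"
    "continuous_on P \<psi>'"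
proof -
  define cg where "cg = chart_at \<G> h"
  define m where "m = snd cg h"
  have cg: "cg \<in> \<G>" "h \<in> fst cg" unfolding cg_def by (intro chart_at atlas_G)+
  have m: "chart_inv cg m = h" "m \<in> snd cg ` fst cg"
    using smooth_atlasD(5)[OF atlas_G cg] cg(2) unfolding m_def by auto
  define V where "V = {z. fst z \<in> snd cg ` fst cg \<and> snd z \<in> snd cy ` fst cy \<and>
      act (chart_inv cg (fst z)) (chart_inv cy (snd z)) \<in> fst cy'}"
  obtain \<alpha>' where \<alpha>: "open V"
    "\<And>z. z \<in> V \<Longrightarrow> ((\<lambda>z. snd cy' (act (chart_inv cg (fst z)) (chart_inv cy (snd z))))
      has_derivative blinfun_apply (\<alpha>' z)) (at z)"
    "continuous_on V \<alpha>'"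
    using act_local[OF cg(1) cy V_def] by blast
  have PV: "P = (\<lambda>b. (m, b)) -` V" unfolding P V_def using m by auto
  show ?thesis
  proof
    show "open P" unfolding PV by (intro open_vimage \<alpha>(1) continuous_intros)
    show "((\<lambda>b. snd cy' (act h (chart_inv cy b))) has_derivative blinfun_apply (\<alpha>' (m, b) o\<^sub>L inr_blinfun)) (at b)"
      if b: "b \<in> P" for b
    proof -
      have 1: "((\<lambda>b. (m, b)) has_derivative (\<lambda>u. (0, u))) (at b)" by (auto intro!: derivative_eq_intros)
      have "(m, b) \<in> V" using b unfolding PV by simp
      from has_derivative_compose[OF 1 \<alpha>(2)[OF this]]
      have "((\<lambda>b. snd cy' (act h (chart_inv cy b))) has_derivative (\<lambda>u. \<alpha>' (m, b) (0, u))) (at b)"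
        by (simp add: m)
      moreover have "blinfun_apply (\<alpha>' (m, b) o\<^sub>L inr_blinfun) = (\<lambda>u. \<alpha>' (m, b) (0, u))" by auto
      ultimately show ?thesis by simp
    qed
    have "continuous_on P (\<lambda>b. \<alpha>' (m, b))"
      by (rule continuous_on_compose2[OF \<alpha>(3)]) (auto simp: PV intro!: continuous_intros)
    thus "continuous_on P (\<lambda>b. \<alpha>' (m, b) o\<^sub>L inr_blinfun)" by (intro continuous_intros)
  qed
qed

text \<open>Differentiating the invariance of \<open>f\<close> with respect to \<open>y\<close>,
  near the given point, relates the two differentials; \<open>second_derivative_transform\<close>
  differentiates this relation once more at a critical point. \<open>T\<close> is bijective because
  the action of the inverse of \<open>h\<close> inverts the moved chart map. With \<open>h\<close>
  the identity this is a change of chart.\<close>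

lemma transport:
  assumes xy: "(x, y) \<in> A" and cx: "cx \<in> \<X>" "x \<in> fst cx" and cy: "cy \<in> \<Y>" "y \<in> fst cy"
    and cy': "cy' \<in> \<Y>" "act h y \<in> fst cy'"
  obtains T where "bij (blinfun_apply T)"
    "dy cx cy (snd cx x, snd cy y) = dy cx cy' (snd cx x, snd cy' (act h y)) o\<^sub>L T"
    "\<And>u v. dy cx cy' (snd cx x, snd cy' (act h y)) = 0 \<Longrightarrow>
      ddy cx cy (snd cx x, snd cy y) (0, u) v = ddy cx cy' (snd cx x, snd cy' (act h y)) (0, T u) (T v)"
proof -
  define \<psi> where "\<psi> b = snd cy' (act h (chart_inv cy b))" for b
  define \<kappa> where "\<kappa> b = snd cy (act (inv\<^bsub>G\<^esub> h) (chart_inv cy' b))" for b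
  define P where "P = {b. b \<in> snd cy ` fst cy \<and> act h (chart_inv cy b) \<in> fst cy'}"
  define P1 where "P1 = {b. b \<in> snd cy' ` fst cy' \<and> act (inv\<^bsub>G\<^esub> h) (chart_inv cy' b) \<in> fst cy}"
  obtain \<psi>' where oP: "open P" and \<psi>: "\<And>b. b \<in> P \<Longrightarrow> (\<psi> has_derivative blinfun_apply (\<psi>' b)) (at b)"
    and \<psi>c: "continuous_on P \<psi>'"
    using move_local[OF cy(1) cy'(1) P_def] unfolding \<psi>_def by metis
  obtain \<kappa>' where oP1: "open P1" and \<kappa>: "\<And>b. b \<in> P1 \<Longrightarrow> (\<kappa> has_derivative blinfun_apply (\<kappa>' b)) (at b)"
    using move_local[OF cy'(1) cy(1) P1_def] unfolding \<kappa>_def by metis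
  have cinv: "chart_inv cx (snd cx x) = x" "chart_inv cy (snd cy y) = y"
    using smooth_atlasD(5)[OF X cx] smooth_atlasD(5)[OF Y cy] by auto
  have \<psi>P: "\<psi> b \<in> P1" "\<kappa> (\<psi> b) = b" if "b \<in> P" for b
    using that smooth_atlasD(5)[OF Y cy'(1)] smooth_atlasD(6,7)[OF Y cy(1)]
    unfolding P_def P1_def \<psi>_def \<kappa>_def by (auto simp: act_inv)
  have \<kappa>P: "\<kappa> b \<in> P" "\<psi> (\<kappa> b) = b" if "b \<in> P1" for b
    using that smooth_atlasD(5)[OF Y cy(1)] smooth_atlasD(6,7)[OF Y cy'(1)]
    unfolding P_def P1_def \<psi>_def \<kappa>_def by (auto simp: act_inv)
  define p where "p = snd cy y"
  have pP: "p \<in> P" unfolding P_def p_def using cy(2) cy'(2) cinv by simp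
  have \<psi>p: "\<psi> p = snd cy' (act h y)" unfolding \<psi>_def p_def cinv ..
  have inv1: "\<kappa>' (\<psi> p) (\<psi>' p u) = u" for u
  proof -
    have "((\<lambda>b. \<kappa> (\<psi> b)) has_derivative (\<lambda>u. \<kappa>' (\<psi> p) (\<psi>' p u))) (at p)"
      by (rule has_derivative_compose[OF \<psi>[OF pP] \<kappa>[OF \<psi>P(1)[OF pP]]])
    moreover have "((\<lambda>b. \<kappa> (\<psi> b)) has_derivative (\<lambda>u. u)) (at p)"
      by (rule has_derivative_transform_within_open[OF has_derivative_ident oP pP]) (simp add: \<psi>P)
    ultimately show ?thesis using has_derivative_unique by metis
  qed
  have inv2: "\<psi>' p (\<kappa>' (\<psi> p) u) = u" for u
  proof -
    have "\<kappa> (\<psi> p) = p" using \<psi>P(2)[OF pP] .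
    hence "((\<lambda>b. \<psi> (\<kappa> b)) has_derivative (\<lambda>u. \<psi>' p (\<kappa>' (\<psi> p) u))) (at (\<psi> p))"
      using has_derivative_compose[OF \<kappa>[OF \<psi>P(1)[OF pP]], of \<psi>] \<psi>[OF pP] by simp
    moreover have "((\<lambda>b. \<psi> (\<kappa> b)) has_derivative (\<lambda>u. u)) (at (\<psi> p))"
      by (rule has_derivative_transform_within_open[OF has_derivative_ident oP1 \<psi>P(1)[OF pP]]) (simp add: \<kappa>P)
    ultimately show ?thesis using has_derivative_unique by metis
  qed
  define a where "a = snd cx x"
  \<comment> \<open>An open set on which \<open>act h\<close> can be read in the two charts and the
    points stay in \<open>A\<close>, where the invariance of \<open>f\<close> applies.\<close>
  define P' where "P' = P \<inter> (\<lambda>b. (a, b)) -` dom cx cy"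
  have oP': "open P'" unfolding P'_def
    by (intro open_Int oP open_vimage open_dom cx(1) cy(1) continuous_intros)
  have pP': "p \<in> P'" unfolding P'_def a_def p_def using pP in_dom[OF cx(1) cy(1) cx(2) cy(2) xy] by (simp add: p_def)
  have A': "(x, chart_inv cy b) \<in> A" if "b \<in> P'" for b
    using that unfolding P'_def dom_def a_def by (simp add: cinv)
  have \<psi>dom: "(a, \<psi> b) \<in> dom cx cy'" if "b \<in> P'" for b
    using in_dom[OF cx(1) cy'(1) cx(2) _ A_inv[OF A'[OF that]], of h] that
    unfolding a_def \<psi>_def P'_def P_def by simp
  have eq: "dy cx cy (a, b) = dy cx cy' (a, \<psi> b) o\<^sub>L \<psi>' b" if b: "b \<in> P'" for b
  proof -
    have bP: "b \<in> P" using b unfolding P'_def by simp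
    have "((\<lambda>b. rep cx cy' (a, \<psi> b)) has_derivative (\<lambda>u. dy cx cy' (a, \<psi> b) (\<psi>' b u))) (at b)"
      using has_derivative_compose[OF \<psi>[OF bP], of "\<lambda>b. rep cx cy' (a, b)"]
        rep_deriv[OF cx(1) cy'(1) \<psi>dom[OF b]] by simp
    hence "((\<lambda>b. rep cx cy (a, b)) has_derivative (\<lambda>u. dy cx cy' (a, \<psi> b) (\<psi>' b u))) (at b)"
    proof (rule has_derivative_transform_within_open[OF _ oP' b])
      fix c assume c: "c \<in> P'"
      hence "act h (chart_inv cy c) \<in> fst cy'" unfolding P'_def P_def by simp
      thus "rep cx cy' (a, \<psi> c) = rep cx cy (a, c)"
        unfolding rep_def \<psi>_def a_def
        using f_inv[OF A'[OF c]] smooth_atlasD(5)[OF Y cy'(1)] by (simp add: cinv)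
    qed
    moreover have "blinfun_apply (dy cx cy' (a, \<psi> b) o\<^sub>L \<psi>' b) = (\<lambda>u. dy cx cy' (a, \<psi> b) (\<psi>' b u))" by auto
    ultimately show ?thesis unfolding dy_def[of cx cy "(a, b)"] by (intro fderiv_eq) simp
  qed
  show ?thesis
  proof
    show "bij (blinfun_apply (\<psi>' p))"
      by (rule o_bij[of "blinfun_apply (\<kappa>' (\<psi> p))"]) (auto simp: inv1 inv2)
    show "dy cx cy (snd cx x, snd cy y) = dy cx cy' (snd cx x, snd cy' (act h y)) o\<^sub>L \<psi>' p"
      using eq[OF pP'] unfolding a_def \<psi>p by (simp only: p_def)
    fix u v assume 0: "dy cx cy' (snd cx x, snd cy' (act h y)) = 0"
    have "(ddy cx cy (a, p) o\<^sub>L inr_blinfun) u v = (ddy cx cy' (a, \<psi> p) o\<^sub>L inr_blinfun) (\<psi>' p u) (\<psi>' p v)"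
    proof (rule second_derivative_transform[OF oP' pP' eq _ \<psi>[OF pP] slice_deriv slice_deriv])
      show "continuous_on P' \<psi>'" using \<psi>c by (rule continuous_on_subset) (auto simp: P'_def)
      show "(a, p) \<in> dom cx cy" using pP' unfolding P'_def by simp
      show "(a, \<psi> p) \<in> dom cx cy'" by (rule \<psi>dom[OF pP'])
      show "dy cx cy' (a, \<psi> p) = 0" using 0 unfolding a_def \<psi>p .
    qed (use cx cy cy' in auto)
    thus "ddy cx cy (snd cx x, snd cy y) (0, u) v
        = ddy cx cy' (snd cx x, snd cy' (act h y)) (0, \<psi>' p u) (\<psi>' p v)"
      unfolding a_def \<psi>p by (simp add: p_def)
  qed
qed

lemma dy_zero_iff:
  assumes "(x, y) \<in> A" "cx \<in> \<X>" "x \<in> fst cx" "cy \<in> \<Y>" "y \<in> fst cy" "cy' \<in> \<Y>" "act h y \<in> fst cy'"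
  shows "dy cx cy (snd cx x, snd cy y) = 0 \<longleftrightarrow> dy cx cy' (snd cx x, snd cy' (act h y)) = 0"
proof -
  obtain T where T: "bij (blinfun_apply T)"
    "dy cx cy (snd cx x, snd cy y) = dy cx cy' (snd cx x, snd cy' (act h y)) o\<^sub>L T"
    by (rule transport[OF assms]) (rule that)
  have "dy cx cy' (snd cx x, snd cy' (act h y)) = 0" if 0: "dy cx cy (snd cx x, snd cy y) = 0"
  proof (rule blinfun_eqI)
    fix v
    obtain u where "v = T u" using T(1) by (meson bij_pointE)
    thus "dy cx cy' (snd cx x, snd cy' (act h y)) v = blinfun_apply 0 v"
      using T(2) 0 by (metis blinfun_apply_blinfun_compose zero_blinfun.rep_eq)
  qed
  thus ?thesis using T(2) by auto
qed

lemma critical_point_iff_dy: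
  assumes "(x, y) \<in> A" "cx \<in> \<X>" "x \<in> fst cx" "cy \<in> \<Y>" "act h y \<in> fst cy"
  shows "critical_point \<Y> (f x) y \<longleftrightarrow> dy cx cy (snd cx x, snd cy (act h y)) = 0"
  using dy_zero_iff[OF assms(1-3) chart_at[OF Y] assms(4,5)] critical_point_iff_dy_chart_at[OF assms(2,3)]
  unfolding coord_def by simp

section \<open>Degenerate critical points\<close>

lemma subspace_orbit_tangent: "subspace (orbit_tangent \<G> G \<Y> act y)"
  unfolding orbit_tangent_def
  by (intro linear_subspace_image bounded_linear.linear[OF blinfun.bounded_linear_right] subspace_UNIV)

lemma finite_dimensional_orbit_tangent: "finite_dimensional (orbit_tangent \<G> G \<Y> act y)"
proof -
  obtain B :: "'m set" where B: "finite B" "UNIV \<subseteq> span B"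
    using finite_dimensional_model unfolding finite_dimensional_def by blast
  let ?\<beta> = "blinfun_apply (differential \<G> \<Y> (\<lambda>g. act g y) \<one>\<^bsub>G\<^esub>)"
  have "range ?\<beta> \<subseteq> ?\<beta> ` span B" using B(2) by blast
  also have "\<dots> = span (?\<beta> ` B)"
    by (intro linear_span_image[symmetric] bounded_linear.linear[OF blinfun.bounded_linear_right])
  finally show ?thesis unfolding orbit_tangent_def finite_dimensional_def using B(1) by blast
qed

abbreviation "m0 \<equiv> coord \<G> \<one>\<^bsub>G\<^esub> \<one>\<^bsub>G\<^esub>"

text \<open>The action near the identity of the group, read in charts. It is the identity in the
  second argument at \<open>m0\<close>, and its partial derivative in the first argument has the
  tangent space of the orbit as range; \<open>orbit_local\<close> provides both facts in the form
  that \<open>slice_through_point\<close> requires.\<close>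

definition orbit_map :: "('y, 'h) chart \<Rightarrow> 'm \<times> 'h \<Rightarrow> 'h" where
  "orbit_map cy z = snd cy (act (param \<G> \<one>\<^bsub>G\<^esub> (fst z)) (chart_inv cy (snd z)))"

definition orbit_dom :: "('y, 'h) chart \<Rightarrow> ('m \<times> 'h) set" where
  "orbit_dom cy = {z. fst z \<in> snd (chart_at \<G> \<one>\<^bsub>G\<^esub>) ` fst (chart_at \<G> \<one>\<^bsub>G\<^esub>) \<and>
     snd z \<in> snd cy ` fst cy \<and> act (param \<G> \<one>\<^bsub>G\<^esub> (fst z)) (chart_inv cy (snd z)) \<in> fst cy}"

lemma orbit_local:
  assumes cy: "cy = chart_at \<Y> y" and p_def: "p = coord \<Y> y y"
  obtains \<alpha>' where "open (orbit_dom cy)" "(m0, p) \<in> orbit_dom cy"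
    "\<And>z. z \<in> orbit_dom cy \<Longrightarrow> (orbit_map cy has_derivative blinfun_apply (\<alpha>' z)) (at z)"
    "continuous_on (orbit_dom cy) \<alpha>'"
    "\<And>b. (m0, b) \<in> orbit_dom cy \<Longrightarrow> orbit_map cy (m0, b) = b"
    "orbit_tangent \<G> G \<Y> act y = range (\<lambda>m. \<alpha>' (m0, p) (m, 0))"
proof -
  define cg where "cg = chart_at \<G> \<one>\<^bsub>G\<^esub>"
  define V where "V = orbit_dom cy"
  define \<alpha> where "\<alpha> = orbit_map cy"
  have cg: "cg \<in> \<G>" "\<one>\<^bsub>G\<^esub> \<in> fst cg" unfolding cg_def by (intro chart_at atlas_G)+
  have cyY: "cy \<in> \<Y>" "y \<in> fst cy" unfolding cy by (intro chart_at Y)+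
  have m0: "m0 \<in> snd cg ` fst cg" "chart_inv cg m0 = \<one>\<^bsub>G\<^esub>"
    using cg smooth_atlasD(5)[OF atlas_G cg] unfolding coord_def cg_def by auto
  have p: "p \<in> snd cy ` fst cy" "chart_inv cy p = y"
    using cyY smooth_atlasD(5)[OF Y cyY] unfolding p_def coord_def cy by auto
  have V': "V = {z. fst z \<in> snd cg ` fst cg \<and> snd z \<in> snd cy ` fst cy \<and>
      act (chart_inv cg (fst z)) (chart_inv cy (snd z)) \<in> fst cy}"
    unfolding V_def orbit_dom_def param_def cg_def ..
  obtain \<alpha>' where oV: "open V" and d: "\<And>z. z \<in> V \<Longrightarrow> (\<alpha> has_derivative blinfun_apply (\<alpha>' z)) (at z)"
    and c: "continuous_on V \<alpha>'"
    by (rule act_local[OF cg(1) cyY(1) cyY(1) V'])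
      (rule that, auto simp: \<alpha>_def orbit_map_def[abs_def] param_def cg_def)
  have z0: "(m0, p) \<in> V" unfolding V' using m0 p cyY by (simp add: act_one)
  have id: "\<alpha> (m0, b) = b" if "(m0, b) \<in> V" for b
    using that smooth_atlasD(7)[OF Y cyY(1)] unfolding \<alpha>_def orbit_map_def V' param_def cg_def[symmetric] by (simp add: m0 act_one)
  have "orbit_tangent \<G> G \<Y> act y = range (\<lambda>m. \<alpha>' (m0, p) (m, 0))"
  proof -
    have 1: "((\<lambda>m. (m, p)) has_derivative (\<lambda>m. (m, 0))) (at m0)" by (auto intro!: derivative_eq_intros)
    have "((\<lambda>m. \<alpha> (m, p)) has_derivative (\<lambda>m. \<alpha>' (m0, p) (m, 0))) (at m0)"
      by (rule has_derivative_compose[OF 1 d[OF z0]])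
    moreover have "(\<lambda>m. \<alpha> (m, p)) = coord \<Y> (act \<one>\<^bsub>G\<^esub> y) \<circ> (\<lambda>g. act g y) \<circ> param \<G> \<one>\<^bsub>G\<^esub>"
      unfolding \<alpha>_def orbit_map_def coord_def act_one cy[symmetric] by (auto simp: p)
    ultimately have D: "((coord \<Y> (act \<one>\<^bsub>G\<^esub> y) \<circ> (\<lambda>g. act g y) \<circ> param \<G> \<one>\<^bsub>G\<^esub>) has_derivative (\<lambda>m. \<alpha>' (m0, p) (m, 0))) (at m0)"
      by simp
    have B: "blinfun_apply (Blinfun (\<lambda>m. \<alpha>' (m0, p) (m, 0))) = (\<lambda>m. \<alpha>' (m0, p) (m, 0))"
      by (rule bounded_linear_Blinfun_apply[OF has_derivative_bounded_linear[OF D]])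
    have "differential \<G> \<Y> (\<lambda>g. act g y) \<one>\<^bsub>G\<^esub> = Blinfun (\<lambda>m. \<alpha>' (m0, p) (m, 0))"
      unfolding differential_def using D by (intro fderiv_eq) (simp add: B)
    thus ?thesis unfolding orbit_tangent_def by (simp add: B)
  qed
  thus ?thesis using that[of \<alpha>'] oV d c z0 id unfolding V_def \<alpha>_def by blast
qed

text \<open>Critical points come in orbits, so \<open>dy\<close> vanishes along the orbit of
  \<open>y\<close>; its derivative along a tangent vector of the orbit is the Hessian applied to
  that vector.\<close>

lemma orbit_tangent_subset_kernel:
  assumes xy: "(x, y) \<in> A" and crit: "critical_point \<Y> (f x) y"
  shows "orbit_tangent \<G> G \<Y> act y \<subseteq> form_kernel (hessian \<Y> (f x) y)"
proof
  fix v assume v: "v \<in> orbit_tangent \<G> G \<Y> act y"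
  define cx where "cx = chart_at \<X> x"
  define cy where "cy = chart_at \<Y> y"
  have cx: "cx \<in> \<X>" "x \<in> fst cx" unfolding cx_def by (intro chart_at X)+
  have cyY: "cy \<in> \<Y>" "y \<in> fst cy" unfolding cy_def by (intro chart_at Y)+
  define p where "p = coord \<Y> y y"
  define a where "a = snd cx x"
  have pinv: "chart_inv cy p = y"
    using smooth_atlasD(5)[OF Y cyY] unfolding p_def coord_def cy_def[symmetric] .
  define \<alpha> where "\<alpha> = orbit_map cy"
  define V where "V = orbit_dom cy"
  obtain \<alpha>' where oV: "open V" and z0: "(m0, p) \<in> V"
    and d: "\<And>z. z \<in> V \<Longrightarrow> (\<alpha> has_derivative blinfun_apply (\<alpha>' z)) (at z)"
    and id: "\<And>b. (m0, b) \<in> V \<Longrightarrow> \<alpha> (m0, b) = b"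
    and R: "orbit_tangent \<G> G \<Y> act y = range (\<lambda>m. \<alpha>' (m0, p) (m, 0))"
    by (rule orbit_local[OF cy_def p_def, folded V_def \<alpha>_def]) (rule that)
  obtain m where m: "v = \<alpha>' (m0, p) (m, 0)" using v unfolding R by blast
  have 1: "((\<lambda>m. (m, p)) has_derivative (\<lambda>m. (m, 0))) (at m0)" by (auto intro!: derivative_eq_intros)
  have d1: "((\<lambda>m. \<alpha> (m, p)) has_derivative (\<lambda>m. \<alpha>' (m0, p) (m, 0))) (at m0)"
    by (rule has_derivative_compose[OF 1 d[OF z0]])
  have dom: "(a, p) \<in> dom cx cy"
    unfolding a_def p_def coord_def cy_def[symmetric] by (rule in_dom[OF cx(1) cyY(1) cx(2) cyY(2) xy])
  have "((\<lambda>m. dy cx cy (a, \<alpha> (m, p))) has_derivative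
      (\<lambda>m. (ddy cx cy (a, p) o\<^sub>L inr_blinfun) (\<alpha>' (m0, p) (m, 0)))) (at m0)"
    by (rule has_derivative_compose[OF d1]) (unfold id[OF z0], rule slice_deriv[OF cx(1) cyY(1) dom])
  moreover have "((\<lambda>m. dy cx cy (a, \<alpha> (m, p))) has_derivative (\<lambda>_. 0)) (at m0)"
  proof (rule has_derivative_transform_within_open[OF has_derivative_const])
    show "open ((\<lambda>m. (m, p)) -` V)" by (intro open_vimage oV continuous_intros)
    show "m0 \<in> (\<lambda>m. (m, p)) -` V" using z0 by simp
    fix m assume "m \<in> (\<lambda>m. (m, p)) -` V"
    hence "act (param \<G> \<one>\<^bsub>G\<^esub> m) y \<in> fst cy" unfolding V_def orbit_dom_def by (simp add: pinv)
    thus "0 = dy cx cy (a, \<alpha> (m, p))"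
      using critical_point_iff_dy[OF xy cx cyY(1)] crit unfolding \<alpha>_def orbit_map_def a_def by (simp add: pinv)
  qed
  ultimately have "(\<lambda>m. (ddy cx cy (a, p) o\<^sub>L inr_blinfun) (\<alpha>' (m0, p) (m, 0))) = (\<lambda>_. 0)"
    by (rule has_derivative_unique)
  hence "(ddy cx cy (a, p) o\<^sub>L inr_blinfun) v = 0" unfolding m by metis
  thus "v \<in> form_kernel (hessian \<Y> (f x) y)"
    unfolding form_kernel_def hessian_eq_ddy[OF cx xy] a_def p_def cy_def by simp
qed

definition degenerate :: "'x \<Rightarrow> 'y \<Rightarrow> bool" where
  "degenerate x y \<longleftrightarrow> (x, y) \<in> A \<and> critical_point \<Y> (f x) y \<and> \<not> G_nondegenerate \<G> G \<Y> act (f x) y"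

text \<open>The kernel of the Hessian at \<open>y\<close> properly contains the tangent space of the
  orbit there, as otherwise \<open>y\<close> would be nondegenerate. Transported to
  \<open>act h y\<close>, it is too large to meet the orthogonal complement of the tangent space at
  \<open>y0\<close> trivially. Here \<open>y0\<close> is arbitrary; it will be the centre of a
  slice.\<close>

lemma degenerate_kernel_vector:
  assumes deg: "degenerate x y" and cx: "cx \<in> \<X>" "x \<in> fst cx" and cy: "cy \<in> \<Y>" "act h y \<in> fst cy"
  obtains w where "norm w = 1" "\<And>d. d \<in> orbit_tangent \<G> G \<Y> act y0 \<Longrightarrow> w \<bullet> d = 0"
    "dy cx cy (snd cx x, snd cy (act h y)) = 0" "ddy cx cy (snd cx x, snd cy (act h y)) (0, w) = 0"
proof -
  define H where "H = hessian \<Y> (f x) y"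
  define D where "D = orbit_tangent \<G> G \<Y> act y"
  define D0 where "D0 = orbit_tangent \<G> G \<Y> act y0"
  have xy: "(x, y) \<in> A" and crit: "critical_point \<Y> (f x) y"
    and nG: "\<not> G_nondegenerate \<G> G \<Y> act (f x) y" using deg unfolding degenerate_def by auto
  define c where "c = chart_at \<Y> y"
  have c: "c \<in> \<Y>" "y \<in> fst c" unfolding c_def by (intro chart_at Y)+
  have H: "H = ddy cx c (snd cx x, snd c y) o\<^sub>L inr_blinfun"
    unfolding H_def c_def hessian_eq_ddy[OF cx xy] coord_def ..
  have symH: "H u v = H v u" for u v
    unfolding H using ddy_sym[OF cx(1) c(1) in_dom[OF cx(1) c(1) cx(2) c(2) xy]] by simp
  have DK: "D \<subseteq> form_kernel H" unfolding D_def H_def by (rule orbit_tangent_subset_kernel[OF xy crit])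
  have "D \<noteq> form_kernel H"
  proof
    assume "D = form_kernel H"
    hence "\<exists>W. closed_complement D W \<and> strongly_nondegenerate_on W H"
      using strongly_nondegenerate_complement[of H] hyp_a[OF xy crit] symH unfolding H_def by simp
    thus False using nG unfolding G_nondegenerate_def D_def H_def by blast
  qed
  then obtain v where v: "v \<in> form_kernel H" "v \<notin> D" using DK by blast
  have subD: "subspace D" "finite_dimensional D" and subD0: "subspace D0" "finite_dimensional D0"
    unfolding D_def D0_def by (intro subspace_orbit_tangent finite_dimensional_orbit_tangent)+
  obtain B where B: "B \<subseteq> D" "independent B" "D \<subseteq> span B" "card B = dim D" using basis_exists by blast
  obtain B1 where "finite B1" "D \<subseteq> span B1" using subD(2) unfolding finite_dimensional_def by blast
  hence finB: "finite B" using independent_span_bound[OF _ B(2)] B(1) by blast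
  have "span B = D" using B subD(1) by (metis span_minimal subset_antisym)
  hence vB: "v \<notin> span B" using v(2) by simp
  \<comment> \<open>One element more than \<open>dim D\<close>, which equals \<open>dim D0\<close>
    by \<open>dim_D\<close>.\<close>
  define I where "I = insert v B"
  have indI: "independent I" unfolding I_def using vB B(2) by (simp add: independent_insert)
  have cardI: "finite I" "dim D0 < card I"
    using finB vB B(4) dim_D[of y y0] span_base[of v B] unfolding I_def D_def D0_def by (auto simp: card_insert_if)
  have IK: "I \<subseteq> form_kernel H" unfolding I_def using v(1) B(1) DK by blast
  let ?z = "(snd cx x, snd cy (act h y))"
  have dy0: "dy cx cy ?z = 0" using critical_point_iff_dy[OF xy cx cy] crit by simp
  obtain T where T: "bij (blinfun_apply T)"
    and Tdd: "\<And>u v. ddy cx c (snd cx x, snd c y) (0, u) v = ddy cx cy ?z (0, T u) (T v)"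
    by (rule transport[OF xy cx c cy]) (rule that, auto simp: dy0)
  have linT: "linear (blinfun_apply T)" by (rule bounded_linear.linear[OF blinfun.bounded_linear_right])
  have TK: "ddy cx cy ?z (0, T u) = 0" if u: "u \<in> form_kernel H" for u
  proof (rule blinfun_eqI)
    fix w
    obtain w' where "w = T w'" using T by (meson bij_pointE)
    thus "ddy cx cy ?z (0, T u) w = blinfun_apply 0 w"
      using u Tdd[of u w'] unfolding form_kernel_def H by simp
  qed
  obtain w where w: "w \<in> span (blinfun_apply T ` I)" "norm w = 1" "\<And>d. d \<in> D0 \<Longrightarrow> w \<bullet> d = 0"
    using independent_image_meets_complement[OF cardI(1) indI linT bij_is_inj[OF T] subD0 cardI(2)] by blast
  have "ddy cx cy ?z (0, w) = 0"
    using w(1)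
  proof (induction rule: span_induct_alt)
    case base
    show ?case using blinfun.zero_right[of "ddy cx cy ?z"] by (simp add: zero_prod_def)
  next
    case (step c u u')
    have "(0, c *\<^sub>R u + u') = c *\<^sub>R (0, u) + (0 :: 'e, u')" by simp
    hence "ddy cx cy ?z (0, c *\<^sub>R u + u') = c *\<^sub>R ddy cx cy ?z (0, u) + ddy cx cy ?z (0, u')"
      by (simp only: blinfun.add_right blinfun.scaleR_right)
    thus ?case using step TK IK by auto
  qed
  thus ?thesis using that w dy0 unfolding D0_def by blast
qed

text \<open>Around a non-critical point the differential stays nonzero. Around a critical one,
  moving along an orbit changes \<open>y\<close> but not \<open>x\<close>, so for the projection to
  \<open>X\<close> it is enough to catch one point of each orbit on the slice.\<close>

lemma degenerate_locally_nowhere_dense: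
  assumes xy: "(x0, y0) \<in> A"
  obtains U V where "open U" "open V" "x0 \<in> U" "y0 \<in> V"
    "interior (closure {x \<in> U. \<exists>y\<in>V. degenerate x y}) = {}"
proof -
  define cx where "cx = chart_at \<X> x0"
  define cy where "cy = chart_at \<Y> y0"
  have cx: "cx \<in> \<X>" "x0 \<in> fst cx" unfolding cx_def by (intro chart_at X)+
  have cy: "cy \<in> \<Y>" "y0 \<in> fst cy" unfolding cy_def by (intro chart_at Y)+
  define a where "a = snd cx x0"
  define p where "p = snd cy y0"
  have dom: "(a, p) \<in> dom cx cy" unfolding a_def p_def by (rule in_dom[OF cx(1) cy(1) cx(2) cy(2) xy])
  have oX: "open {x \<in> fst cx. dist (snd cx x) a < r}" for r
  proof -
    have "{x \<in> fst cx. dist (snd cx x) a < r} = fst cx \<inter> snd cx -` ball a r" by (auto simp: dist_commute)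
    thus ?thesis using continuous_open_preimage[OF smooth_atlasD(3,1)[OF X cx(1)] open_ball] by simp
  qed
  have oY: "open {y \<in> fst cy. dist (snd cy y) p < r}" for r
  proof -
    have "{y \<in> fst cy. dist (snd cy y) p < r} = fst cy \<inter> snd cy -` ball p r" by (auto simp: dist_commute)
    thus ?thesis using continuous_open_preimage[OF smooth_atlasD(3,1)[OF Y cy(1)] open_ball] by simp
  qed
  show ?thesis
  proof (cases "critical_point \<Y> (f x0) y0")
    case False
    hence nz: "dy cx cy (a, p) \<noteq> 0"
      using critical_point_iff_dy[OF xy cx cy(1), of "\<one>\<^bsub>G\<^esub>"] cy(2) unfolding a_def p_def by (simp add: act_one)
    have "isCont (dy cx cy) (a, p)" by (rule has_derivative_continuous[OF dy_deriv[OF cx(1) cy(1) dom]])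
    moreover have "norm (dy cx cy (a, p)) > 0" using nz by simp
    ultimately obtain r where r: "r > 0"
      and near: "\<And>z. dist z (a, p) < r \<Longrightarrow> dist (dy cx cy z) (dy cx cy (a, p)) < norm (dy cx cy (a, p))"
      unfolding continuous_at_eps_delta by blast
    have ne: "dy cx cy z \<noteq> 0" if "dist z (a, p) < r" for z
      using near[OF that] by (auto simp: dist_norm)
    define U where "U = {x \<in> fst cx. dist (snd cx x) a < r / 2}"
    define V where "V = {y \<in> fst cy. dist (snd cy y) p < r / 2}"
    have "\<not> degenerate x y" if "x \<in> U" "y \<in> V" for x y
    proof
      assume d: "degenerate x y"
      have "dist (snd cx x, snd cy y) (a, p) \<le> dist (snd cx x) a + dist (snd cy y) p"
        using norm_Pair_le[of "snd cx x - a" "snd cy y - p"] by (simp add: dist_norm)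
      also have "\<dots> < r" using that unfolding U_def V_def by auto
      finally have "dy cx cy (snd cx x, snd cy y) \<noteq> 0" by (rule ne)
      thus False
        using critical_point_iff_dy[of x y cx cy "\<one>\<^bsub>G\<^esub>"] d cx(1) cy(1) that unfolding U_def V_def degenerate_def
        by (auto simp: act_one)
    qed
    hence "{x \<in> U. \<exists>y\<in>V. degenerate x y} = {}" by blast
    moreover have "open U" "open V" "x0 \<in> U" "y0 \<in> V"
      unfolding U_def V_def using oX[of "r / 2"] oY[of "r / 2"] cx cy r by (auto simp: a_def p_def)
    ultimately show ?thesis by (intro that[of U V]) (simp_all only: closure_empty interior_empty)
  next
    case True
    define H where "H = hessian \<Y> (f x0) y0"
    define D where "D = orbit_tangent \<G> G \<Y> act y0"
    have H: "H = ddy cx cy (a, p) o\<^sub>L inr_blinfun"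
      unfolding H_def a_def p_def cy_def hessian_eq_ddy[OF cx xy] coord_def ..
    have finD: "finite_dimensional D" and subD: "subspace D"
        unfolding D_def by (intro subspace_orbit_tangent finite_dimensional_orbit_tangent)+
    obtain r where r: "r > 0"
      and cl: "closed (fst ` degenerate_zeros (dy cx cy) (ddy cx cy) (a, p) D r)" (is "closed ?B")
      and int: "interior (fst ` degenerate_zeros (dy cx cy) (ddy cx cy) (a, p) D r) = {}"
    proof (rule degenerate_zeros_nowhere_dense[OF open_dom[OF cx(1) cy(1)] dom dy_deriv[OF cx(1) cy(1)]
          ddy_cont[OF cx(1) cy(1)] ddy_sym[OF cx(1) cy(1)], where B = H and D = D])
      show "H u = ddy cx cy (a, p) (0, u)" for u unfolding H by simp
      show "fredholm_form H" unfolding H_def by (rule hyp_a[OF xy True])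
      show "subspace D" by (rule subD)
      show "D \<subseteq> form_kernel H" unfolding D_def H_def by (rule orbit_tangent_subset_kernel[OF xy True])
      show "\<exists>w. ddy cx cy (a, p) (w, 0) v \<noteq> 0" if "v \<in> form_kernel H - D" for v
        using hyp_b[OF xy True] that mixed_derivative_eq_ddy[OF xy]
        unfolding H_def D_def cx_def cy_def a_def p_def coord_def by simp
    qed (assumption | rule that)+
    define \<alpha> where "\<alpha> = orbit_map cy"
    define S where "S = orbit_dom cy"
    have pc: "p = coord \<Y> y0 y0" unfolding p_def coord_def cy_def ..
    obtain \<delta> where \<delta>: "\<delta> > 0" "\<And>b. dist b p < \<delta> \<Longrightarrow>
      (\<exists>m. (m, b) \<in> S \<and> dist (\<alpha> (m, b)) p < r \<and> (\<forall>d\<in>D. (\<alpha> (m, b) - p) \<bullet> d = 0))"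
    proof (rule orbit_local[OF cy_def pc, folded S_def \<alpha>_def])
      fix \<alpha>'
      assume "open S" "(m0, p) \<in> S" "\<And>z. z \<in> S \<Longrightarrow> (\<alpha> has_derivative blinfun_apply (\<alpha>' z)) (at z)"
        "continuous_on S \<alpha>'" "\<And>b. (m0, b) \<in> S \<Longrightarrow> \<alpha> (m0, b) = b"
        "orbit_tangent \<G> G \<Y> act y0 = range (\<lambda>m. \<alpha>' (m0, p) (m, 0))"
      from slice_through_point[OF this finD[unfolded D_def] r]
      show thesis using that unfolding D_def by blast
    qed
    define U where "U = {x \<in> fst cx. dist (snd cx x) a < r}"
    define V where "V = {y \<in> fst cy. dist (snd cy y) p < \<delta>}"
    have sub: "{x \<in> U. \<exists>y\<in>V. degenerate x y} \<subseteq> {x \<in> fst cx. snd cx x \<in> ?B}"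
    proof
      fix x assume "x \<in> {x \<in> U. \<exists>y\<in>V. degenerate x y}"
      then obtain y where xU: "x \<in> U" and yV: "y \<in> V" and deg: "degenerate x y" by blast
      have x: "x \<in> fst cx" using xU unfolding U_def by simp
      have y: "chart_inv cy (snd cy y) = y" using yV smooth_atlasD(5)[OF Y cy(1)] unfolding V_def by simp
      obtain m where m: "(m, snd cy y) \<in> S" "dist (\<alpha> (m, snd cy y)) p < r"
        "\<And>d. d \<in> D \<Longrightarrow> (\<alpha> (m, snd cy y) - p) \<bullet> d = 0"
        using \<delta>(2)[of "snd cy y"] yV unfolding V_def by blast
      define h where "h = param \<G> \<one>\<^bsub>G\<^esub> m"
      have h: "act h y \<in> fst cy" "\<alpha> (m, snd cy y) = snd cy (act h y)"
        using m(1) unfolding S_def orbit_dom_def \<alpha>_def orbit_map_def h_def by (auto simp: y)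
      obtain w where w: "norm w = 1" "\<And>d. d \<in> D \<Longrightarrow> w \<bullet> d = 0"
        "dy cx cy (snd cx x, snd cy (act h y)) = 0" "ddy cx cy (snd cx x, snd cy (act h y)) (0, w) = 0"
        by (rule degenerate_kernel_vector[OF deg cx(1) x cy(1) h(1), of y0, folded D_def]) (rule that)
      have "(snd cx x, snd cy (act h y)) \<in> degenerate_zeros (dy cx cy) (ddy cx cy) (a, p) D r"
        using xU m(2,3) w unfolding U_def h(2) degenerate_zeros_def by auto
      hence "snd cx x \<in> ?B" by (rule image_eqI[rotated]) simp
      thus "x \<in> {x \<in> fst cx. snd cx x \<in> ?B}" using x by blast
    qed
    have "interior (closure {x \<in> U. \<exists>y\<in>V. degenerate x y}) \<subseteq> interior (closure {x \<in> fst cx. snd cx x \<in> ?B})"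
      by (intro interior_mono closure_mono sub)
    also have "\<dots> = {}" by (rule nowhere_dense_chart_preimage[OF X cx(1) cl int])
    finally have "interior (closure {x \<in> U. \<exists>y\<in>V. degenerate x y}) = {}" by blast
    moreover have "open U" "open V" "x0 \<in> U" "y0 \<in> V"
      unfolding U_def V_def using oX oY cx cy r \<delta>(1) by (auto simp: a_def p_def)
    ultimately show ?thesis using that[of U V] by blast
  qed
qed

end

section \<open>Countable families of basic sets, and the passage from local to global\<close>

text \<open>Charts around the points of a countable dense set need not cover the manifold, but their
  union \<open>W\<close> is open and dense. The points of \<open>C\<close> in such a chart are dense
  in it, so balls of radius \<open>1 / (n + 1)\<close> around them, taken in the chart, form a
  basis.\<close>

lemma separable_smooth_atlas_local_basis:
  fixes \<X> :: "('x::t2_space, 'e::real_normed_vector) chart set"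
  assumes X: "smooth_atlas \<X>" and sep: "separable_space (euclidean :: 'x topology)"
  obtains W :: "'x set" and \<P> where "open W" "closure W = UNIV" "countable \<P>"
    "\<And>x U. x \<in> W \<Longrightarrow> open U \<Longrightarrow> x \<in> U \<Longrightarrow> \<exists>P\<in>\<P>. x \<in> P \<and> P \<subseteq> U"
proof -
  obtain C :: "'x set" where C: "countable C" "closure C = UNIV"
    using sep unfolding separable_space_def by auto
  define W where "W = (\<Union>q\<in>C. fst (chart_at \<X> q))"
  define N where "N q q' n = {x \<in> fst (chart_at \<X> q). dist (coord \<X> q x) (coord \<X> q q') < 1 / real (Suc n)}"
    for q q' and n :: nat
  define \<P> where "\<P> = (\<lambda>(q, q', n). N q q' n) ` (C \<times> C \<times> UNIV)"
  have oW: "open W" unfolding W_def by (intro open_UN ballI smooth_atlasD[OF X] chart_at X)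
  have dW: "closure W = UNIV"
  proof -
    have "C \<subseteq> W" unfolding W_def using chart_at(2)[OF X] by blast
    thus ?thesis using C(2) closure_mono by blast
  qed
  have cP: "countable \<P>" unfolding \<P>_def using C(1) by simp
  have bP: "\<exists>P\<in>\<P>. x \<in> P \<and> P \<subseteq> U" if x: "x \<in> W" and U: "open U" "x \<in> U" for x U
  proof -
    obtain q where q: "q \<in> C" "x \<in> fst (chart_at \<X> q)" using x unfolding W_def by blast
    define c where "c = chart_at \<X> q"
    have c: "c \<in> \<X>" unfolding c_def by (rule chart_at[OF X])
    have co: "coord \<X> q = snd c" unfolding coord_def c_def ..
    have xc: "x \<in> fst c" using q(2) unfolding c_def .
    have "snd c ` (U \<inter> fst c) = (snd c ` fst c) \<inter> chart_inv c -` U"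
      using smooth_atlasD(5-7)[OF X c] by force
    moreover have "open ((snd c ` fst c) \<inter> chart_inv c -` U)"
      by (rule continuous_open_preimage[OF smooth_atlasD(4,2)[OF X c] U(1)])
    ultimately have "open (snd c ` (U \<inter> fst c))" by simp
    then obtain e where e: "e > 0" "ball (snd c x) e \<subseteq> snd c ` (U \<inter> fst c)"
      using xc U(2) openE by blast
    \<comment> \<open>Half of \<open>e\<close>, because the basic set is a ball around
      \<open>q'\<close> and not around \<open>x\<close>.\<close>
    obtain n where n: "1 / real (Suc n) < e / 2"
      using e(1) nat_approx_posE[of "e / 2"] by auto
    have "open (fst c \<inter> snd c -` ball (snd c x) (1 / real (Suc n)))"
      by (rule continuous_open_preimage[OF smooth_atlasD(3,1)[OF X c] open_ball])
    moreover have "x \<in> fst c \<inter> snd c -` ball (snd c x) (1 / real (Suc n))" using xc by simp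
    moreover have "x \<in> closure C" using C(2) by simp
    ultimately obtain q' where q': "q' \<in> C" "q' \<in> fst c" "dist (snd c x) (snd c q') < 1 / real (Suc n)"
      using open_Int_closure_eq_empty[of "fst c \<inter> snd c -` ball (snd c x) (1 / real (Suc n))" C] by auto
    have "N q q' n \<in> \<P>" unfolding \<P>_def using q(1) q'(1) by (intro image_eqI[of _ _ "(q, q', n)"]) auto
    moreover have "x \<in> N q q' n" unfolding N_def co c_def[symmetric] using xc q'(3) by simp
    moreover have "N q q' n \<subseteq> U"
    proof
      fix z assume z: "z \<in> N q q' n"
      hence zc: "z \<in> fst c" "dist (snd c z) (snd c q') < 1 / real (Suc n)"
        unfolding N_def co c_def[symmetric] by auto
      have "dist (snd c x) (snd c z) \<le> dist (snd c x) (snd c q') + dist (snd c z) (snd c q')"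
        by (rule dist_triangle2)
      also have "\<dots> < e" using zc(2) q'(3) n by linarith
      finally have "snd c z \<in> snd c ` (U \<inter> fst c)" using e(2) by auto
      then obtain z' where "z' \<in> U" "z' \<in> fst c" "snd c z = snd c z'" by blast
      thus "z \<in> U" using smooth_atlasD(5)[OF X c] zc(1) by metis
    qed
    ultimately show ?thesis by blast
  qed
  show ?thesis by (rule that[OF oW dW cP bP])
qed

theorem theorem2p7:
  fixes \<X> :: "('x::t2_space, 'e::banach) chart set"
    and \<Y> :: "('y::t2_space, 'h::{real_inner, banach}) chart set"
    and \<G> :: "('g::t2_space, 'm::banach) chart set"
    and G :: "('g, 'k) monoid_scheme"
    and act :: "'g \<Rightarrow> 'y \<Rightarrow> 'y"
    and A :: "('x \<times> 'y) set"
    and f :: "'x \<Rightarrow> 'y \<Rightarrow> real"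
    and k :: nat
  assumes X: "smooth_atlas \<X>" "separable_space (euclidean :: 'x topology)"
    and Y: "smooth_atlas \<Y>" "second_countable (euclidean :: 'y topology)"
    and G: "lie_group \<G> G"
    and act: "group_action G UNIV act"
    and act_C1: "Ck_map 1 (prod_atlas \<G> \<Y>) UNIV \<Y> (\<lambda>(g, y). act g y)"
    and dim_D: "\<And>y y'. dim (orbit_tangent \<G> G \<Y> act y) = dim (orbit_tangent \<G> G \<Y> act y')"
    and A_open: "open A"
    and A_inv: "\<And>x y g. (x, y) \<in> A \<Longrightarrow> (x, act g y) \<in> A"
    and k: "k \<ge> 2"
    and f_Ck: "Ck_map k (prod_atlas \<X> \<Y>) A model_atlas (\<lambda>(x, y). f x y)"
    and f_inv: "\<And>x y g. (x, y) \<in> A \<Longrightarrow> f x (act g y) = f x y"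
    and hyp_a: "\<And>x\<^sub>0 y\<^sub>0. (x\<^sub>0, y\<^sub>0) \<in> A \<Longrightarrow> critical_point \<Y> (f x\<^sub>0) y\<^sub>0 \<Longrightarrow>
      fredholm_form (hessian \<Y> (f x\<^sub>0) y\<^sub>0)"
    and hyp_b: "\<And>x\<^sub>0 y\<^sub>0 v. (x\<^sub>0, y\<^sub>0) \<in> A \<Longrightarrow> critical_point \<Y> (f x\<^sub>0) y\<^sub>0 \<Longrightarrow>
      v \<in> form_kernel (hessian \<Y> (f x\<^sub>0) y\<^sub>0) - orbit_tangent \<G> G \<Y> act y\<^sub>0 \<Longrightarrow>
      \<exists>w. blinfun_apply (blinfun_apply (mixed_derivative \<X> \<Y> f x\<^sub>0 y\<^sub>0) w) v \<noteq> 0"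
  shows "generic_in (top_of_set (fst ` A))
    {x \<in> fst ` A. G_Morse \<G> G \<Y> act {y. (x, y) \<in> A} (f x)}"
proof -
  have f_C2: "Ck_map 2 (prod_atlas \<X> \<Y>) A model_atlas (\<lambda>(x, y). f x y)"
    using f_Ck Ck_on_le[OF _ k] unfolding Ck_map_def by blast
  interpret F: invariant_family \<X> \<Y> \<G> G act A f
    by (rule invariant_family.intro)
      (fact X(1) Y(1) G act act_C1 dim_D A_open A_inv f_C2 f_inv hyp_a hyp_b)+
  obtain W :: "'x set" and \<P> where W: "open W" "closure W = UNIV" and \<P>: "countable \<P>"
    "\<And>x U. x \<in> W \<Longrightarrow> open U \<Longrightarrow> x \<in> U \<Longrightarrow> \<exists>P\<in>\<P>. x \<in> P \<and> P \<subseteq> U"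
    by (rule separable_smooth_atlas_local_basis[OF X]) (rule that)
  obtain \<B> :: "'y set set" where \<B>: "countable \<B>" "\<And>U y. open U \<Longrightarrow> y \<in> U \<Longrightarrow> \<exists>V\<in>\<B>. y \<in> V \<and> V \<subseteq> U"
    using Y(2) unfolding second_countable_def by auto
  define S where "S P V = {x \<in> P. \<exists>y\<in>V. F.degenerate x y}" for P V
  \<comment> \<open>The pairs are selected by the local property itself. Every degenerate
    \<open>(x, y)\<close> with \<open>x \<in> W\<close> lies in a good pair, because the
    neighbourhoods given by \<open>degenerate_locally_nowhere_dense\<close> can be shrunk to basic
    sets.\<close>
  define good where "good = {(P, V) \<in> \<P> \<times> \<B>. interior (closure (S P V)) = {}}"
  \<comment> \<open>\<open>W\<close> contributes one of the dense open sets: it keeps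
    \<open>x\<close> where \<open>\<P>\<close> is a basis, and it makes the family nonempty, as the
    enumeration by \<open>from_nat_into\<close> demands.\<close>
  define \<W> where "\<W> = insert (W \<inter> fst ` A) ((\<lambda>(P, V). fst ` A - closure (S P V)) ` good)"
  have "countable good" unfolding good_def by (rule countable_subset[of _ "\<P> \<times> \<B>"]) (use \<P>(1) \<B>(1) in auto)
  hence "countable \<W>" unfolding \<W>_def by simp
  moreover have "\<W> \<noteq> {}" unfolding \<W>_def by simp
  ultimately have rng: "range (from_nat_into \<W>) = \<W>" by (intro range_from_nat_into)
  have oA: "open (fst ` A)" by (rule open_image_fst[OF A_open])
  have dense: "openin (top_of_set (fst ` A)) T \<and> top_of_set (fst ` A) closure_of T = topspace (top_of_set (fst ` A))"
    if T: "T \<in> \<W>" for T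
  proof -
    obtain R where R: "open R" "closure R = UNIV" "T = fst ` A \<inter> R"
    proof -
      consider "T = W \<inter> fst ` A" | P V where "(P, V) \<in> good" "T = fst ` A - closure (S P V)"
        using T unfolding \<W>_def by auto
      thus ?thesis
      proof cases
        case 1
        thus ?thesis using that[of W] W by blast
      next
        case 2
        have "closure (- closure (S P V)) = UNIV"
          using 2(1) unfolding good_def closure_complement by simp
        thus ?thesis using that[of "- closure (S P V)"] 2(2) by (auto simp: open_Compl)
      qed
    qed
    have "fst ` A \<subseteq> closure T"
    proof -
      have "fst ` A \<inter> closure R \<subseteq> closure (fst ` A \<inter> R)" by (rule open_Int_closure_subset[OF oA])
      thus ?thesis using R by simp
    qed
    moreover have "fst ` A \<inter> T = T" using R(3) by blast
    ultimately show ?thesis using R by (auto simp: closure_of_subtopology openin_open)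
  qed
  have "(\<Inter>n. from_nat_into \<W> n) \<subseteq> {x \<in> fst ` A. G_Morse \<G> G \<Y> act {y. (x, y) \<in> A} (f x)}"
  proof
    fix x assume "x \<in> (\<Inter>n. from_nat_into \<W> n)"
    hence x: "x \<in> T" if "T \<in> \<W>" for T using that rng by (metis INT_E UNIV_I imageE)
    have xW: "x \<in> W" "x \<in> fst ` A" using x[of "W \<inter> fst ` A"] unfolding \<W>_def by auto
    have "\<not> F.degenerate x y" for y
    proof
      assume d: "F.degenerate x y"
      hence "(x, y) \<in> A" unfolding F.degenerate_def by simp
      then obtain U V where UV: "open U" "open V" "x \<in> U" "y \<in> V" "interior (closure (S U V)) = {}"
        unfolding S_def by (rule F.degenerate_locally_nowhere_dense)
      obtain P where P: "P \<in> \<P>" "x \<in> P" "P \<subseteq> U" using \<P>(2)[OF xW(1) UV(1,3)] by blast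
      obtain V' where V': "V' \<in> \<B>" "y \<in> V'" "V' \<subseteq> V" using \<B>(2)[OF UV(2,4)] by blast
      have "S P V' \<subseteq> S U V" unfolding S_def using P(3) V'(3) by blast
      hence "interior (closure (S P V')) \<subseteq> {}" unfolding UV(5)[symmetric] by (intro interior_mono closure_mono)
      hence "(P, V') \<in> good" unfolding good_def using P(1) V'(1) by blast
      hence "fst ` A - closure (S P V') \<in> \<W>" unfolding \<W>_def by force
      hence "x \<notin> closure (S P V')" using x by blast
      moreover have "x \<in> S P V'" unfolding S_def using P(2) V'(2) d by blast
      ultimately show False using closure_subset by blast
    qed
    thus "x \<in> {x \<in> fst ` A. G_Morse \<G> G \<Y> act {y. (x, y) \<in> A} (f x)}"
      using xW(2) unfolding G_Morse_def F.degenerate_def by blast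
  qed
  thus ?thesis
    unfolding generic_in_def
  proof (intro conjI exI[of _ "from_nat_into \<W>"] allI)
    fix n
    have "from_nat_into \<W> n \<in> \<W>" using rng by blast
    thus "openin (top_of_set (fst ` A)) (from_nat_into \<W> n)"
      "top_of_set (fst ` A) closure_of from_nat_into \<W> n = topspace (top_of_set (fst ` A))"
      using dense by blast+
  qed auto
qed

end
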